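(* Let $n\ge1$ and $d_1,\ldots,d_n\ge0$ be integers. With $J_{d_1,\ldots,d_n}(q,z_1,\ldots,z_n)$ the normalized scalar product of the Whittaker and dual Whittaker vectors, $$ J_{d_1,\ldots,d_n}(q,z_1,\ldots,z_n)=v^{-(\beta,\beta)/2+(\lambda,\beta)}(\theta^\lambda_\beta,\bar\theta^\lambda_\beta),\qquad \beta=\sum_{i=1}^nd_i\alpha_i,\quad z_i=q^{-(\lambda+\rho,\alpha_i)},\quad q=v^2, $$ one has $$ \begin{aligned} J_{d_1,\ldots,d_n}(q,z_1,\ldots,z_n)&=\sum_{(m_{k,i})}(-1)^{\sum_{i=1}^n d_i-\sum_{i=0}^{n-1}m_{i,i}}\;q^{p(m)}\;\prod_{j=1}^n z_j^{\sum_{k=0}^{j-1}\sum_{i=j+1}^n m_{k,i-1}}\\ &\times\prod_{0\le k<i\le n}\frac{1}{(q)_{m_{k,i-1}-m_{k,i}}}\times\prod_{0\le k<l<i\le n}\frac{1}{(q^{m_{k,i}-m_{l,i-1}}z_{k,l})_{m_{k,i-1}-m_{k,i}}}\\ &\times\prod_{0\le k<l\le i\le n}\frac{1}{(q^{m_{k,i}-m_{l,i}+1}z_{k,l})_{m_{k,i-1}-m_{k,i}}}, \end{aligned} $$ where $$ p(m)=-\sum_{0\le k<l\le i\le n-1}m_{k,i}m_{l,i}+\sum_{0\le k<l<i\le n-1}m_{k,i}m_{l,i-1}+\frac12\sum_{0\le k<i\le n-1}m_{k,i}(m_{k,i}-1) $$ and the sum is over all non-negative integers $m_{k,i}$ ($0\le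 k\le i\le n$) satisfying $0=m_{k,n}\le m_{k,n-1}\le\cdots\le m_{k,k}$ ($0\le k\le n$) and $\sum_{k=0}^{i-1}m_{k,i-1}=d_i$ ($1\le i\le n$).
   Context: Notation: $(x)_m=\prod_{i=1}^m(1-q^{i-1}x)$; $z_{k,l}=\prod_{j=k+1}^l z_j$ for $0\le k<l\le n$. $\epsilon_0,\ldots,\epsilon_n$ are orthonormal for $(\ ,\ )$; $\alpha_i=\epsilon_{i-1}-\epsilon_i$, $\omega_i=\epsilon_0+\cdots+\epsilon_{i-1}$ ($1\le i\le n$), $\rho=\sum_{i=1}^n\omega_i$, $Q^+=\bigoplus_{i=1}^n\mathbb{Z}_{\ge0}\alpha_i$. The weight $\lambda=\sum_{k=0}^n\lambda_k\epsilon_k$ is generic: $v,v^{\lambda_0},\ldots,v^{\lambda_n}$ are algebraically independent, and the base field contains them. $U_v(\mathfrak{gl}_{n+1})$ has generators $E_i,F_i$ ($1\le i\le n$), $v^{\pm\epsilon_i}$ ($0\le i\le n$) with standard relations: the $v^{\pm\epsilon_i}$ commute, $v^{\epsilon_i}E_jv^{-\epsilon_i}=v^{(\epsilon_i,\alpha_j)}E_j$, $v^{\epsilon_i}F_jv^{-\epsilon_i}=v^{-(\epsilon_i,\alpha_j)}F_j$, $[E_i,F_j]=\delta_{ij}(K_i-K_i^{-1})/(v-v^{-1})$, $K_i=v^{\epsilon_{i-1}-\epsilon_i}$, and the $q$-Serre relations. $U_{v^{-1}}(\mathfrak{gl}_{n+1})$ is the same algebra with $v$ replaced by $v^{-1}$;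 its generators are denoted $\bar E_i,\bar F_i,\bar v^{\pm\epsilon_i}$, and $\bar K_i=\bar v^{\epsilon_{i-1}-\epsilon_i}$. $\mathcal V^\lambda$ is the Verma module over $U_v(\mathfrak{gl}_{n+1})$ generated by $\mathbf{1}^\lambda$ with $E_i\mathbf{1}^\lambda=0$, $v^{\epsilon_i}\mathbf{1}^\lambda=v^{\lambda_i}\mathbf{1}^\lambda$. $\overline{\mathcal V}^\lambda$ is the Verma module over $U_{v^{-1}}(\mathfrak{gl}_{n+1})$ generated by $\bar{\mathbf{1}}^\lambda$ with $\bar E_i\bar{\mathbf{1}}^\lambda=0$, $\bar v^{\epsilon_i}\bar{\mathbf{1}}^\lambda=v^{-\lambda_i}\bar{\mathbf{1}}^\lambda$. For $\beta\in Q^+$, $(\mathcal V^\lambda)_\beta$ (resp. $(\overline{\mathcal V}^\lambda)_\beta$) is the subspace on which each $K_i$ (resp. $\bar K_i$) acts by $v^{(\alpha_i,\lambda-\beta)}$ (resp. $v^{-(\alpha_i,\lambda-\beta)}$). The Whittaker vector $\theta^\lambda=\sum_\beta\theta^\lambda_\beta\in\prod_{\beta\in Q^+}(\mathcal V^\lambda)_\beta$ is the unique element with $\theta^\lambda_0=\mathbf{1}^\lambda$ and $E_iK_i^{i-1}\theta^\lambda=\frac{1}{1-v^2}\theta^\lambda$ ($1\le i\le n$). The dual Whittaker vector $\bar\theta^\lambda=\sum_\beta\bar\theta^\lambda_\beta\in\prod_{\beta\in Q^+}(\overline{\mathcal V}^\lambda)_\beta$ is the unique element with $\bar\theta^\lambda_0=\bar{\mathbf{1}}^\lambda$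 and $\bar E_i\bar K_i^{i-1}\bar\theta^\lambda=\frac{1}{1-v^{-2}}\bar\theta^\lambda$ ($1\le i\le n$). The Shapovalov pairing $(\ ,\ ):\mathcal V^\lambda\times\overline{\mathcal V}^\lambda\to$ (base field) is the unique non-degenerate bilinear pairing with $(\mathbf{1}^\lambda,\bar{\mathbf{1}}^\lambda)=1$ and $(xw,w')=(w,\sigma(x)w')$ for all $x\in U_v(\mathfrak{gl}_{n+1})$, where $\sigma:U_v(\mathfrak{gl}_{n+1})\to U_{v^{-1}}(\mathfrak{gl}_{n+1})$ is the linear anti-isomorphism $E_i\mapsto\bar F_i$, $F_i\mapsto\bar E_i$, $v^{\epsilon_i}\mapsto\bar v^{-\epsilon_i}$ (so $K_i\mapsto\bar K_i^{-1}$). The scalar product defining $J_{d_1,\ldots,d_n}$ depends on $\lambda$ only through the $z_i$ and is a rational function of $q,z_1,\ldots,z_n$. *)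

theory Defs
  imports Complex_Main "HOL-Library.Poly_Mapping" "HOL-Algebra.QuotRing"
begin

section \<open>The free associative algebra\<close>

text \<open>
  The free algebra on a set of letters is the monoid algebra of the monoid of words; the wrapper
  type only serves to make concatenation the additive monoid structure expected by
  \<^typ>\<open>'a \<Rightarrow>\<^sub>0 'b\<close>, whose product is convolution.
\<close>

datatype 'a word = Word (letters: "'a list")

instantiation word :: (type) monoid_add
begin

definition zero_word :: "'a word" where
  "0 = Word []"

definition plus_word :: "'a word \<Rightarrow> 'a word \<Rightarrow> 'a word" where
  "u + w = Word (letters u @ letters w)"

instance
  by standard (simp_all add: zero_word_def plus_word_def)

end

text \<open>
  \<open>EE i\<close> and \<open>FF i\<close> stand for $E_i$, $F_i$; \<open>VV i\<close> and \<open>VI i\<close> for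
  $v^{\epsilon_i}$, $v^{-\epsilon_i}$.
\<close>

datatype gl_gen = EE nat | FF nat | VV nat | VI nat

definition gl_gens :: "nat \<Rightarrow> gl_gen set" where
  "gl_gens n = EE ` {1..n} \<union> FF ` {1..n} \<union> VV ` {0..n} \<union> VI ` {0..n}"

type_synonym 'a free_poly = "gl_gen word \<Rightarrow>\<^sub>0 'a"

definition gen :: "gl_gen \<Rightarrow> 'a::field free_poly" where
  "gen g = Poly_Mapping.single (Word [g]) 1"

definition const :: "'a::field \<Rightarrow> 'a free_poly" where
  "const c = Poly_Mapping.single 0 c"

definition free_alg :: "nat \<Rightarrow> 'a::field free_poly ring" where
  "free_alg n =
    \<lparr>carrier = {p. \<forall>w \<in> Poly_Mapping.keys p. set (letters w) \<subseteq> gl_gens n},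
     mult = (*), one = 1, zero = 0, add = (+)\<rparr>"

lemma free_alg_simps [simp]:
  "mult (free_alg n) = (*)" "one (free_alg n) = 1"
  "zero (free_alg n) = 0" "add (free_alg n) = (+)"
  by (simp_all add: free_alg_def)

lemma free_alg_carrier:
  "p \<in> carrier (free_alg n) \<longleftrightarrow> (\<forall>w \<in> Poly_Mapping.keys p. set (letters w) \<subseteq> gl_gens n)"
  by (simp add: free_alg_def)

lemma free_alg_add: "p + q \<in> carrier (free_alg n)"
  if "p \<in> carrier (free_alg n)" "q \<in> carrier (free_alg n)"
  using that Poly_Mapping.keys_add[of p q] by (auto simp: free_alg_carrier)

lemma free_alg_uminus: "- p \<in> carrier (free_alg n)" if "p \<in> carrier (free_alg n)"
  using that by (auto simp: free_alg_carrier in_keys_iff)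

lemma free_alg_diff: "p - q \<in> carrier (free_alg n)"
  if "p \<in> carrier (free_alg n)" "q \<in> carrier (free_alg n)"
  using free_alg_add[OF that(1) free_alg_uminus[OF that(2)]] by simp

lemma free_alg_mult: "p * q \<in> carrier (free_alg n)"
  if "p \<in> carrier (free_alg n)" "q \<in> carrier (free_alg n)"
  using that Poly_Mapping.keys_mult[of p q] by (fastforce simp: free_alg_carrier plus_word_def)

lemma free_alg_const: "const c \<in> carrier (free_alg n)"
  by (auto simp: free_alg_carrier const_def zero_word_def)

lemma free_alg_one: "1 \<in> carrier (free_alg n)"
  using free_alg_const[of 1] by (simp add: const_def)

lemma free_alg_gen: "gen g \<in> carrier (free_alg n)" if "g \<in> gl_gens n"
  using that by (auto simp: free_alg_carrier gen_def)

lemma ring_free_alg: "ring (free_alg n)"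
proof (rule ringI)
  show "abelian_group (free_alg n)"
  proof (rule abelian_groupI)
    show "\<exists>y\<in>carrier (free_alg n). y \<oplus>\<^bsub>free_alg n\<^esub> x = \<zero>\<^bsub>free_alg n\<^esub>"
      if "x \<in> carrier (free_alg n)" for x
      using free_alg_uminus[OF that] by (intro bexI[of _ "- x"]) auto
  qed (auto simp: free_alg_add free_alg_carrier[of 0] add_ac)
  show "Group.monoid (free_alg n)"
    by (rule monoidI) (auto simp: free_alg_mult free_alg_one mult.assoc)
qed (auto simp: algebra_simps)


section \<open>Weights\<close>

text \<open>
  An integral weight is its coordinate function with respect to $\epsilon_0, \ldots, \epsilon_n$
  (zero beyond \<open>n\<close>).
\<close>

type_synonym weight = "nat \<Rightarrow> int"

definition eps :: "nat \<Rightarrow> weight" where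
  "eps i = (\<lambda>k. if k = i then 1 else 0)"

definition alpha :: "nat \<Rightarrow> weight" where
  "alpha i = (\<lambda>k. eps (i - 1) k - eps i k)"

definition omega :: "nat \<Rightarrow> weight" where
  "omega i = (\<lambda>k. \<Sum>j<i. eps j k)"

definition rho :: "nat \<Rightarrow> weight" where
  "rho n = (\<lambda>k. \<Sum>i=1..n. omega i k)"

definition form :: "nat \<Rightarrow> weight \<Rightarrow> weight \<Rightarrow> int" where
  "form n \<beta> \<gamma> = (\<Sum>k\<le>n. \<beta> k * \<gamma> k)"

definition root_sum :: "nat \<Rightarrow> (nat \<Rightarrow> nat) \<Rightarrow> weight" where
  "root_sum n d = (\<lambda>k. \<Sum>i=1..n. int (d i) * alpha i k)"

definition Qplus :: "nat \<Rightarrow> weight set" where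
  "Qplus n = range (root_sum n)"

text \<open>
  The generic weight $\lambda$ enters only through the scalars $v^{\lambda_k}$, which are the
  argument \<open>vl\<close> throughout; \<open>vpow n vl \<beta>\<close> is $v^{(\lambda,\beta)}$.
\<close>

definition vpow :: "nat \<Rightarrow> (nat \<Rightarrow> 'a::field) \<Rightarrow> weight \<Rightarrow> 'a" where
  "vpow n vl \<beta> = (\<Prod>k\<le>n. vl k powi \<beta> k)"

definition mpoly_eval :: "(nat \<Rightarrow> 'a::field_char_0) \<Rightarrow> ((nat \<Rightarrow>\<^sub>0 nat) \<Rightarrow>\<^sub>0 rat) \<Rightarrow> 'a" where
  "mpoly_eval x p =
    (\<Sum>m \<in> Poly_Mapping.keys p. of_rat (Poly_Mapping.lookup p m) *
       (\<Prod>i \<in> Poly_Mapping.keys m. x i ^ Poly_Mapping.lookup m i))"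

text \<open>
  Independence is over the prime field; this is implied by independence over any larger field of
  constants.
\<close>

definition alg_independent :: "nat set \<Rightarrow> (nat \<Rightarrow> 'a::field_char_0) \<Rightarrow> bool" where
  "alg_independent I x \<longleftrightarrow>
    (\<forall>p. (\<forall>m \<in> Poly_Mapping.keys p. Poly_Mapping.keys m \<subseteq> I) \<longrightarrow> mpoly_eval x p = 0 \<longrightarrow> p = 0)"

definition generic_weight :: "nat \<Rightarrow> 'a::field_char_0 \<Rightarrow> (nat \<Rightarrow> 'a) \<Rightarrow> bool" where
  "generic_weight n v vl \<longleftrightarrow>
    alg_independent {0..n + 1} (\<lambda>j. case j of 0 \<Rightarrow> v | Suc k \<Rightarrow> vl k)"


section \<open>The quantum group\<close>

definition Kpoly :: "nat \<Rightarrow> 'a::field free_poly" where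
  "Kpoly i = gen (VV (i - 1)) * gen (VI i)"

definition Kinv_poly :: "nat \<Rightarrow> 'a::field free_poly" where
  "Kinv_poly i = gen (VI (i - 1)) * gen (VV i)"

text \<open>An element \<open>r\<close> of this set stands for the relation \<open>r = 0\<close>.\<close>

inductive_set gl_relations :: "nat \<Rightarrow> 'a::field \<Rightarrow> 'a free_poly set" for n :: nat and v :: 'a where
  inv_right: "i \<le> n \<Longrightarrow> gen (VV i) * gen (VI i) - 1 \<in> gl_relations n v"
| inv_left: "i \<le> n \<Longrightarrow> gen (VI i) * gen (VV i) - 1 \<in> gl_relations n v"
| commute: "i \<le> n \<Longrightarrow> j \<le> n \<Longrightarrow>
    gen (VV i) * gen (VV j) - gen (VV j) * gen (VV i) \<in> gl_relations n v"
| weight_E: "i \<le> n \<Longrightarrow> j \<in> {1..n} \<Longrightarrow>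
    gen (VV i) * gen (EE j) * gen (VI i)
      - const (v powi form n (eps i) (alpha j)) * gen (EE j) \<in> gl_relations n v"
| weight_F: "i \<le> n \<Longrightarrow> j \<in> {1..n} \<Longrightarrow>
    gen (VV i) * gen (FF j) * gen (VI i)
      - const (v powi - form n (eps i) (alpha j)) * gen (FF j) \<in> gl_relations n v"
| E_F: "i \<in> {1..n} \<Longrightarrow> j \<in> {1..n} \<Longrightarrow>
    gen (EE i) * gen (FF j) - gen (FF j) * gen (EE i)
      - (if i = j then const (1 / (v - inverse v)) * (Kpoly i - Kinv_poly i) else 0)
    \<in> gl_relations n v"
| Serre_E_far: "i \<in> {1..n} \<Longrightarrow> j \<in> {1..n} \<Longrightarrow> i + 1 < j \<or> j + 1 < i \<Longrightarrow>
    gen (EE i) * gen (EE j) - gen (EE j) * gen (EE i) \<in> gl_relations n v"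
| Serre_F_far: "i \<in> {1..n} \<Longrightarrow> j \<in> {1..n} \<Longrightarrow> i + 1 < j \<or> j + 1 < i \<Longrightarrow>
    gen (FF i) * gen (FF j) - gen (FF j) * gen (FF i) \<in> gl_relations n v"
| Serre_E_near: "i \<in> {1..n} \<Longrightarrow> j \<in> {1..n} \<Longrightarrow> i + 1 = j \<or> j + 1 = i \<Longrightarrow>
    gen (EE i) ^ 2 * gen (EE j)
      - const (v + inverse v) * gen (EE i) * gen (EE j) * gen (EE i)
      + gen (EE j) * gen (EE i) ^ 2 \<in> gl_relations n v"
| Serre_F_near: "i \<in> {1..n} \<Longrightarrow> j \<in> {1..n} \<Longrightarrow> i + 1 = j \<or> j + 1 = i \<Longrightarrow>
    gen (FF i) ^ 2 * gen (FF j)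
      - const (v + inverse v) * gen (FF i) * gen (FF j) * gen (FF i)
      + gen (FF j) * gen (FF i) ^ 2 \<in> gl_relations n v"

lemma gl_relations_carrier: "gl_relations n v \<subseteq> carrier (free_alg n)"
proof
  fix r assume "r \<in> gl_relations n v"
  then show "r \<in> carrier (free_alg n)"
    by (induction rule: gl_relations.induct)
      (auto intro!: free_alg_add free_alg_diff free_alg_mult free_alg_const free_alg_one
          free_alg_gen simp: Kpoly_def Kinv_poly_def power2_eq_square gl_gens_def free_alg_carrier[of 0])
qed

definition gl_ideal :: "nat \<Rightarrow> 'a::field \<Rightarrow> 'a free_poly set" where
  "gl_ideal n v = Idl\<^bsub>free_alg n\<^esub> (gl_relations n v)"

definition quantum_gl :: "nat \<Rightarrow> 'a::field \<Rightarrow> 'a free_poly set ring" where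
  "quantum_gl n v = free_alg n Quot gl_ideal n v"

definition qcls :: "nat \<Rightarrow> 'a::field \<Rightarrow> 'a free_poly \<Rightarrow> 'a free_poly set" where
  "qcls n v p = gl_ideal n v +>\<^bsub>free_alg n\<^esub> p"

lemma ideal_gl_ideal: "ideal (gl_ideal n v) (free_alg n)"
  unfolding gl_ideal_def by (rule ring.genideal_ideal[OF ring_free_alg gl_relations_carrier])

lemma ring_quantum_gl: "ring (quantum_gl n v)"
  unfolding quantum_gl_def by (rule ideal.quotient_is_ring[OF ideal_gl_ideal])


section \<open>Modules and Verma modules\<close>

locale quantum_gl_module = vector_space scale
  for scale :: "'a::field \<Rightarrow> 'm::ab_group_add \<Rightarrow> 'm" +
  fixes n :: nat and v :: 'a and act :: "'a free_poly set \<Rightarrow> 'm \<Rightarrow> 'm"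
  assumes act_const: "act (qcls n v (const c)) w = scale c w"
    and act_add: "x \<in> carrier (quantum_gl n v) \<Longrightarrow> y \<in> carrier (quantum_gl n v) \<Longrightarrow>
      act (x \<oplus>\<^bsub>quantum_gl n v\<^esub> y) w = act x w + act y w"
    and act_mult: "x \<in> carrier (quantum_gl n v) \<Longrightarrow> y \<in> carrier (quantum_gl n v) \<Longrightarrow>
      act (x \<otimes>\<^bsub>quantum_gl n v\<^esub> y) w = act x (act y w)"
    and act_right_add: "x \<in> carrier (quantum_gl n v) \<Longrightarrow> act x (w + w') = act x w + act x w'"

definition left_ideal_gen :: "('b, 'c) ring_scheme \<Rightarrow> 'b set \<Rightarrow> 'b set" where
  "left_ideal_gen R S = \<Inter>{J. additive_subgroup J R \<and>
     (\<forall>x \<in> carrier R. \<forall>y \<in> J. x \<otimes>\<^bsub>R\<^esub> y \<in> J) \<and> S \<subseteq> J}"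

text \<open>
  The Verma module is the module generated by \<open>hw\<close> subject to $E_i\,\mathbf 1 = 0$ and
  $v^{\epsilon_i}\mathbf 1 = v^{\lambda_i}\mathbf 1$, i.e. the quotient of the algebra by the
  corresponding left ideal. The module over $U_{v^{-1}}(\mathfrak{gl}_{n+1})$ with highest weight
  scalars $v^{-\lambda_i}$ is the instance with \<open>inverse v\<close> and \<open>\<lambda>k. inverse (vl k)\<close>.
\<close>

locale verma_module = quantum_gl_module scale n v act
  for scale :: "'a::field \<Rightarrow> 'm::ab_group_add \<Rightarrow> 'm" and n :: nat and v :: 'a
    and act :: "'a free_poly set \<Rightarrow> 'm \<Rightarrow> 'm" +
  fixes vl :: "nat \<Rightarrow> 'a" and hw :: 'm
  assumes generated: "\<exists>x \<in> carrier (quantum_gl n v). w = act x hw"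
    and annihilator: "{x \<in> carrier (quantum_gl n v). act x hw = 0} =
      left_ideal_gen (quantum_gl n v)
        ({qcls n v (gen (EE i)) |i. i \<in> {1..n}} \<union>
         {qcls n v (gen (VV i) - const (vl i)) |i. i \<in> {0..n}})"

text \<open>The scalar below is $v^{(\alpha_i,\lambda-\beta)}$.\<close>

definition weight_space ::
  "nat \<Rightarrow> 'a::field \<Rightarrow> (nat \<Rightarrow> 'a) \<Rightarrow> ('a \<Rightarrow> 'm \<Rightarrow> 'm) \<Rightarrow> ('a free_poly set \<Rightarrow> 'm \<Rightarrow> 'm) \<Rightarrow> weight \<Rightarrow> 'm set"
where
  "weight_space n v vl scale act \<beta> =
    {w. \<forall>i \<in> {1..n}. act (qcls n v (Kpoly i)) w =
        scale (vpow n vl (alpha i) * v powi - form n (alpha i) \<beta>) w}"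

text \<open>
  An element of $\prod_{\beta\in Q^+}(\mathcal V^\lambda)_\beta$ is the family of its components,
  extended by 0 outside $Q^+$. Since $E_i K_i^{i-1}$ maps the component of index $\beta+\alpha_i$
  to that of index $\beta$, the last condition is $E_i K_i^{i-1}\theta = \theta/(1-v^2)$ read off
  in each component. With \<open>inverse v\<close> in place of \<open>v\<close> it is the dual condition.
\<close>

definition whittaker_vector ::
  "nat \<Rightarrow> 'a::field \<Rightarrow> (nat \<Rightarrow> 'a) \<Rightarrow> ('a \<Rightarrow> 'm \<Rightarrow> 'm) \<Rightarrow> ('a free_poly set \<Rightarrow> 'm \<Rightarrow> 'm) \<Rightarrow>
   'm::ab_group_add \<Rightarrow> (weight \<Rightarrow> 'm) \<Rightarrow> bool"
where
  "whittaker_vector n v vl scale act hw \<theta> \<longleftrightarrow>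
     (\<forall>\<beta> \<in> Qplus n. \<theta> \<beta> \<in> weight_space n v vl scale act \<beta>) \<and>
     (\<forall>\<beta>. \<beta> \<notin> Qplus n \<longrightarrow> \<theta> \<beta> = 0) \<and>
     \<theta> (\<lambda>_. 0) = hw \<and>
     (\<forall>i \<in> {1..n}. \<forall>\<beta>. act (qcls n v (gen (EE i) * Kpoly i ^ (i - 1))) (\<theta> (\<lambda>k. \<beta> k + alpha i k)) =
        scale (1 / (1 - v ^ 2)) (\<theta> \<beta>))"


section \<open>The Shapovalov pairing\<close>

locale shapovalov_anti_iso =
  fixes n :: nat and v :: "'a::field" and \<sigma> :: "'a free_poly set \<Rightarrow> 'a free_poly set"
  assumes bij: "bij_betw \<sigma> (carrier (quantum_gl n v)) (carrier (quantum_gl n (inverse v)))"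
    and add: "x \<in> carrier (quantum_gl n v) \<Longrightarrow> y \<in> carrier (quantum_gl n v) \<Longrightarrow>
      \<sigma> (x \<oplus>\<^bsub>quantum_gl n v\<^esub> y) = \<sigma> x \<oplus>\<^bsub>quantum_gl n (inverse v)\<^esub> \<sigma> y"
    and linear: "x \<in> carrier (quantum_gl n v) \<Longrightarrow>
      \<sigma> (qcls n v (const c) \<otimes>\<^bsub>quantum_gl n v\<^esub> x) =
      qcls n (inverse v) (const c) \<otimes>\<^bsub>quantum_gl n (inverse v)\<^esub> \<sigma> x"
    and one: "\<sigma> \<one>\<^bsub>quantum_gl n v\<^esub> = \<one>\<^bsub>quantum_gl n (inverse v)\<^esub>"
    and anti_mult: "x \<in> carrier (quantum_gl n v) \<Longrightarrow> y \<in> carrier (quantum_gl n v) \<Longrightarrow>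
      \<sigma> (x \<otimes>\<^bsub>quantum_gl n v\<^esub> y) = \<sigma> y \<otimes>\<^bsub>quantum_gl n (inverse v)\<^esub> \<sigma> x"
    and E: "i \<in> {1..n} \<Longrightarrow> \<sigma> (qcls n v (gen (EE i))) = qcls n (inverse v) (gen (FF i))"
    and F: "i \<in> {1..n} \<Longrightarrow> \<sigma> (qcls n v (gen (FF i))) = qcls n (inverse v) (gen (EE i))"
    and V: "i \<in> {0..n} \<Longrightarrow> \<sigma> (qcls n v (gen (VV i))) = qcls n (inverse v) (gen (VI i))"

definition shapovalov_pairing ::
  "nat \<Rightarrow> 'a::field \<Rightarrow> ('a free_poly set \<Rightarrow> 'a free_poly set) \<Rightarrow>
   ('a \<Rightarrow> 'm \<Rightarrow> 'm) \<Rightarrow> ('a free_poly set \<Rightarrow> 'm \<Rightarrow> 'm) \<Rightarrow> 'm::ab_group_add \<Rightarrow>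
   ('a \<Rightarrow> 'k \<Rightarrow> 'k) \<Rightarrow> ('a free_poly set \<Rightarrow> 'k \<Rightarrow> 'k) \<Rightarrow> 'k::ab_group_add \<Rightarrow>
   ('m \<Rightarrow> 'k \<Rightarrow> 'a) \<Rightarrow> bool"
where
  "shapovalov_pairing n v \<sigma> scale act hw scale' act' hw' B \<longleftrightarrow>
     (\<forall>w'. Vector_Spaces.linear scale (*) (\<lambda>w. B w w')) \<and>
     (\<forall>w. Vector_Spaces.linear scale' (*) (\<lambda>w'. B w w')) \<and>
     (\<forall>w. (\<forall>w'. B w w' = 0) \<longrightarrow> w = 0) \<and>
     (\<forall>w'. (\<forall>w. B w w' = 0) \<longrightarrow> w' = 0) \<and>
     B hw hw' = 1 \<and>
     (\<forall>x \<in> carrier (quantum_gl n v). \<forall>w w'. B (act x w) w' = B w (act' (\<sigma> x) w'))"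


section \<open>The normalized scalar product and the fermionic sum\<close>

text \<open>Here $(\beta,\beta)$ is even for $\beta\in Q^+$, so the integer division is exact.\<close>

definition whittaker_J ::
  "nat \<Rightarrow> 'a::field \<Rightarrow> (nat \<Rightarrow> 'a) \<Rightarrow> ('m \<Rightarrow> 'k \<Rightarrow> 'a) \<Rightarrow> (weight \<Rightarrow> 'm) \<Rightarrow> (weight \<Rightarrow> 'k) \<Rightarrow>
   (nat \<Rightarrow> nat) \<Rightarrow> 'a"
where
  "whittaker_J n v vl B \<theta> \<theta>' d =
    (let \<beta> = root_sum n d
     in v powi (- (form n \<beta> \<beta> div 2)) * vpow n vl \<beta> * B (\<theta> \<beta>) (\<theta>' \<beta>))"

text \<open>$q^{-(\lambda+\rho,\alpha_i)}$ with $q = v^2$:\<close>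

definition z_var :: "nat \<Rightarrow> 'a::field \<Rightarrow> (nat \<Rightarrow> 'a) \<Rightarrow> nat \<Rightarrow> 'a" where
  "z_var n v vl i = inverse (vpow n vl (alpha i) ^ 2 * (v ^ 2) powi form n (rho n) (alpha i))"

definition qpoch :: "'a::field \<Rightarrow> 'a \<Rightarrow> nat \<Rightarrow> 'a" where
  "qpoch q x m = (\<Prod>i=1..m. 1 - q ^ (i - 1) * x)"

definition zprod :: "(nat \<Rightarrow> 'a::field) \<Rightarrow> nat \<Rightarrow> nat \<Rightarrow> 'a" where
  "zprod z k l = (\<Prod>j=k+1..l. z j)"

text \<open>
  The triangular arrays $(m_{k,i})_{0\le k\le i\le n}$, made unique functions by the value 0
  outside the triangle.
\<close>

definition arrays :: "nat \<Rightarrow> (nat \<Rightarrow> nat) \<Rightarrow> (nat \<Rightarrow> nat \<Rightarrow> nat) set" where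
  "arrays n d = {m.
     (\<forall>k i. \<not> (k \<le> i \<and> i \<le> n) \<longrightarrow> m k i = 0) \<and>
     (\<forall>k\<le>n. m k n = 0 \<and> (\<forall>i. k \<le> i \<and> i < n \<longrightarrow> m k (i + 1) \<le> m k i)) \<and>
     (\<forall>i \<in> {1..n}. (\<Sum>k<i. m k (i - 1)) = d i)}"

text \<open>Every $m(m-1)$ is even, so the integer division is exact.\<close>

definition p_exp :: "nat \<Rightarrow> (nat \<Rightarrow> nat \<Rightarrow> nat) \<Rightarrow> int" where
  "p_exp n m =
     - (\<Sum>(k, l, i) \<in> {(k, l, i). k < l \<and> l \<le> i \<and> i \<le> n - 1}. int (m k i) * int (m l i))
     + (\<Sum>(k, l, i) \<in> {(k, l, i). k < l \<and> l < i \<and> i \<le> n - 1}. int (m k i) * int (m l (i - 1)))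
     + (\<Sum>(k, i) \<in> {(k, i). k < i \<and> i \<le> n - 1}. int (m k i) * (int (m k i) - 1)) div 2"

end

theory Submission
  imports Defs "HOL-Computational_Algebra.Polynomial"
begin

text \<open>
  Write $e_i = (1-v^2) E_i K_i^{i-1}$ and $f_i = v(1-v^{-2}) K_i^{-(i-1)} F_i K_i^{-1}$. Then
  $e_i \theta_\gamma = \theta_{\gamma-\alpha_i}$, and with the normalization of $J$ included, the
  functional $(\,\cdot\,,\bar\theta_\gamma)$ composed with $f_i$ is the one for $\gamma-\alpha_i$.
  The commutation relations of $e_i$ and $f_j$ are rational in $q$ and the $z_i$, and they are
  satisfied by explicit Gelfand--Tsetlin operators on functions of the arrays $m$. In that model the
  Whittaker vector is the constant function 1 and the functional is summation against the fermionic
  summand; both facts reduce to the leading coefficient in Lagrange interpolation. A vector of the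
  Verma module is represented by the function obtained from any expression of it in words in the
  $f_i$ applied to $\mathbf 1$. Since the $e_i$ of the model have no common kernel in positive
  degree, $\theta_\gamma$ is represented by the constant function 1 on the arrays of weight
  $\gamma$, so $J$ is the sum of the summands.
\<close>

section \<open>Matrix coefficients of the Gelfand--Tsetlin model\<close>

text \<open>A linear map from the Verma module to the model would require the relations among the
  f_i to be verified for the model operators. Representing vectors by a relation avoids this: it is
  enough that e_i is pushed through a word in the f_j by one rule on both sides, with equal scalars,
  down to a vector killed by every e_i.

  The twist by K_i in e_i is dictated by the Whittaker equation, the one in f_i by the adjoint of
  the dual equation together with the normalization of J. Its trace in the model is
  \<open>comm_factor\<close>.

  Gelfand--Tsetlin coefficients are fixed only up to rescaling the basis. Here the differences with
  row r - 1 all sit in the e-coefficients of row r, and those with row r + 1 in the f-coefficients.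
  This makes the Whittaker vector constant, so the whole formula is carried by the weight of the
  functional; the fermionic summand is the weight for which the transpose of \<open>gt_f\<close> has
  coefficients of total 1. Boundary terms disappear because the coefficients themselves vanish
  there.\<close>

lemma lagrange_leading_coeff:
  fixes x :: "'i \<Rightarrow> 'a::field"
  assumes fin: "finite J" and inj: "inj_on x J" and deg: "degree P < card J"
  shows "(\<Sum>j\<in>J. poly P (x j) / (\<Prod>l\<in>J-{j}. x j - x l)) = coeff P (card J - 1)"
proof -
  \<comment> \<open>\<open>b j\<close> is monic of degree \<open>card J - 1\<close>, and
    \<open>L\<close> interpolates \<open>P\<close> at the nodes. Two polynomials of degree below
    \<open>card J\<close> that agree at \<open>card J\<close> points coincide, so their top
    coefficients can be compared.\<close>
  define b where "b j = (\<Prod>l\<in>J-{j}. [:- x l, 1:])" for j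
  define c where "c j = poly P (x j) / (\<Prod>l\<in>J-{j}. x j - x l)" for j
  define L where "L = (\<Sum>j\<in>J. smult (c j) (b j))"
  have db: "degree (b j) = card J - 1" if "j \<in> J" for j
    unfolding b_def using that by (subst degree_prod_eq_sum_degree) (auto simp: card_Diff_singleton)
  have cb: "coeff (b j) (card J - 1) = 1" if "j \<in> J" for j
  proof -
    have "lead_coeff (b j) = 1" unfolding b_def by (simp add: lead_coeff_prod)
    then show ?thesis using db[OF that] by simp
  qed
  have Pne: "J \<noteq> {}" using deg by auto
  have "degree L \<le> card J - 1"
    unfolding L_def by (intro degree_sum_le) (auto simp: fin db intro: order.trans[OF degree_smult_le])
  then have dL: "degree L < card J" using deg by linarith
  have pb: "poly (b j) (x i) = (if i = j then \<Prod>l\<in>J-{j}. x j - x l else 0)"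
    if "i \<in> J" "j \<in> J" for i j
    using that fin by (auto simp: b_def poly_prod)
  have nz: "(\<Prod>l\<in>J-{j}. x j - x l) \<noteq> 0" if "j \<in> J" for j
    using that fin inj by (auto simp: inj_on_def)
  have pL: "poly L (x i) = poly P (x i)" if "i \<in> J" for i
  proof -
    have "poly L (x i) = (\<Sum>j\<in>J. c j * poly (b j) (x i))"
      by (simp add: L_def poly_sum)
    also have "\<dots> = (\<Sum>j\<in>J. if j = i then poly P (x i) else 0)"
      using that nz by (intro sum.cong) (auto simp: pb c_def)
    finally show ?thesis using that fin by simp
  qed
  have "L = P"
    by (rule poly_eqI_degree[of "x ` J"]) (use pL dL deg inj in \<open>auto simp: card_image\<close>)
  then have "coeff P (card J - 1) = (\<Sum>j\<in>J. c j * coeff (b j) (card J - 1))"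
    by (auto simp: L_def coeff_sum)
  also have "\<dots> = (\<Sum>j\<in>J. c j)" using cb by (intro sum.cong) simp_all
  finally show ?thesis by (simp add: c_def)
qed

text \<open>
  The variable \<open>t k r\<close> stands for $q^{-m_{k,r}} z_1 \cdots z_k$. Row \<open>r\<close> belongs to the generators of
  index \<open>r + 1\<close>, since these change exactly one of the $m_{k,r}$, $k \le r$.
\<close>

definition e_coeff :: "(nat \<Rightarrow> nat \<Rightarrow> 'a::field) \<Rightarrow> nat \<Rightarrow> nat \<Rightarrow> 'a" where
  "e_coeff t r k = (\<Prod>l<r. 1 - t k r / t l (r - 1)) / (\<Prod>l\<in>{..r}-{k}. 1 - t k r / t l r)"

text \<open>\<open>e_coeff\<close> with all variables inverted. It arises as the coefficient of the
  transpose of \<open>gt_f\<close> with respect to the fermionic weights.\<close>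

definition e_coeff_dual :: "(nat \<Rightarrow> nat \<Rightarrow> 'a::field) \<Rightarrow> nat \<Rightarrow> nat \<Rightarrow> 'a" where
  "e_coeff_dual t r k = (\<Prod>l<r. t k r - t l (r - 1)) / (\<Prod>l\<in>{..r}-{k}. t k r - t l r)"

text \<open>The monomials in \<open>t\<close> carry the powers of \<open>q\<close> in the
  off-diagonal commutation with \<open>e_coeff\<close>. The factor \<open>l = k\<close> of the first
  product vanishes when m_{k,r} = m_{k,r+1}, so an array that cannot be lowered contributes
  nothing.\<close>

definition f_coeff :: "(nat \<Rightarrow> nat \<Rightarrow> 'a::field) \<Rightarrow> nat \<Rightarrow> nat \<Rightarrow> 'a" where
  "f_coeff t r k = (\<Prod>l\<le>Suc r. t k r - t l (Suc r)) * (\<Prod>l<r. t l (r - 1)) /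
     ((t k r)\<^sup>2 * (\<Prod>l\<in>{..r}-{k}. (t k r - t l r) * t l r))"

definition upd2 :: "(nat \<Rightarrow> nat \<Rightarrow> 'a) \<Rightarrow> nat \<Rightarrow> nat \<Rightarrow> 'a \<Rightarrow> nat \<Rightarrow> nat \<Rightarrow> 'a" where
  "upd2 t k r c = (\<lambda>l i. if l = k \<and> i = r then c else t l i)"

text \<open>With i = r + 1, j = s + 1 and q = v^2 this is v^((alpha_i, alpha_j)(j + 1 - i)), the net
  power of v from moving the K-powers in e_i and f_j past F_j and E_i. The exponents i - 1 and j
  explain the asymmetry between the two neighbouring cases.\<close>

definition comm_factor :: "'a::field \<Rightarrow> nat \<Rightarrow> nat \<Rightarrow> 'a" where
  "comm_factor q r s = (if r = s then q else if s = Suc r then inverse q else 1)"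

text \<open>Lagrange interpolation of the monic polynomial of degree r with roots t_{l,r-1} at the r
  + 1 nodes of row r.\<close>

lemma sum_e_coeff_dual:
  assumes inj: "inj_on (\<lambda>l. t l r) {..r}"
  shows "(\<Sum>k\<le>r. e_coeff_dual t r k) = 1"
proof -
  define P where "P = (\<Prod>l<r. [:- t l (r-1), 1:])"
  have dP: "degree P = r" unfolding P_def by (subst degree_prod_eq_sum_degree) auto
  have lP: "coeff P r = 1"
  proof -
    have "lead_coeff P = 1" unfolding P_def by (simp add: lead_coeff_prod)
    then show ?thesis using dP by simp
  qed
  have "(\<Sum>k\<le>r. e_coeff_dual t r k) = (\<Sum>k\<in>{..r}. poly P (t k r) / (\<Prod>l\<in>{..r}-{k}. t k r - t l r))"
    by (simp add: e_coeff_dual_def P_def poly_prod)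
  also have "\<dots> = coeff P (card {..r} - 1)"
    by (rule lagrange_leading_coeff) (use inj dP in auto)
  finally show ?thesis using lP by simp
qed

text \<open>Inverting the variables turns this into the dual identity: numerator and denominator of
  \<open>e_coeff\<close> have r factors each, so the powers of \<open>t k r\<close> cancel.\<close>

lemma sum_e_coeff:
  assumes inj: "inj_on (\<lambda>l. t l r) {..r}" and nz: "\<And>l. l \<le> r \<Longrightarrow> t l r \<noteq> (0::'a::field)"
    and nz': "\<And>l. l < r \<Longrightarrow> t l (r-1) \<noteq> 0"
  shows "(\<Sum>k\<le>r. e_coeff t r k) = 1"
proof -
  define u where "u l i = inverse (t l i)" for l i
  have inj': "inj_on (\<lambda>l. u l r) {..r}" using inj by (auto simp: inj_on_def u_def)
  have "e_coeff t r k = e_coeff_dual u r k" if k: "k \<le> r" for k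
  proof -
    have 1: "(\<Prod>l<r. 1 - t k r / t l (r - 1)) = t k r ^ r * (\<Prod>l<r. u k r - u l (r-1))"
    proof -
      have "(\<Prod>l<r. 1 - t k r / t l (r - 1)) = (\<Prod>l<r. t k r * (u k r - u l (r-1)))"
        using k nz by (intro prod.cong) (auto simp: u_def field_simps)
      then show ?thesis by (simp add: prod.distrib)
    qed
    have 2: "(\<Prod>l\<in>{..r}-{k}. 1 - t k r / t l r) = t k r ^ r * (\<Prod>l\<in>{..r}-{k}. u k r - u l r)"
    proof -
      have "(\<Prod>l\<in>{..r}-{k}. 1 - t k r / t l r) = (\<Prod>l\<in>{..r}-{k}. t k r * (u k r - u l r))"
        using k nz by (intro prod.cong) (auto simp: u_def field_simps)
      then show ?thesis using k by (simp add: prod.distrib card_Diff_singleton)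
    qed
    show ?thesis unfolding e_coeff_def e_coeff_dual_def 1 2 using nz[OF k] by simp
  qed
  then have "(\<Sum>k\<le>r. e_coeff t r k) = (\<Sum>k\<le>r. e_coeff_dual u r k)" by simp
  with sum_e_coeff_dual[of u r, OF inj'] show ?thesis by simp
qed

section \<open>Commutation of the coefficients at two different positions\<close>

lemma e_coeff_upd2_other: "e_coeff (upd2 t k s c) r p = e_coeff t r p" if "s \<noteq> r" "Suc s \<noteq> r"
  using that by (auto simp: e_coeff_def upd2_def intro!: arg_cong2[of _ _ _ _ "(/)"] prod.cong)

lemma f_coeff_upd2_other: "f_coeff (upd2 t k s c) r p = f_coeff t r p" if "s \<noteq> r" "Suc s \<noteq> r" "s \<noteq> Suc r"
  using that
  by (auto simp: f_coeff_def upd2_def intro!: arg_cong2[of _ _ _ _ "(/)"] arg_cong2[of _ _ _ _ "(*)"] prod.cong)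

text \<open>Only the factors linking p and k change. The difference factors balance exactly; the
  \<open>q\<close> comes from the monomial \<open>t l r\<close> at \<open>l = p\<close> in the
  denominator of \<open>f_coeff\<close>.\<close>

lemma e_f_coeff_same_row:
  fixes t :: "nat \<Rightarrow> nat \<Rightarrow> 'a::field"
  assumes q: "q \<noteq> 0" and nz: "t p r \<noteq> 0" "t k r \<noteq> 0" and "p \<noteq> k" "p \<le> r" "k \<le> r"
  shows "e_coeff t r p * f_coeff (upd2 t p r (t p r / q)) r k = q * f_coeff t r k * e_coeff (upd2 t k r (q * t k r)) r p"
proof -
  define N where "N = (\<Prod>l<r. 1 - t p r / t l (r - 1))"
  define D where "D = (\<Prod>l\<in>{..r}-{p}-{k}. 1 - t p r / t l r)"
  define M where "M = (\<Prod>l\<le>Suc r. t k r - t l (Suc r)) * (\<Prod>l<r. t l (r - 1))"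
  define C where "C = (\<Prod>l\<in>{..r}-{k}-{p}. (t k r - t l r) * t l r)"
  let ?a = "t p r" and ?b = "t k r"
  have kin: "k \<in> {..r} - {p}" "p \<in> {..r} - {k}" using assms by auto
  have r1: "r - Suc 0 \<noteq> r" if "0 < r" using that by simp
  have e1: "e_coeff t r p = N / ((1 - ?a / ?b) * D)"
    unfolding e_coeff_def N_def D_def by (subst prod.remove[OF _ kin(1)]) auto
  have f1: "f_coeff t r k = M / (?b\<^sup>2 * ((?b - ?a) * ?a * C))"
    unfolding f_coeff_def M_def C_def by (subst prod.remove[OF _ kin(2)]) auto
  have e2: "e_coeff (upd2 t k r (q * ?b)) r p = N / ((1 - ?a / (q * ?b)) * D)"
  proof -
    have "(\<Prod>l<r. 1 - upd2 t k r (q * ?b) p r / upd2 t k r (q * ?b) l (r - 1)) = N"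
      unfolding N_def using assms by (intro prod.cong) (auto simp: upd2_def)
    moreover have "(\<Prod>l\<in>{..r}-{p}. 1 - upd2 t k r (q * ?b) p r / upd2 t k r (q * ?b) l r) = (1 - ?a / (q * ?b)) * D"
      unfolding D_def using assms by (subst prod.remove[OF _ kin(1)]) (auto simp: upd2_def intro!: prod.cong)
    ultimately show ?thesis by (simp add: e_coeff_def)
  qed
  have f2: "f_coeff (upd2 t p r (?a / q)) r k = M / (?b\<^sup>2 * ((?b - ?a / q) * (?a / q) * C))"
  proof -
    let ?t = "upd2 t p r (?a / q)"
    have "(\<Prod>l\<le>Suc r. ?t k r - ?t l (Suc r)) * (\<Prod>l<r. ?t l (r - 1)) = M"
      unfolding M_def using assms by (intro arg_cong2[of _ _ _ _ "(*)"] prod.cong) (auto simp: upd2_def)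
    moreover have "(\<Prod>l\<in>{..r}-{k}. (?t k r - ?t l r) * ?t l r) = (?b - ?a / q) * (?a / q) * C"
      unfolding C_def using assms by (subst prod.remove[OF _ kin(2)]) (auto simp: upd2_def intro!: prod.cong)
    moreover have "?t k r = ?b" using assms by (simp add: upd2_def)
    ultimately show ?thesis by (simp add: f_coeff_def)
  qed
  have A: "(1 - ?a / ?b) = (?b - ?a) * inverse ?b" "(1 - ?a / (q * ?b)) = (q * ?b - ?a) / (q * ?b)"
    "?b - ?a / q = (q * ?b - ?a) / q"
    using nz q by (auto simp: field_simps)
  \<comment> \<open>\<open>x\<close> and \<open>y\<close> stand for \<open>?b - ?a\<close> and
    \<open>q * ?b - ?a\<close>. Zero values of \<open>y\<close>, \<open>C\<close>, \<open>D\<close>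
    and, in the last step, of \<open>?b - ?a\<close> make both sides 0 by the convention on
    division.\<close>
  have "x \<noteq> 0 \<Longrightarrow> N / ((x * inverse ?b) * D) * (M / (?b\<^sup>2 * (y / q * (?a / q) * C)))
     = q * (M / (?b\<^sup>2 * (x * ?a * C))) * (N / (y / (q * ?b) * D))" for x y
    using q nz by (cases "y = 0"; cases "C = 0"; cases "D = 0") (simp_all add: field_simps power2_eq_square)
  then show ?thesis unfolding e1 e2 f1 f2 A by (cases "?b - ?a = 0") simp_all
qed

text \<open>Each of the two positions sees the other through one factor. With u =
  \<open>t p (Suc s)\<close> and a = \<open>t k s\<close> the claim reduces to (1 - u/a)(a - u/q) =
  (a - u)(1 - u/(q a)).\<close>

lemma e_f_coeff_above:
  fixes t :: "nat \<Rightarrow> nat \<Rightarrow> 'a::field"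
  assumes q: "q \<noteq> 0" and nz: "t k s \<noteq> 0" and "p \<le> Suc s" "k \<le> s"
  shows "e_coeff t (Suc s) p * f_coeff (upd2 t p (Suc s) (t p (Suc s) / q)) s k
     = f_coeff t s k * e_coeff (upd2 t k s (q * t k s)) (Suc s) p"
proof -
  define N where "N = (\<Prod>l\<in>{..<Suc s}-{k}. 1 - t p (Suc s) / t l s)"
  define D where "D = (\<Prod>l\<in>{..Suc s}-{p}. 1 - t p (Suc s) / t l (Suc s))"
  define M where "M = (\<Prod>l\<in>{..Suc s}-{p}. t k s - t l (Suc s))"
  define C where "C = (\<Prod>l<s. t l (s - 1)) / ((t k s)\<^sup>2 * (\<Prod>l\<in>{..s}-{k}. (t k s - t l s) * t l s))"
  let ?u = "t p (Suc s)" and ?a = "t k s"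
  have kin: "k \<in> {..<Suc s}" "p \<in> {..Suc s}" using assms by auto
  have e1: "e_coeff t (Suc s) p = (1 - ?u / ?a) * N / D"
    unfolding e_coeff_def N_def D_def by (subst prod.remove[OF _ kin(1)]) auto
  have f1: "f_coeff t s k = (?a - ?u) * M * C"
    unfolding f_coeff_def M_def C_def by (subst prod.remove[OF _ kin(2)]) auto
  have e2: "e_coeff (upd2 t k s (q * ?a)) (Suc s) p = (1 - ?u / (q * ?a)) * N / D"
    unfolding e_coeff_def N_def D_def
    by (subst prod.remove[OF _ kin(1)])
       (auto simp: upd2_def intro!: arg_cong2[of _ _ _ _ "(/)"] arg_cong2[of _ _ _ _ "(*)"] prod.cong)
  have f2: "f_coeff (upd2 t p (Suc s) (?u / q)) s k = (?a - ?u / q) * M * C"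
  proof -
    let ?t = "upd2 t p (Suc s) (?u / q)"
    have "(\<Prod>l\<le>Suc s. ?t k s - ?t l (Suc s)) = (?a - ?u / q) * M"
      unfolding M_def by (subst prod.remove[OF _ kin(2)]) (auto simp: upd2_def intro!: prod.cong)
    moreover have "(\<Prod>l<s. ?t l (s - 1)) / ((?t k s)\<^sup>2 * (\<Prod>l\<in>{..s}-{k}. (?t k s - ?t l s) * ?t l s)) = C"
      unfolding C_def by (intro arg_cong2[of _ _ _ _ "(/)"] arg_cong2[of _ _ _ _ "(*)"] prod.cong) (auto simp: upd2_def)
    ultimately show ?thesis unfolding f_coeff_def by (simp only: times_divide_eq_right[symmetric])
  qed
  have "(1 - ?u / ?a) * (?a - ?u / q) = (?a - ?u) * (1 - ?u / (q * ?a))"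
    using q nz by (simp add: field_simps)
  then have "((1 - ?u / ?a) * (?a - ?u / q)) * (N / D * M * C) = ((?a - ?u) * (1 - ?u / (q * ?a))) * (N / D * M * C)"
    by (rule arg_cong)
  then show ?thesis unfolding e1 e2 f1 f2 by (simp only: times_divide_eq_right times_divide_eq_left mult_ac)
qed

text \<open>\<open>e_coeff\<close> in row r does not involve row r + 1, and \<open>f_coeff\<close>
  in row r + 1 involves row r only through the product of its nodes, which changes by 1/q.\<close>

lemma e_f_coeff_below:
  fixes t :: "nat \<Rightarrow> nat \<Rightarrow> 'a::field"
  assumes q: "q \<noteq> 0" and "p \<le> r" "k \<le> Suc r"
  shows "e_coeff t r p * f_coeff (upd2 t p r (t p r / q)) (Suc r) k
     = inverse q * f_coeff t (Suc r) k * e_coeff (upd2 t k (Suc r) (q * t k (Suc r))) r p"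
proof -
  define X where "X = (\<Prod>l\<le>Suc (Suc r). t k (Suc r) - t l (Suc (Suc r)))"
  define Y where "Y = ((t k (Suc r))\<^sup>2 * (\<Prod>l\<in>{..Suc r}-{k}. (t k (Suc r) - t l (Suc r)) * t l (Suc r)))"
  define M where "M = (\<Prod>l\<in>{..<Suc r}-{p}. t l r)"
  have pin: "p \<in> {..<Suc r}" using assms by auto
  have f1: "f_coeff t (Suc r) k = X * (t p r * M) / Y"
  proof -
    have "(\<Prod>l<Suc r. t l r) = t p r * M"
      unfolding M_def by (subst prod.remove[OF _ pin]) auto
    then show ?thesis unfolding f_coeff_def X_def Y_def diff_Suc_1 by simp
  qed
  have f2: "f_coeff (upd2 t p r (t p r / q)) (Suc r) k = X * (t p r / q * M) / Y"
  proof -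
    let ?t = "upd2 t p r (t p r / q)"
    have "(\<Prod>l\<le>Suc (Suc r). ?t k (Suc r) - ?t l (Suc (Suc r))) = X"
      unfolding X_def by (intro prod.cong) (auto simp: upd2_def)
    moreover have "(?t k (Suc r))\<^sup>2 * (\<Prod>l\<in>{..Suc r}-{k}. (?t k (Suc r) - ?t l (Suc r)) * ?t l (Suc r)) = Y"
      unfolding Y_def by (intro arg_cong2[of _ _ _ _ "(*)"] prod.cong) (auto simp: upd2_def)
    moreover have "(\<Prod>l<Suc r. ?t l r) = t p r / q * M"
      unfolding M_def by (subst prod.remove[OF _ pin]) (auto simp: upd2_def intro!: prod.cong)
    ultimately show ?thesis unfolding f_coeff_def by simp
  qed
  have "e_coeff (upd2 t k (Suc r) (q * t k (Suc r))) r p = e_coeff t r p"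
    by (rule e_coeff_upd2_other) auto
  then show ?thesis unfolding f1 f2 by (simp add: divide_inverse)
qed

lemma e_f_coeff_commute:
  fixes t :: "nat \<Rightarrow> nat \<Rightarrow> 'a::field"
  assumes q: "q \<noteq> 0" and nz: "t p r \<noteq> 0" "t k s \<noteq> 0" and "p \<le> r" "k \<le> s" "(p, r) \<noteq> (k, s)"
  shows "e_coeff t r p * f_coeff (upd2 t p r (t p r / q)) s k
     = comm_factor q r s * f_coeff t s k * e_coeff (upd2 t k s (q * t k s)) r p"
proof -
  consider "r = s" | "r = Suc s" | "s = Suc r" | "r \<noteq> s" "r \<noteq> Suc s" "s \<noteq> Suc r" by blast
  then show ?thesis
  proof cases
    case 1
    then have "p \<noteq> k" "k \<le> r" using assms by auto
    then show ?thesis using e_f_coeff_same_row[OF q, where r = r] assms 1 by (simp add: comm_factor_def)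
  next
    case 2 then show ?thesis using e_f_coeff_above[OF q, where s = s] assms by (simp add: comm_factor_def)
  next
    case 3 then show ?thesis using e_f_coeff_below[OF q, where r = r] assms by (simp add: comm_factor_def)
  next
    case 4 then show ?thesis by (simp add: e_coeff_upd2_other f_coeff_upd2_other comm_factor_def)
  qed
qed

text \<open>
  With $a_k = t_{k,r}$ this is Lagrange interpolation at the $2r+3$ nodes $0$, $a_k$, $q a_k$ of the
  polynomial $\prod_{l<r} (x - t_{l,r-1}) \prod_{l\le r+1} (x/q - t_{l,r+1})$ of degree $2r+2$.
\<close>

lemma sum_e_f_coeff_diagonal:
  fixes t :: "nat \<Rightarrow> nat \<Rightarrow> 'a::field"
  assumes q: "q \<noteq> 0" and nz: "\<And>l i. l \<le> Suc r \<Longrightarrow> t l i \<noteq> 0" and inj: "inj_on (\<lambda>l. t l r) {..r}"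
    and qne: "\<And>k l. k \<le> r \<Longrightarrow> l \<le> r \<Longrightarrow> t k r \<noteq> q * t l r"
  shows "(\<Sum>k\<le>r. e_coeff t r k * f_coeff (upd2 t k r (t k r / q)) r k)
       - q * (\<Sum>k\<le>r. f_coeff t r k * e_coeff (upd2 t k r (q * t k r)) r k)
     = (1 - q) * (1 - q * (\<Prod>l<r. t l (r - 1)) * (\<Prod>l\<le>Suc r. t l (Suc r)) / (\<Prod>l\<le>r. t l r)\<^sup>2)"
proof -
  note [simp del] = prod.atMost_Suc sum.atMost_Suc
  have q1: "q \<noteq> 1" using qne[of 0 0] by auto
  \<comment> \<open>\<open>None\<close> is the node 0, \<open>Some (False, k)\<close> the node a_k
    and \<open>Some (True, k)\<close> the node q a_k. Their Lagrange terms give the Cartan part, the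
    e f terms and the f e terms respectively.\<close>
  define J :: "(bool \<times> nat) option set" where "J = insert None (Some ` (UNIV \<times> {..r}))"
  define x where "x = (\<lambda>j. case j of None \<Rightarrow> 0 | Some (b, k) \<Rightarrow> if b then q * t k r else t k r)"
  define P where "P = (\<Prod>l<r. [:- t l (r-1), 1:]) * (\<Prod>l\<le>Suc r. [:- t l (Suc r), inverse q:])"
  define T where "T j = poly P (x j) / (\<Prod>l\<in>J-{j}. x j - x l)" for j
  define A where "A k = (\<Prod>l<r. t k r - t l (r-1))" for k
  have xs: "x None = 0" "x (Some (False, k)) = t k r" "x (Some (True, k)) = q * t k r" for k
    by (auto simp: x_def)
  have U: "UNIV = {True, False}" by auto
  have cJ: "card J = 2 * Suc r + 1"
    unfolding J_def by (subst card_insert_disjoint) (auto simp: card_image card_cartesian_product)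
  have fJ: "finite J" by (simp add: J_def)
  have injx: "inj_on x J"
  proof (rule inj_onI)
    fix j j' assume "j \<in> J" "j' \<in> J" "x j = x j'"
    then show "j = j'"
      using nz q qne qne[symmetric] inj_onD[OF inj]
      by (cases j; cases j') (auto simp: J_def x_def split: if_splits)
  qed
  have dP: "degree P = 2 * Suc r"
  proof -
    have "degree (\<Prod>l<r. [:- t l (r-1), 1:]) = r"
      by (subst degree_prod_eq_sum_degree) auto
    moreover have "degree (\<Prod>l\<le>Suc r. [:- t l (Suc r), inverse q:]) = r + 2"
      using q by (subst degree_prod_eq_sum_degree) (auto simp del: prod.atMost_Suc sum.atMost_Suc)
    moreover have "(\<Prod>l<r. [:- t l (r-1), 1:]) \<noteq> 0" "(\<Prod>l\<le>Suc r. [:- t l (Suc r), inverse q:]) \<noteq> 0"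
      using q by (auto simp del: prod.atMost_Suc simp: prod_zero_iff)
    ultimately show ?thesis unfolding P_def by (subst degree_mult_eq) auto
  qed
  have lP: "coeff P (2 * Suc r) = inverse q ^ (r + 2)"
  proof -
    have "lead_coeff P = inverse q ^ (r + 2)" unfolding P_def using q
      by (simp add: lead_coeff_mult lead_coeff_prod)
    then show ?thesis using dP by simp
  qed
  have prodJ: "(\<Prod>j\<in>J. g j) = g None * (\<Prod>k\<le>r. g (Some (True, k)) * g (Some (False, k)))"
    for g :: "(bool \<times> nat) option \<Rightarrow> 'a"
  proof -
    have "(\<Prod>x\<in>UNIV \<times> {..r}. g (Some x)) = (\<Prod>b\<in>UNIV. \<Prod>k\<le>r. g (Some (b, k)))"
      by (subst prod.cartesian_product) (simp add: case_prod_unfold)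
    then show ?thesis
      unfolding J_def by (subst prod.insert) (auto simp: prod.reindex U prod.distrib)
  qed
  have sumJ: "(\<Sum>j\<in>J. g j) = g None + (\<Sum>k\<le>r. g (Some (True, k)) + g (Some (False, k)))"
    for g :: "(bool \<times> nat) option \<Rightarrow> 'a"
  proof -
    have "(\<Sum>x\<in>UNIV \<times> {..r}. g (Some x)) = (\<Sum>b\<in>UNIV. \<Sum>k\<le>r. g (Some (b, k)))"
      by (subst sum.cartesian_product) (simp add: case_prod_unfold)
    then show ?thesis
      unfolding J_def by (subst sum.insert) (auto simp: sum.reindex U sum.distrib)
  qed
  have total: "(\<Sum>j\<in>J. T j) = inverse q ^ (r + 2)"
    unfolding T_def by (subst lagrange_leading_coeff) (use fJ injx dP cJ lP in auto)
  have prodJ': "(\<Prod>j\<in>J-{i}. g j) = (if i = None then 1 else g None) *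
      (\<Prod>k\<le>r. (if i = Some (True, k) then 1 else g (Some (True, k))) * (if i = Some (False, k) then 1 else g (Some (False, k))))"
    if "i \<in> J" for i and g :: "(bool \<times> nat) option \<Rightarrow> 'a"
  proof -
    have "(\<Prod>j\<in>J-{i}. g j) = (\<Prod>j\<in>J-{i}. if i = j then 1 else g j)"
      by (intro prod.cong) auto
    also have "\<dots> = (\<Prod>j\<in>J. if i = j then 1 else g j)"
      unfolding prod.remove[OF fJ that, of "\<lambda>j. if i = j then 1 else g j"] by (simp only: refl if_True mult_1_left)
    finally have "(\<Prod>j\<in>J-{i}. g j) = (\<Prod>j\<in>J. if i = j then 1 else g j)" .
    then show ?thesis by (simp only: prodJ)
  qed
  have prodJk: "(\<Prod>j\<in>J-{Some (b, k)}. g j) = g None * g (Some (\<not> b, k)) *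
      ((\<Prod>l\<in>{..r}-{k}. g (Some (True, l))) * (\<Prod>l\<in>{..r}-{k}. g (Some (False, l))))"
    if k: "k \<le> r" for b k and g :: "(bool \<times> nat) option \<Rightarrow> 'a"
  proof -
    let ?h = "\<lambda>l. (if Some (b, k) = Some (True, l) then 1 else g (Some (True, l))) *
        (if Some (b, k) = Some (False, l) then 1 else g (Some (False, l)))"
    have "(\<Prod>j\<in>J-{Some (b, k)}. g j) = g None * (\<Prod>l\<le>r. ?h l)"
      using k by (subst prodJ') (simp_all add: J_def)
    also have "(\<Prod>l\<le>r. ?h l) = ?h k * (\<Prod>l\<in>{..r}-{k}. ?h l)"
      using k by (intro prod.remove) auto
    also have "(\<Prod>l\<in>{..r}-{k}. ?h l) = (\<Prod>l\<in>{..r}-{k}. g (Some (True, l)) * g (Some (False, l)))"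
      by (intro prod.cong) auto
    also have "?h k = g (Some (\<not> b, k))" by (cases b) auto
    finally show ?thesis by (simp add: prod.distrib mult.assoc)
  qed
  have TN: "T None = (\<Prod>l<r. t l (r-1)) * (\<Prod>l\<le>Suc r. t l (Suc r)) / (q ^ Suc r * (\<Prod>l\<le>r. t l r)\<^sup>2)"
  proof -
    have "poly P 0 = (\<Prod>l<r. t l (r-1)) * (\<Prod>l\<le>Suc r. t l (Suc r))"
      by (simp add: P_def poly_prod prod.distrib prod_uminus power_add)
    moreover have "(\<Prod>l\<in>J-{None}. x None - x l) = q ^ Suc r * (\<Prod>l\<le>r. t l r)\<^sup>2"
      by (subst prodJ') (simp_all add: J_def xs prod.distrib power2_eq_square mult_ac)
    ultimately show ?thesis by (simp add: T_def xs)
  qed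
  \<comment> \<open>Numerator and denominator have r factors each, so the signs from reversing the
    differences cancel.\<close>
  have signs: "(\<Prod>l<r. t l (r-1)) * (\<Prod>l<r. 1 - c / t l (r-1)) / ((\<Prod>l\<in>{..r}-{k}. t l r) * (\<Prod>l\<in>{..r}-{k}. 1 - c / t l r))
     = (\<Prod>l<r. c - t l (r-1)) / (\<Prod>l\<in>{..r}-{k}. c - t l r)" if "k \<le> r" for k c
  proof -
    have e: "a * (1 - c / a) = - (c - a)" if "a \<noteq> 0" for a :: 'a
      using that by (simp add: field_simps)
    have cr: "card ({..r}-{k}) = r" using that by (simp add: card_Diff_singleton)
    have "(\<Prod>l<r. t l (r-1) * (1 - c / t l (r-1))) = (\<Prod>l<r. - (c - t l (r-1)))"
      by (intro prod.cong refl e nz) auto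
    moreover have "(\<Prod>l\<in>{..r}-{k}. t l r * (1 - c / t l r)) = (\<Prod>l\<in>{..r}-{k}. - (c - t l r))"
      by (intro prod.cong refl e nz) auto
    ultimately show ?thesis
      unfolding prod.distrib[symmetric] by (simp only: prod_uminus cr card_lessThan) simp
  qed
  \<comment> \<open>At a_k the factors x/q - t_{l,r+1} of \<open>P\<close> become those of
    \<open>f_coeff\<close> after a_k has been replaced by a_k/q.\<close>
  have TF: "e_coeff t r k * f_coeff (upd2 t k r (t k r / q)) r k = q ^ (r + 2) * (1 - q) * T (Some (False, k))"
    if k: "k \<le> r" for k
  proof -
    let ?a = "t k r" and ?t = "upd2 t k r (t k r / q)"
    define U where "U = (\<Prod>l\<le>Suc r. ?a / q - t l (Suc r))"
    define D where "D = (\<Prod>l\<in>{..r}-{k}. ?a - q * t l r)"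
    define N where "N = (\<Prod>l<r. ?a - t l (r-1)) / (\<Prod>l\<in>{..r}-{k}. ?a - t l r)"
    have cr: "card ({..r}-{k}) = r" using k by (simp add: card_Diff_singleton)
    have "(\<Prod>l\<le>Suc r. ?t k r - ?t l (Suc r)) = U"
      unfolding U_def by (intro prod.cong) (auto simp: upd2_def)
    moreover have "(\<Prod>l<r. ?t l (r-1)) = (\<Prod>l<r. t l (r-1))"
      by (intro prod.cong) (auto simp: upd2_def)
    moreover have "(\<Prod>l\<in>{..r}-{k}. (?t k r - ?t l r) * ?t l r) = inverse q ^ r * D * (\<Prod>l\<in>{..r}-{k}. t l r)"
    proof -
      have "(\<Prod>l\<in>{..r}-{k}. (?t k r - ?t l r) * ?t l r) = (\<Prod>l\<in>{..r}-{k}. inverse q * (?a - q * t l r) * t l r)"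
        using q by (intro prod.cong) (auto simp: upd2_def field_simps)
      then show ?thesis by (simp add: prod.distrib D_def cr)
    qed
    moreover have "?t k r = ?a / q" by (simp add: upd2_def)
    ultimately have "f_coeff ?t r k = U * (\<Prod>l<r. t l (r-1)) / ((?a / q)\<^sup>2 * (inverse q ^ r * D * (\<Prod>l\<in>{..r}-{k}. t l r)))"
      by (simp add: f_coeff_def)
    then have "e_coeff t r k * f_coeff ?t r k = U / ((?a / q)\<^sup>2 * (inverse q ^ r * D)) *
       ((\<Prod>l<r. t l (r-1)) * (\<Prod>l<r. 1 - ?a / t l (r-1)) / ((\<Prod>l\<in>{..r}-{k}. t l r) * (\<Prod>l\<in>{..r}-{k}. 1 - ?a / t l r)))"
      by (simp add: e_coeff_def mult_ac)
    also have "\<dots> = U / ((?a / q)\<^sup>2 * (inverse q ^ r * D)) * N"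
      by (simp only: signs[OF k] N_def)
    finally have L: "e_coeff t r k * f_coeff ?t r k = U / ((?a / q)\<^sup>2 * (inverse q ^ r * D)) * N" .
    have "poly P ?a = (\<Prod>l<r. ?a - t l (r-1)) * U"
      unfolding P_def U_def by (simp add: poly_prod divide_inverse mult_ac)
    moreover have "(\<Prod>l\<in>J-{Some (False, k)}. x (Some (False, k)) - x l)
       = ?a * ((?a - q * ?a) * D * (\<Prod>l\<in>{..r}-{k}. ?a - t l r))"
      unfolding prodJk[OF k] D_def xs if_False if_True simp_thms by (simp only: xs mult_ac diff_0_right)
    ultimately have Tk: "T (Some (False, k)) = U / (?a * (?a - q * ?a) * D) * N"
      by (simp add: T_def xs N_def mult_ac)
    have aq: "?a - q * ?a = (1 - q) * ?a" by (simp add: algebra_simps)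
    have "U / ((?a / q)\<^sup>2 * (inverse q ^ r * D)) * N = q ^ (r + 2) * w * (U / (?a * (w * ?a) * D) * N)"
      if "w \<noteq> 0" for w
      using q nz[of k r] k that
      by (cases "D = 0") (simp_all add: power2_eq_square power_add power_inverse divide_simps)
    from this[of "1 - q"] show ?thesis unfolding L Tk aq using q1 by (metis right_minus_eq)
  qed
  \<comment> \<open>At q a_k the same factors become a_k - t_{l,r+1}, those of the unshifted
    \<open>f_coeff\<close>. The sign comes from q a_k - a_k = -(1 - q) a_k.\<close>
  have TT: "f_coeff t r k * e_coeff (upd2 t k r (q * t k r)) r k = - (q ^ (r + 1) * (1 - q) * T (Some (True, k)))"
    if k: "k \<le> r" for k
  proof -
    let ?a = "t k r" and ?t = "upd2 t k r (q * t k r)"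
    define U where "U = (\<Prod>l\<le>Suc r. ?a - t l (Suc r))"
    define D where "D = (\<Prod>l\<in>{..r}-{k}. ?a - t l r)"
    define N where "N = (\<Prod>l<r. q * ?a - t l (r-1)) / (\<Prod>l\<in>{..r}-{k}. q * ?a - t l r)"
    have cr: "card ({..r}-{k}) = r" using k by (simp add: card_Diff_singleton)
    have "(\<Prod>l<r. 1 - ?t k r / ?t l (r-1)) = (\<Prod>l<r. 1 - q * ?a / t l (r-1))"
      by (intro prod.cong) (auto simp: upd2_def)
    moreover have "(\<Prod>l\<in>{..r}-{k}. 1 - ?t k r / ?t l r) = (\<Prod>l\<in>{..r}-{k}. 1 - q * ?a / t l r)"
      by (intro prod.cong) (auto simp: upd2_def)
    ultimately have "e_coeff ?t r k = (\<Prod>l<r. 1 - q * ?a / t l (r-1)) / (\<Prod>l\<in>{..r}-{k}. 1 - q * ?a / t l r)"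
      by (simp add: e_coeff_def)
    moreover have "f_coeff t r k = U * (\<Prod>l<r. t l (r-1)) / (?a\<^sup>2 * (D * (\<Prod>l\<in>{..r}-{k}. t l r)))"
      by (simp add: f_coeff_def U_def D_def prod.distrib)
    ultimately have "f_coeff t r k * e_coeff ?t r k = U / (?a\<^sup>2 * D) *
       ((\<Prod>l<r. t l (r-1)) * (\<Prod>l<r. 1 - q * ?a / t l (r-1)) / ((\<Prod>l\<in>{..r}-{k}. t l r) * (\<Prod>l\<in>{..r}-{k}. 1 - q * ?a / t l r)))"
      by (simp add: mult_ac)
    also have "\<dots> = U / (?a\<^sup>2 * D) * N"
      by (simp only: signs[OF k] N_def)
    finally have L: "f_coeff t r k * e_coeff ?t r k = U / (?a\<^sup>2 * D) * N" .
    have q_cancel: "inverse q * (q * ?a) = ?a" "q * ?a * inverse q = ?a" "q * (?a * inverse q) = ?a"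
      using q by (simp_all add: field_simps)
    have "poly P (q * ?a) = (\<Prod>l<r. q * ?a - t l (r-1)) * U"
      by (simp add: P_def U_def poly_prod q_cancel)
    moreover have "(\<Prod>l\<in>J-{Some (True, k)}. x (Some (True, k)) - x l)
       = q * ?a * ((q * ?a - ?a) * (q ^ r * D) * (\<Prod>l\<in>{..r}-{k}. q * ?a - t l r))"
    proof -
      have "(\<Prod>l\<in>{..r}-{k}. q * ?a - q * t l r) = q ^ r * D"
        by (simp only: right_diff_distrib[symmetric] prod.distrib prod_constant cr D_def)
      then show ?thesis
        unfolding prodJk[OF k] by (simp only: simp_thms xs mult_ac diff_0_right)
    qed
    ultimately have Tk: "T (Some (True, k)) = U / (q * ?a * (q * ?a - ?a) * (q ^ r * D)) * N"
      by (simp add: T_def xs N_def mult_ac)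
    have aq: "q * ?a - ?a = - ((1 - q) * ?a)" by (simp add: algebra_simps)
    have "U / (?a\<^sup>2 * D) * N = - (q ^ (r + 1) * w * (U / (q * ?a * (- (w * ?a)) * (q ^ r * D)) * N))"
      if "w \<noteq> 0" for w
      using q nz[of k r] k that
      by (cases "D = 0") (simp_all add: power2_eq_square power_add power_inverse divide_simps)
    from this[of "1 - q"] show ?thesis unfolding L Tk aq using q1 by (metis right_minus_eq)
  qed
  have "(\<Sum>k\<le>r. e_coeff t r k * f_coeff (upd2 t k r (t k r / q)) r k)
       - q * (\<Sum>k\<le>r. f_coeff t r k * e_coeff (upd2 t k r (q * t k r)) r k)
     = q ^ (r + 2) * (1 - q) * ((\<Sum>k\<le>r. T (Some (True, k))) + (\<Sum>k\<le>r. T (Some (False, k))))"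
    by (simp add: TF TT sum_distrib_left sum_negf distrib_left mult_ac)
  also have "\<dots> = q ^ (r + 2) * (1 - q) * (inverse q ^ (r + 2) - T None)"
  proof -
    have "(\<Sum>k\<le>r. T (Some (True, k))) + (\<Sum>k\<le>r. T (Some (False, k))) = inverse q ^ (r + 2) - T None"
      using total by (simp only: sumJ sum.distrib eq_diff_eq add_ac)
    then show ?thesis by (rule arg_cong)
  qed
  also have "\<dots> = (1 - q) * (1 - q ^ (r + 2) * T None)"
  proof -
    have "q ^ (r + 2) * inverse q ^ (r + 2) = 1"
      using q by (simp only: power_mult_distrib[symmetric] right_inverse[OF q] power_one)
    then show ?thesis by (metis (no_types, opaque_lifting) mult.assoc mult.commute right_diff_distrib)
  qed
  also have "q ^ (r + 2) * T None = q * (\<Prod>l<r. t l (r - 1)) * (\<Prod>l\<le>Suc r. t l (Suc r)) / (\<Prod>l\<le>r. t l r)\<^sup>2"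
    unfolding TN using q by simp
  finally show ?thesis .
qed

section \<open>The Gelfand--Tsetlin model\<close>

definition raise :: "(nat \<Rightarrow> nat \<Rightarrow> nat) \<Rightarrow> nat \<Rightarrow> nat \<Rightarrow> nat \<Rightarrow> nat \<Rightarrow> nat" where
  "raise m k r = upd2 m k r (Suc (m k r))"

definition lower :: "(nat \<Rightarrow> nat \<Rightarrow> nat) \<Rightarrow> nat \<Rightarrow> nat \<Rightarrow> nat \<Rightarrow> nat \<Rightarrow> nat" where
  "lower m k r = upd2 m k r (m k r - 1)"

definition node :: "'a::field \<Rightarrow> (nat \<Rightarrow> 'a) \<Rightarrow> (nat \<Rightarrow> nat \<Rightarrow> nat) \<Rightarrow> nat \<Rightarrow> nat \<Rightarrow> 'a" where
  "node q z m k i = q powi (- int (m k i)) * zprod z 0 k"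

definition gt_array :: "nat \<Rightarrow> (nat \<Rightarrow> nat \<Rightarrow> nat) \<Rightarrow> bool" where
  "gt_array n m \<longleftrightarrow> (\<forall>k i. \<not> (k \<le> i \<and> i \<le> n) \<longrightarrow> m k i = 0) \<and>
     (\<forall>k\<le>n. m k n = 0 \<and> (\<forall>i. k \<le> i \<and> i < n \<longrightarrow> m k (i + 1) \<le> m k i))"

definition row_sum :: "(nat \<Rightarrow> nat \<Rightarrow> nat) \<Rightarrow> nat \<Rightarrow> nat" where
  "row_sum m i = (\<Sum>k<i. m k (i - 1))"

definition wt :: "nat \<Rightarrow> (nat \<Rightarrow> nat \<Rightarrow> nat) \<Rightarrow> weight" where
  "wt n m = root_sum n (row_sum m)"

lemma arrays_alt: "arrays n d = {m. gt_array n m \<and> (\<forall>i\<in>{1..n}. row_sum m i = d i)}"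
  by (auto simp: arrays_def gt_array_def row_sum_def)

section \<open>Weights, row sums and the boundary of the set of arrays\<close>

lemma form_alpha: "form n (alpha i) \<gamma> = \<gamma> (i - 1) - \<gamma> i" if "i \<in> {1..n}"
proof -
  have "form n (alpha i) \<gamma> = (\<Sum>k\<le>n. (if k = i - 1 then \<gamma> k else 0) - (if k = i then \<gamma> k else 0))"
    unfolding form_def alpha_def eps_def by (intro sum.cong) auto
  also have "\<dots> = \<gamma> (i - 1) - \<gamma> i"
    using that by (auto simp: sum_subtractf)
  finally show ?thesis .
qed

lemma form_rho_alpha:
  assumes i: "i \<in> {1..n}" shows "form n (rho n) (alpha i) = 1"
proof -
  have "rho n k = int (n - k)" if "k \<le> n" for k
  proof -
    have "rho n k = (\<Sum>i=1..n. if k < i then 1 else 0)"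
      unfolding rho_def omega_def eps_def by (intro sum.cong) auto
    also have "\<dots> = int (card ({1..n} \<inter> {i. k < i}))" by (simp add: sum.If_cases)
    also have "{1..n} \<inter> {i. k < i} = {k<..n}" by auto
    finally show ?thesis by simp
  qed
  moreover have "form n (rho n) (alpha i) = rho n (i - 1) - rho n i"
    using form_alpha[OF i, of "rho n"] by (simp add: form_def mult.commute)
  ultimately show ?thesis using i by (auto simp: of_nat_diff)
qed

lemma root_sum_alt:
  "root_sum n d k = (if k < n then int (d (Suc k)) else 0) - (if 1 \<le> k \<and> k \<le> n then int (d k) else 0)"
proof -
  have "root_sum n d k = (\<Sum>i=1..n. (if i = Suc k then int (d i) else 0) - (if i = k then int (d i) else 0))"
    unfolding root_sum_def alpha_def eps_def by (intro sum.cong) auto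
  also have "\<dots> = (if k < n then int (d (Suc k)) else 0) - (if 1 \<le> k \<and> k \<le> n then int (d k) else 0)"
    by (auto simp: sum_subtractf)
  finally show ?thesis .
qed

lemma form_alpha_root_sum:
  assumes "i \<in> {1..n}"
  shows "form n (alpha i) (root_sum n d) =
    2 * int (d i) - (if 1 < i then int (d (i - 1)) else 0) - (if i < n then int (d (i + 1)) else 0)"
  using assms by (auto simp: form_alpha root_sum_alt)

text \<open>Triangularity: for i < n, coordinate i of \<open>root_sum n d\<close> is d(i+1) - d(i),
  without the second term at i = 0.\<close>

lemma root_sum_inj:
  assumes "root_sum n d = root_sum n d'" "i \<in> {1..n}" shows "d i = d' i"
proof -
  have "i \<in> {1..n} \<longrightarrow> d i = d' i" for i
  proof (induction i)
    case (Suc i)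
    then show ?case using fun_cong[OF assms(1), of i] by (auto simp: root_sum_alt split: if_splits)
  qed simp
  then show ?thesis using assms(2) by blast
qed

lemma root_sum_Suc:
  assumes "i \<in> {1..n}"
  shows "root_sum n (d(i := Suc (d i))) = (\<lambda>k. root_sum n d k + alpha i k)"
proof
  fix k
  have "root_sum n (d(i := Suc (d i))) k = (\<Sum>j=1..n. int (d j) * alpha j k + (if j = i then alpha i k else 0))"
    unfolding root_sum_def by (intro sum.cong) (auto simp: algebra_simps)
  also have "\<dots> = root_sum n d k + alpha i k"
    using assms by (simp add: sum.distrib root_sum_def)
  finally show "root_sum n (d(i := Suc (d i))) k = root_sum n d k + alpha i k" .
qed

lemma row_sum_raise: "k \<le> r \<Longrightarrow> row_sum (raise m k r) = (row_sum m)(Suc r := Suc (row_sum m (Suc r)))"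
proof
  fix i assume k: "k \<le> r"
  have "(\<Sum>l\<le>r. raise m k r l r) = Suc (\<Sum>l\<le>r. m l r)"
    using k by (simp add: sum.remove[of "{..r}" k "\<lambda>l. raise m k r l r"] sum.remove[of "{..r}" k "\<lambda>l. m l r"])
      (auto simp: raise_def upd2_def intro!: sum.cong)
  moreover have "i \<noteq> Suc r \<Longrightarrow> row_sum (raise m k r) i = row_sum m i"
    unfolding row_sum_def by (intro sum.cong) (auto simp: raise_def upd2_def)
  ultimately show "row_sum (raise m k r) i = ((row_sum m)(Suc r := Suc (row_sum m (Suc r)))) i"
    by (cases "i = Suc r") (simp_all add: row_sum_def lessThan_Suc_atMost)
qed

lemma wt_raise: "k \<le> r \<Longrightarrow> r < n \<Longrightarrow> wt n (raise m k r) = (\<lambda>i. wt n m i + alpha (Suc r) i)"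
  by (simp add: wt_def row_sum_raise root_sum_Suc)

lemma raise_lower: "0 < m k r \<Longrightarrow> raise (lower m k r) k r = m"
  by (auto simp: raise_def lower_def upd2_def fun_eq_iff)

lemma lower_raise: "lower (raise m k r) k r = m"
  by (auto simp: raise_def lower_def upd2_def fun_eq_iff)

lemma lower_raise_commute: "(k, s) \<noteq> (p, r) \<Longrightarrow> lower (raise m p r) k s = raise (lower m k s) p r"
  by (auto simp: raise_def lower_def upd2_def fun_eq_iff)

lemma gt_array_raise_iff:
  assumes "gt_array n m" "k \<le> r" "r < n"
  shows "gt_array n (raise m k r) \<longleftrightarrow> k = r \<or> m k r < m k (r - 1)"
proof
  assume L: "gt_array n (raise m k r)"
  show "k = r \<or> m k r < m k (r - 1)"
  proof (cases "k = r")
    case False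
    then have "k \<le> r - 1" "r - 1 < n" "r - 1 + 1 = r" using assms by auto
    with L have "raise m k r k r \<le> raise m k r k (r - 1)"
      using assms unfolding gt_array_def by (metis le_trans less_imp_le_nat)
    then show ?thesis using \<open>r - 1 + 1 = r\<close> by (auto simp: raise_def upd2_def split: if_splits)
  qed simp
next
  assume "k = r \<or> m k r < m k (r - 1)"
  then show "gt_array n (raise m k r)"
    using assms unfolding gt_array_def raise_def upd2_def
    by (auto simp: le_Suc_eq) 
qed

lemma gt_array_lower_iff:
  assumes "gt_array n m" "k \<le> r" "r < n" 
  shows "0 < m k r \<and> gt_array n (lower m k r) \<longleftrightarrow> m k (Suc r) < m k r"
proof
  assume L: "0 < m k r \<and> gt_array n (lower m k r)"
  then have "lower m k r k (r + 1) \<le> lower m k r k r"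
    using assms unfolding gt_array_def by (metis le_trans less_imp_le_nat)
  then show "m k (Suc r) < m k r" using L by (auto simp: lower_def upd2_def split: if_splits)
next
  assume "m k (Suc r) < m k r"
  then show "0 < m k r \<and> gt_array n (lower m k r)"
    using assms unfolding gt_array_def lower_def upd2_def
    by (auto intro: le_trans[OF diff_le_self])
qed

lemma gt_array_antimono: "gt_array n m \<Longrightarrow> k \<le> r \<Longrightarrow> r < n \<Longrightarrow> m k (Suc r) \<le> m k r"
  unfolding gt_array_def by (metis Suc_eq_plus1 le_trans less_imp_le_nat)

text \<open>Every entry is one term of a prescribed row sum, hence bounded by the total
  \<open>K\<close>.\<close>

lemma finite_arrays: "finite (arrays n d)"
proof -
  define K where "K = (\<Sum>i=1..n. d i)"
  define F where "F = {f :: nat \<Rightarrow> nat. \<forall>i. (i \<in> {..n} \<longrightarrow> f i \<in> {..K}) \<and> (i \<notin> {..n} \<longrightarrow> f i = 0)}"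
  have "finite F" unfolding F_def by (rule finite_set_of_finite_funs) auto
  then have "finite {m. \<forall>k. (k \<in> {..n} \<longrightarrow> m k \<in> F) \<and> (k \<notin> {..n} \<longrightarrow> m k = (\<lambda>_. 0))}"
    by (intro finite_set_of_finite_funs) auto
  moreover have "arrays n d \<subseteq> {m. \<forall>k. (k \<in> {..n} \<longrightarrow> m k \<in> F) \<and> (k \<notin> {..n} \<longrightarrow> m k = (\<lambda>_. 0))}"
  proof
    fix m assume m: "m \<in> arrays n d"
    have le: "m k i \<le> K" for k i
    proof (cases "k \<le> i \<and> i < n")
      case True
      have "m k i \<le> (\<Sum>k<Suc i. m k i)" using True by (intro member_le_sum) auto
      also have "\<dots> = d (Suc i)"
      proof -
        have "\<forall>i\<in>{1..n}. (\<Sum>k<i. m k (i - 1)) = d i" using m by (simp add: arrays_def)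
        from bspec[OF this, of "Suc i"] show ?thesis using True by simp
      qed
      also have "\<dots> \<le> K" unfolding K_def using True by (intro member_le_sum) auto
      finally show ?thesis .
    next
      case False
      then have "m k i = 0" using m unfolding arrays_def by (cases "i = n") auto
      then show ?thesis by simp
    qed
    have "m k i = 0" if "i > n \<or> k > n" for k i
      using m that unfolding arrays_def by auto
    then show "m \<in> {m. \<forall>k. (k \<in> {..n} \<longrightarrow> m k \<in> F) \<and> (k \<notin> {..n} \<longrightarrow> m k = (\<lambda>_. 0))}"
      using le by (auto simp: F_def fun_eq_iff)
  qed
  ultimately show ?thesis by (rule finite_subset[rotated])
qed

lemma finite_wt: "finite {m. gt_array n m \<and> wt n m = \<gamma>}"
proof (cases "\<exists>m. gt_array n m \<and> wt n m = \<gamma>")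
  case True
  then obtain m0 where m0: "wt n m0 = \<gamma>" by blast
  have "{m. gt_array n m \<and> wt n m = \<gamma>} \<subseteq> arrays n (row_sum m0)"
  proof
    fix m assume "m \<in> {m. gt_array n m \<and> wt n m = \<gamma>}"
    then have "gt_array n m" "root_sum n (row_sum m) = root_sum n (row_sum m0)"
      using m0 by (simp_all add: wt_def)
    then show "m \<in> arrays n (row_sum m0)"
      unfolding arrays_alt mem_Collect_eq by (intro conjI ballI root_sum_inj)
  qed
  then show ?thesis using finite_arrays by (rule finite_subset)
next
  case False
  then have "{m. gt_array n m \<and> wt n m = \<gamma>} = {}" by blast
  then show ?thesis by (rule ssubst) (rule finite.emptyI)
qed

lemma arrays_wt: "arrays n d = {m. gt_array n m \<and> wt n m = root_sum n d}"
proof -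
  have "root_sum n (row_sum m) = root_sum n d" if "\<forall>i\<in>{1..n}. row_sum m i = d i" for m
    using that by (auto simp: root_sum_def)
  then show ?thesis unfolding arrays_alt wt_def by (auto dest: root_sum_inj)
qed

text \<open>The form in which genericity enters the combinatorics: nodes in different columns never
  differ by a power of q, and nodes in one column coincide only if the entries do. This keeps the
  denominators nonzero.\<close>

locale gt_model =
  fixes n :: nat and q :: "'a::field" and z :: "nat \<Rightarrow> 'a"
  assumes q0: "q \<noteq> 0" and z0: "\<And>j. j \<in> {1..n} \<Longrightarrow> z j \<noteq> 0"
    and q_not_root: "\<And>c. q powi c = 1 \<Longrightarrow> c = 0"
    and z_generic: "\<And>k l c. k < l \<Longrightarrow> l \<le> n \<Longrightarrow> q powi c * zprod z k l \<noteq> 1"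
begin

lemma zprod_nz: "l \<le> n \<Longrightarrow> zprod z k l \<noteq> 0"
  using z0 by (auto simp: zprod_def)

lemma zprod_mult: "k \<le> l \<Longrightarrow> zprod z 0 k * zprod z k l = zprod z 0 l"
proof -
  assume "k \<le> l"
  then have "{0+1..l} = {0+1..k} \<union> {k+1..l}" "{0+1..k} \<inter> {k+1..l} = {}" by auto
  then show ?thesis unfolding zprod_def by (metis prod.union_disjoint finite_atLeastAtMost)
qed

lemma node_nz: "k \<le> n \<Longrightarrow> node q z m k i \<noteq> 0"
  using q0 zprod_nz by (simp add: node_def)

lemma node_ratio:
  assumes "k \<le> l" "l \<le> n"
  shows "node q z m l j / node q z m k i = q powi (int (m k i) - int (m l j)) * zprod z k l"
  unfolding node_def zprod_mult[OF assms(1), symmetric]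
  using q0 zprod_nz[of k 0] assms by (simp add: power_int_diff power_int_minus field_simps)

lemma powi_inj: "q powi a = q powi b \<longleftrightarrow> a = b"
proof
  assume "q powi a = q powi b"
  then have "q powi (a - b) = 1" using q0 by (simp add: power_int_diff)
  then show "a = b" using q_not_root by fastforce
qed simp

text \<open>Between different columns the equation would make some q-power times z_{k,l} equal to 1;
  within one column it compares powers of q.\<close>

lemma node_eq_iff:
  assumes "k \<le> n" "l \<le> n"
  shows "node q z m k i = q powi c * node q z m l j \<longleftrightarrow> k = l \<and> int (m k i) = int (m l j) - c"
proof -
  have ne: False if kl: "k < l" "l \<le> n" and e: "node q z m k i = q powi c * node q z m l j" for k l i j c
  proof -
    have "1 = q powi c * (node q z m l j / node q z m k i)"
      using e node_nz[of k m i] kl by simp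
    also have "\<dots> = q powi (c + (int (m k i) - int (m l j))) * zprod z k l"
      using kl q0 by (simp add: node_ratio power_int_add)
    finally show False using z_generic[OF kl] by metis
  qed
  consider "k < l" | "l < k" | "k = l" by linarith
  then show ?thesis
  proof cases
    case 2
    have "node q z m l j = q powi (- c) * node q z m k i" if "node q z m k i = q powi c * node q z m l j"
      using that q0 by (simp add: power_int_minus)
    then show ?thesis using ne 2 assms by blast
  next
    case 3
    have "node q z m k i = q powi c * node q z m k j \<longleftrightarrow> q powi (- int (m k i)) = q powi (c + - int (m k j))"
      using q0 zprod_nz[OF assms(1), of 0]
      by (simp only: node_def mult.assoc[symmetric] mult_cancel_right power_int_add simp_thms)
    also have "\<dots> \<longleftrightarrow> - int (m k i) = c + - int (m k j)" by (rule powi_inj)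
    finally show ?thesis using 3 by auto
  qed (use ne assms in blast)
qed

lemma node_eq: "k \<le> n \<Longrightarrow> l \<le> n \<Longrightarrow> node q z m k i = node q z m l j \<longleftrightarrow> k = l \<and> m k i = m l j"
  using node_eq_iff[of k l m i 0 j] by simp

lemma node_eq_q: "k \<le> n \<Longrightarrow> l \<le> n \<Longrightarrow> node q z m k i = q * node q z m l j \<longleftrightarrow> k = l \<and> Suc (m k i) = m l j"
  using node_eq_iff[of k l m i 1 j] by auto

lemma node_raise: "node q z (raise m k r) = upd2 (node q z m) k r (node q z m k r / q)"
proof -
  have "- int (Suc a) = - int a - 1" for a by simp
  then have "q powi (- int (Suc a)) = q powi (- int a) / q" for a
    using q0 by (simp only: power_int_diff power_int_1_right simp_thms)
  then show ?thesis by (auto simp: node_def raise_def upd2_def fun_eq_iff simp del: of_nat_Suc)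
qed

lemma node_lower: "0 < m k r \<Longrightarrow> node q z (lower m k r) = upd2 (node q z m) k r (q * node q z m k r)"
proof -
  assume pos: "0 < m k r"
  then have "node q z m = upd2 (node q z (lower m k r)) k r (node q z (lower m k r) k r / q)"
    by (metis node_raise raise_lower)
  then show ?thesis using q0 by (auto simp: upd2_def fun_eq_iff)
qed

lemma inj_node: "r \<le> n \<Longrightarrow> inj_on (\<lambda>l. node q z m l r) {..r}"
  by (auto simp: inj_on_def node_eq)

text \<open>The numerator factor \<open>l = k\<close> vanishes exactly at m_{k,r} = m_{k,r-1}, and
  genericity keeps all others nonzero. Vanishing lets sums over k run freely across the boundary;
  nonvanishing drives the injectivity argument.\<close>

lemma e_coeff_eq_0_iff:
  assumes "gt_array n m" "k \<le> r" "r < n"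
  shows "e_coeff (node q z m) r k = 0 \<longleftrightarrow> \<not> gt_array n (raise m k r)"
proof -
  have "(\<Prod>l\<in>{..r}-{k}. 1 - node q z m k r / node q z m l r) \<noteq> 0"
    using assms node_nz by (auto simp: node_eq)
  then have "e_coeff (node q z m) r k = 0 \<longleftrightarrow> (\<exists>l<r. node q z m k r = node q z m l (r - 1))"
    using assms node_nz by (auto simp: e_coeff_def)
  also have "\<dots> \<longleftrightarrow> k < r \<and> m k r = m k (r - 1)"
    using assms by (auto simp: node_eq)
  also have "\<dots> \<longleftrightarrow> \<not> gt_array n (raise m k r)"
    using gt_array_raise_iff[OF assms] gt_array_antimono[of n m k "r - 1"] assms by auto
  finally show ?thesis .
qed

lemma e_coeff_dual_eq_0:
  assumes "gt_array n m" "k \<le> r" "r < n" "\<not> gt_array n (raise m k r)"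
  shows "e_coeff_dual (node q z m) r k = 0"
proof -
  have "k < r" "m k r = m k (r - 1)"
    using gt_array_raise_iff[OF assms(1-3)] gt_array_antimono[of n m k "r - 1"] assms by auto
  then show ?thesis using assms by (auto simp: e_coeff_dual_def node_eq intro!: exI[of _ k] bexI[of _ k])
qed

lemma f_coeff_eq_0:
  assumes "gt_array n m" "k \<le> r" "r < n" "\<not> (0 < m k r \<and> gt_array n (lower m k r))"
  shows "f_coeff (node q z m) r k = 0"
proof -
  have "m k r = m k (Suc r)"
    using gt_array_lower_iff[OF assms(1-3)] gt_array_antimono[OF assms(1-3)] assms(4) by auto
  then have "(\<Prod>l\<le>Suc r. node q z m k r - node q z m l (Suc r)) = 0"
    using assms by (auto simp del: prod.atMost_Suc simp: node_eq intro!: bexI[of _ k])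
  then show ?thesis by (simp add: f_coeff_def)
qed

text \<open>
  A function \<open>X\<close> is the family of coefficients of a vector in the Gelfand--Tsetlin basis, so the
  operator \<open>gt_e r\<close>, which lowers $m_{k,r}$ on basis vectors, reads off values of \<open>X\<close> at the raised
  arrays. At the boundary \<open>lower\<close> truncates, but there \<open>f_coeff\<close> vanishes.
\<close>

definition gt_e :: "nat \<Rightarrow> ((nat \<Rightarrow> nat \<Rightarrow> nat) \<Rightarrow> 'a) \<Rightarrow> (nat \<Rightarrow> nat \<Rightarrow> nat) \<Rightarrow> 'a" where
  "gt_e r X m = (if gt_array n m then \<Sum>k\<le>r. e_coeff (node q z m) r k * X (raise m k r) else 0)"

definition gt_f :: "nat \<Rightarrow> ((nat \<Rightarrow> nat \<Rightarrow> nat) \<Rightarrow> 'a) \<Rightarrow> (nat \<Rightarrow> nat \<Rightarrow> nat) \<Rightarrow> 'a" where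
  "gt_f r X m = (if gt_array n m then \<Sum>k\<le>r. f_coeff (node q z m) r k * X (lower m k r) else 0)"

lemma prod_powi: "(\<Prod>l\<in>A. q powi f l) = q powi (\<Sum>l\<in>A. f l)"
  using q0 by (induction A rule: infinite_finite_induct) (auto simp: power_int_add)

lemma prod_node: "r \<le> n \<Longrightarrow> (\<Prod>l\<le>r. node q z m l r) = q powi (- int (row_sum m (Suc r))) * (\<Prod>l\<le>r. zprod z 0 l)"
proof -
  have "(\<Prod>l\<le>r. q powi (- int (m l r))) = q powi (- int (\<Sum>l\<le>r. m l r))"
    by (simp only: prod_powi sum_negf of_nat_sum)
  then show ?thesis by (simp add: node_def prod.distrib row_sum_def lessThan_Suc_atMost)
qed

text \<open>The product of the nodes of row r is q^(-d_{r+1}) times a monomial in \<open>z\<close>,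
  where d denotes the row sums. The q-exponents combine to 2 d_{r+1} - d_r - d_{r+2}, and the
  z-monomials of rows r - 1, r, r + 1 leave the single factor z_{r+1}.\<close>

lemma cartan_factor:
  assumes "gt_array n m" "r < n"
  shows "q * (\<Prod>l<r. node q z m l (r - 1)) * (\<Prod>l\<le>Suc r. node q z m l (Suc r)) / (\<Prod>l\<le>r. node q z m l r)\<^sup>2
    = q powi (1 + form n (alpha (Suc r)) (wt n m)) * z (Suc r)"
proof -
  define Z where "Z r = (\<Prod>l\<le>r. zprod z 0 l)" for r
  define Z' where "Z' = (\<Prod>l<r. zprod z 0 l)"
  have 1: "(\<Prod>l<r. node q z m l (r - 1)) = q powi (- (if 0 < r then int (row_sum m r) else 0)) * Z'"
    using prod_node[of "r - 1" m] assms by (cases r) (auto simp: Z'_def lessThan_Suc_atMost)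
  \<comment> \<open>For r + 1 = n the next row is row n, which is identically 0. This matches the
    missing term d_{n+1} in the pairing with alpha_n.\<close>
  have last: "row_sum m (Suc n) = 0" using assms(1) by (auto simp: row_sum_def gt_array_def)
  have 2: "(\<Prod>l\<le>Suc r. node q z m l (Suc r)) =
      q powi (- (if Suc r < n then int (row_sum m (Suc (Suc r))) else 0)) * Z (Suc r)"
    using prod_node[of "Suc r" m] assms last by (cases "Suc r = n") (auto simp: Z_def)
  have 3: "(\<Prod>l\<le>r. node q z m l r)\<^sup>2 = q powi (- (2 * int (row_sum m (Suc r)))) * (Z r)\<^sup>2"
  proof -
    have "(q powi a)\<^sup>2 = q powi (2 * a)" for a
      using q0 power_int_add[of q a a] by (simp add: power2_eq_square)
    then show ?thesis using assms(2) by (simp only: prod_node less_imp_le Z_def power_mult_distrib mult_minus_right)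
  qed
  have Znz: "Z r \<noteq> 0" "Z' \<noteq> 0" using zprod_nz assms by (auto simp: Z_def Z'_def)
  have zp: "zprod z 0 (Suc r) = zprod z 0 r * z (Suc r)"
    by (simp add: zprod_def prod.nat_ivl_Suc')
  have "Z r = Z' * zprod z 0 r" by (simp add: Z_def Z'_def flip: lessThan_Suc_atMost)
  moreover have "Z (Suc r) = Z r * zprod z 0 (Suc r)" by (simp add: Z_def)
  ultimately have 4: "Z' * Z (Suc r) / (Z r)\<^sup>2 = z (Suc r)"
    unfolding zp using Znz by (simp add: power2_eq_square)
  have ex: "1 + form n (alpha (Suc r)) (wt n m) = 1 + - (if 0 < r then int (row_sum m r) else 0)
       + - (if Suc r < n then int (row_sum m (Suc (Suc r))) else 0) + 2 * int (row_sum m (Suc r))"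
    using assms(2) by (simp add: wt_def form_alpha_root_sum)
  have "q * (q powi a * Z') * (q powi b * Z (Suc r)) / (q powi - c * (Z r)\<^sup>2) = q powi (1 + a + b + c) * z (Suc r)" for a b c
    unfolding 4[symmetric] using q0 by (simp add: power_int_add power_int_minus divide_inverse mult_ac)
  then show ?thesis unfolding 1 2 3 ex by blast
qed

text \<open>Terms that raise and lower different positions match one by one. The diagonal terms
  match only after summation over k, and they produce the Cartan scalar.\<close>

lemma gt_e_f:
  assumes m: "gt_array n m" and r: "r < n" and s: "s < n"
  shows "gt_e r (gt_f s X) m = comm_factor q r s * gt_f s (gt_e r X) m +
    (if r = s then (1 - q) * (1 - q powi (1 + form n (alpha (Suc r)) (wt n m)) * z (Suc r)) * X m else 0)"
proof -
  let ?t = "node q z m"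
  define L where "L p k = e_coeff ?t r p * f_coeff (upd2 ?t p r (?t p r / q)) s k * X (lower (raise m p r) k s)" for p k
  define R where "R p k = f_coeff ?t s k * e_coeff (upd2 ?t k s (q * ?t k s)) r p * X (raise (lower m k s) p r)" for p k
  have LHS: "gt_e r (gt_f s X) m = (\<Sum>p\<le>r. \<Sum>k\<le>s. L p k)"
  proof -
    \<comment> \<open>At an invalid raised array \<open>gt_f\<close> is 0 by definition, and the
      right-hand side is 0 because the coefficient vanishes.\<close>
    have "e_coeff ?t r p * gt_f s X (raise m p r) = (\<Sum>k\<le>s. L p k)" if "p \<le> r" for p
      using e_coeff_eq_0_iff[OF m that r]
      by (cases "gt_array n (raise m p r)") (auto simp: gt_f_def L_def node_raise sum_distrib_left mult.assoc)
    then show ?thesis using m by (simp add: gt_e_def)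
  qed
  have RHS: "gt_f s (gt_e r X) m = (\<Sum>k\<le>s. \<Sum>p\<le>r. R p k)"
  proof -
    have "f_coeff ?t s k * gt_e r X (lower m k s) = (\<Sum>p\<le>r. R p k)" if "k \<le> s" for k
      using f_coeff_eq_0[OF m that s] 
      by (cases "0 < m k s \<and> gt_array n (lower m k s)") (auto simp: gt_e_def R_def node_lower sum_distrib_left mult.assoc)
    then show ?thesis using m by (simp add: gt_f_def)
  qed
  have LR: "L p k = comm_factor q r s * R p k" if "p \<le> r" "k \<le> s" "(p, r) \<noteq> (k, s)" for p k
    unfolding L_def R_def
    using e_f_coeff_commute[of q ?t p r k s] that q0 node_nz[of p m r] node_nz[of k m s] r s
    by (subst lower_raise_commute) (auto simp: mult.assoc)
  show ?thesis
  proof (cases "r = s")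
    case False
    then have "(\<Sum>p\<le>r. \<Sum>k\<le>s. L p k) = (\<Sum>p\<le>r. \<Sum>k\<le>s. comm_factor q r s * R p k)"
      by (intro sum.cong refl LR) auto
    also have "\<dots> = comm_factor q r s * (\<Sum>k\<le>s. \<Sum>p\<le>r. R p k)"
      by (subst sum.swap) (simp add: sum_distrib_left)
    finally show ?thesis using False by (simp add: LHS RHS)
  next
    case True
    have split: "(\<Sum>p\<le>r. \<Sum>k\<le>r. G p k) = (\<Sum>p\<le>r. G p p) + (\<Sum>p\<le>r. \<Sum>k\<in>{..r}-{p}. G p k)"
      for G :: "nat \<Rightarrow> nat \<Rightarrow> 'a"
    proof -
      have "(\<Sum>k\<le>r. G p k) = G p p + (\<Sum>k\<in>{..r}-{p}. G p k)" if "p \<in> {..r}" for p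
        using that by (intro sum.remove) auto
      then show ?thesis by (simp add: sum.distrib)
    qed
    have c: "comm_factor q r s = q" using True by (simp add: comm_factor_def)
    have off: "(\<Sum>p\<le>r. \<Sum>k\<in>{..r}-{p}. L p k) = q * (\<Sum>p\<le>r. \<Sum>k\<in>{..r}-{p}. R p k)"
      unfolding sum_distrib_left using True LR c by (intro sum.cong) auto
    have dL: "(\<Sum>p\<le>r. L p p) = (\<Sum>k\<le>r. e_coeff ?t r k * f_coeff (upd2 ?t k r (?t k r / q)) r k) * X m"
      using True by (simp add: L_def lower_raise sum_distrib_right)
    have "R k k = f_coeff ?t r k * e_coeff (upd2 ?t k r (q * ?t k r)) r k * X m" if "k \<le> r" for k
      using f_coeff_eq_0[OF m that r] True by (cases "0 < m k r") (auto simp: R_def raise_lower)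
    then have dR: "(\<Sum>p\<le>r. R p p) = (\<Sum>k\<le>r. f_coeff ?t r k * e_coeff (upd2 ?t k r (q * ?t k r)) r k) * X m"
      by (simp add: sum_distrib_right)
    have diag: "(\<Sum>k\<le>r. e_coeff ?t r k * f_coeff (upd2 ?t k r (?t k r / q)) r k)
       - q * (\<Sum>k\<le>r. f_coeff ?t r k * e_coeff (upd2 ?t k r (q * ?t k r)) r k)
       = (1 - q) * (1 - q powi (1 + form n (alpha (Suc r)) (wt n m)) * z (Suc r))"
      unfolding cartan_factor[OF m r, symmetric]
      by (rule sum_e_f_coeff_diagonal) (use q0 node_nz r inj_node[of r] node_eq_q in auto)
    have "(\<Sum>p\<le>r. \<Sum>k\<le>r. L p k) - q * (\<Sum>p\<le>r. \<Sum>k\<le>r. R p k) =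
       (1 - q) * (1 - q powi (1 + form n (alpha (Suc r)) (wt n m)) * z (Suc r)) * X m"
      unfolding split off dL dR diag[symmetric] by (simp add: algebra_simps)
    moreover have "(\<Sum>k\<le>s. \<Sum>p\<le>r. R p k) = (\<Sum>p\<le>r. \<Sum>k\<le>r. R p k)"
      using True by (subst sum.swap) simp
    ultimately show ?thesis unfolding LHS RHS c using True by (simp add: algebra_simps)
  qed
qed

text \<open>The Whittaker equation for the constant function 1, one weight at a time: the
  coefficients of \<open>gt_e r\<close> add up to 1, and those leading outside the arrays
  vanish.\<close>

lemma gt_e_indicator:
  assumes r: "r < n" and m: "gt_array n m"
  shows "gt_e r (\<lambda>m. if gt_array n m \<and> wt n m = \<gamma> then 1 else 0) m
    = (if wt n m = (\<lambda>i. \<gamma> i - alpha (Suc r) i) then 1 else 0)"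
proof -
  have "gt_e r (\<lambda>m. if gt_array n m \<and> wt n m = \<gamma> then 1 else 0) m
     = (\<Sum>k\<le>r. e_coeff (node q z m) r k * (if wt n m = (\<lambda>i. \<gamma> i - alpha (Suc r) i) then 1 else 0))"
  proof -
    have "wt n (raise m k r) = \<gamma> \<longleftrightarrow> wt n m = (\<lambda>i. \<gamma> i - alpha (Suc r) i)" if "k \<le> r" for k
      using that r by (simp add: wt_raise fun_eq_iff algebra_simps)
    then have "e_coeff (node q z m) r k * (if gt_array n (raise m k r) \<and> wt n (raise m k r) = \<gamma> then 1 else 0)
      = e_coeff (node q z m) r k * (if wt n m = (\<lambda>i. \<gamma> i - alpha (Suc r) i) then 1 else 0)" if "k \<le> r" for k
      using that e_coeff_eq_0_iff[OF m that r] by simp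
    then have "(\<Sum>k\<le>r. e_coeff (node q z m) r k * (if gt_array n (raise m k r) \<and> wt n (raise m k r) = \<gamma> then 1 else 0))
      = (\<Sum>k\<le>r. e_coeff (node q z m) r k * (if wt n m = (\<lambda>i. \<gamma> i - alpha (Suc r) i) then 1 else 0))"
      by (intro sum.cong) auto
    then show ?thesis using m by (simp only: gt_e_def if_True)
  qed
  also have "\<dots> = (if wt n m = (\<lambda>i. \<gamma> i - alpha (Suc r) i) then 1 else 0)"
  proof -
    have "(\<Sum>k\<le>r. e_coeff (node q z m) r k) = 1"
      using r by (intro sum_e_coeff inj_node) (auto simp: node_nz)
    then show ?thesis by simp
  qed
  finally show ?thesis .
qed

section \<open>Joint injectivity of the e-operators in positive degree\<close>

definition gt_size :: "(nat \<Rightarrow> nat \<Rightarrow> nat) \<Rightarrow> nat" where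
  "gt_size m = (\<Sum>i=1..n. row_sum m i)"

lemma gt_size_raise: "k \<le> r \<Longrightarrow> r < n \<Longrightarrow> gt_size (raise m k r) = Suc (gt_size m)"
proof -
  assume "k \<le> r" "r < n"
  then have "gt_size (raise m k r) = (\<Sum>i=1..n. row_sum m i + (if i = Suc r then 1 else 0))"
    unfolding gt_size_def by (intro sum.cong) (auto simp: row_sum_raise)
  then show ?thesis using \<open>r < n\<close> by (simp add: sum.distrib gt_size_def)
qed

lemma gt_size_zero: "gt_array n m \<Longrightarrow> gt_size m = 0 \<Longrightarrow> m = (\<lambda>_ _. 0)"
proof (intro ext)
  fix k i assume m: "gt_array n m" "gt_size m = 0"
  show "m k i = 0"
  proof (cases "k \<le> i \<and> i < n")
    case True
    then have "row_sum m (Suc i) = 0" using m(2) by (auto simp: gt_size_def)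
    then show ?thesis using True by (auto simp: row_sum_def le_less)
  next
    case False
    then show ?thesis using m(1) unfolding gt_array_def by (cases "i = n") auto
  qed
qed

text \<open>
  By induction on \<open>r\<close>, \<open>X m \<noteq> 0\<close> forces $m_{k,i} = m_{k,i+1}$ for all $i < r$: if $m_{k,r} > m_{k,r+1}$,
  then in \<open>gt_e r X (lower m k r) = 0\<close> every term except that of \<open>m\<close> vanishes, because its
  coefficient is zero or its array violates the equalities in the smaller rows.
\<close>

lemma gt_e_jointly_injective:
  assumes ge0: "\<And>r m. r < n \<Longrightarrow> gt_array n m \<Longrightarrow> gt_size m = N \<Longrightarrow> gt_e r X m = 0"
    and m: "gt_array n m" "gt_size m = Suc N"
  shows "X m = 0"
proof -
  have step: "r \<le> n \<Longrightarrow> gt_array n m \<Longrightarrow> gt_size m = Suc N \<Longrightarrow> X m \<noteq> 0 \<Longrightarrow>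
      (\<forall>i<r. \<forall>k\<le>i. m k i = m k (Suc i))" for r m
  proof (induction r arbitrary: m)
    case (Suc r)
    have r: "r < n" using Suc.prems by simp
    have "m k r = m k (Suc r)" if k: "k \<le> r" for k
    proof (rule ccontr)
      assume "m k r \<noteq> m k (Suc r)"
      with gt_array_antimono[OF Suc.prems(2) k r] have "m k (Suc r) < m k r" by simp
      then have pos: "0 < m k r" and low: "gt_array n (lower m k r)"
        using gt_array_lower_iff[OF Suc.prems(2) k r] by auto
      let ?m = "lower m k r"
      have rl: "raise ?m k r = m" using pos by (rule raise_lower)
      have "gt_size ?m = N" using gt_size_raise[OF k r, of ?m] Suc.prems(3) rl by simp
      with low r have "(\<Sum>l\<le>r. e_coeff (node q z ?m) r l * X (raise ?m l r)) = 0"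
        using ge0[of r ?m] by (simp add: gt_e_def)
      moreover have "e_coeff (node q z ?m) r l * X (raise ?m l r) = 0" if l: "l \<in> {..r}-{k}" for l
      proof (rule ccontr)
        assume "e_coeff (node q z ?m) r l * X (raise ?m l r) \<noteq> 0"
        then have v: "gt_array n (raise ?m l r)" and X: "X (raise ?m l r) \<noteq> 0"
          using e_coeff_eq_0_iff[OF low _ r] l by auto
        have sz: "gt_size (raise ?m l r) = Suc N" using \<open>gt_size ?m = N\<close> l r by (simp add: gt_size_raise)
        have IH: "\<forall>i<r. \<forall>k\<le>i. raise ?m l r k i = raise ?m l r k (Suc i)"
          using Suc.IH[OF _ v sz X] r by simp
        have IH0: "\<forall>i<r. \<forall>k\<le>i. m k i = m k (Suc i)"
          using Suc.IH[OF _ Suc.prems(2-4)] r by simp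
        show False
        \<comment> \<open>Lowering changed the entry (k, r) and raising the entry (l, r). As k and l
          are distinct and at most r, one of them is below r, and in that column the required
          equality of rows r - 1 and r is broken.\<close>
        proof (cases "k < r")
          case True
          have "raise ?m l r k (r - 1) = raise ?m l r k r" "m k (r - 1) = m k r"
            using IH[rule_format, of "r - 1" k] IH0[rule_format, of "r - 1" k] True by auto
          moreover have "r - 1 \<noteq> r" using True by simp
          ultimately show False using True pos l by (simp add: raise_def lower_def upd2_def)
        next
          case False
          then have kr: "k = r" and lr: "l < r" using k l by auto
          have "raise ?m l r l (r - 1) = raise ?m l r l r" "m l (r - 1) = m l r"
            using IH[rule_format, of "r - 1" l] IH0[rule_format, of "r - 1" l] lr by auto
          moreover have "r - 1 \<noteq> r" using lr by simp
          ultimately show False using lr kr by (simp add: raise_def lower_def upd2_def)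
        qed
      qed
      ultimately have "e_coeff (node q z ?m) r k * X m = 0"
        using k by (subst (asm) sum.remove[of _ k]) (auto simp: rl)
      moreover have "e_coeff (node q z ?m) r k \<noteq> 0"
        using e_coeff_eq_0_iff[OF low k r] Suc.prems(2) rl by simp
      ultimately show False using Suc.prems(4) by simp
    qed
    moreover have "\<forall>i<r. \<forall>k\<le>i. m k i = m k (Suc i)"
      using Suc.IH[OF _ Suc.prems(2-4)] r by simp
    ultimately show ?case by (auto simp: less_Suc_eq)
  qed simp
  show ?thesis
  proof (rule ccontr)
    assume "X m \<noteq> 0"
    then have const: "\<forall>i<n. \<forall>k\<le>i. m k i = m k (Suc i)" using step[OF order_refl m] by blast
    \<comment> \<open>The equalities propagate the zero row n to every row, which contradicts the
      positive size.\<close>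
    have "m k (n - j) = 0" if "k \<le> n - j" for k j
      using that
    proof (induction j)
      case 0 then show ?case using m(1) by (auto simp: gt_array_def)
    next
      case (Suc j)
      show ?case
      proof (cases "j < n")
        case True
        then have "Suc (n - Suc j) = n - j" by simp
        then show ?thesis using const[rule_format, of "n - Suc j" k] Suc True by auto
      next
        case False then show ?thesis using Suc by simp
      qed
    qed
    then have "m k i = 0" if "k \<le> i" "i \<le> n" for k i
      using that by (metis diff_diff_cancel)
    then have "row_sum m i = 0" if "i \<in> {1..n}" for i using that by (auto simp: row_sum_def)
    then have "gt_size m = 0" by (simp add: gt_size_def)
    then show False using m(2) by simp
  qed
qed

end

section \<open>The fermionic summand\<close>

text \<open>
  The quotient of the summands of \<open>raise m k r\<close> and \<open>m\<close>, collected from all factors that change.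
\<close>

definition summand_ratio :: "'a::field \<Rightarrow> (nat \<Rightarrow> nat \<Rightarrow> 'a) \<Rightarrow> nat \<Rightarrow> nat \<Rightarrow> 'a" where
  "summand_ratio q t r k =
     (\<Prod>l<k. 1 - t k r / (q * t l r)) / (\<Prod>l<k. 1 - t k r / (q * t l (Suc r)))
     * (\<Prod>l<k. 1 - t k r / t l (r - 1)) / (\<Prod>l<k. 1 - t k r / t l r)
     * (if k < r then - (1 - t k r / t k (r - 1)) else 1) / (1 - q * t k (Suc r) / t k r)
     * (\<Prod>l\<in>{k<..<r}. 1 - t l (r - 1) / t k r)
     * (\<Prod>l\<in>{k<..r}. 1 - q * t l r / t k r) / (\<Prod>l\<in>{k<..r}. 1 - t l r / t k r)
     / (\<Prod>l\<in>{k<..Suc r}. 1 - q * t l (Suc r) / t k r)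
     * (if k < r then (\<Prod>l\<in>{k<..r}. t l r) / (\<Prod>l\<in>{k<..<r}. t l (r - 1)) / t k r else 1)
     * (\<Prod>l<k. t l r) / (\<Prod>l<k. t l (Suc r))"

lemma prod_split_at:
  assumes "k \<le> (r::nat)"
  shows "prod g ({..r} - {k}) = prod g {..<k} * prod g {k<..r}"
    "prod g {..r} = prod g {..<k} * g k * prod g {k<..r}"
    "prod g {..<r} = prod g {..<k} * (if k < r then g k * prod g {k<..<r} else 1)"
proof -
  have e: "{..r} - {k} = {..<k} \<union> {k<..r}" using assms by auto
  show 1: "prod g ({..r} - {k}) = prod g {..<k} * prod g {k<..r}"
    unfolding e by (rule prod.union_disjoint) auto
  have "prod g {..r} = g k * prod g ({..r} - {k})" using assms by (intro prod.remove) auto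
  then show "prod g {..r} = prod g {..<k} * g k * prod g {k<..r}" unfolding 1 by (simp only: mult_ac)
  show "prod g {..<r} = prod g {..<k} * (if k < r then g k * prod g {k<..<r} else 1)"
  proof (cases "k < r")
    case True
    then have "{..<r} = {..<k} \<union> insert k {k<..<r}" by auto
    moreover have "prod g ({..<k} \<union> insert k {k<..<r}) = prod g {..<k} * prod g (insert k {k<..<r})"
      by (rule prod.union_disjoint) auto
    ultimately show ?thesis using True by simp
  next
    case False then show ?thesis using assms by simp
  qed
qed

text \<open>The rational identity behind the recursion for the summand. Products are split at l = k
  because the summand only contains ordered pairs of columns, so columns to the left and to the
  right of k enter differently.\<close>

lemma summand_ratio_f_coeff:
  fixes t :: "nat \<Rightarrow> nat \<Rightarrow> 'a::field"
  assumes k: "k \<le> r" and q: "q \<noteq> 0" and nz: "\<And>l i. l \<le> Suc r \<Longrightarrow> t l i \<noteq> 0"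
    and d1: "\<And>l. l \<le> r \<Longrightarrow> l \<noteq> k \<Longrightarrow> t k r \<noteq> t l r"
    and d2: "\<And>l. l \<le> r \<Longrightarrow> l \<noteq> k \<Longrightarrow> t k r \<noteq> q * t l r"
    and d3: "\<And>l. l \<le> Suc r \<Longrightarrow> t k r \<noteq> q * t l (Suc r)"
  shows "summand_ratio q t r k * f_coeff (upd2 t k r (t k r / q)) r k = e_coeff_dual t r k"
proof -
  define a where "a = t k r"
  define PA where "PA = (\<Prod>l<k. 1 - a / (q * t l r))"
  define PU where "PU = (\<Prod>l<k. 1 - a / (q * t l (Suc r)))"
  define PS where "PS = (\<Prod>l<k. 1 - a / t l (r - 1))"
  define PB where "PB = (\<Prod>l<k. 1 - a / t l r)"
  define A where "A = (\<Prod>l<k. t l r)"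
  define U where "U = (\<Prod>l<k. t l (Suc r))"
  define S where "S = (\<Prod>l<k. t l (r - 1))"
  define HA where "HA = (\<Prod>l\<in>{k<..r}. 1 - q * t l r / a)"
  define HB where "HB = (\<Prod>l\<in>{k<..r}. 1 - t l r / a)"
  define HS where "HS = (\<Prod>l\<in>{k<..<r}. 1 - t l (r - 1) / a)"
  define HU where "HU = (\<Prod>l\<in>{k<..Suc r}. 1 - q * t l (Suc r) / a)"
  define AH where "AH = (\<Prod>l\<in>{k<..r}. t l r)"
  define SH where "SH = (\<Prod>l\<in>{k<..<r}. t l (r - 1))"
  define N where "N = r - k"
  define e where "e = (-1 :: 'a) ^ k"
  have ee: "e * e = 1" "e \<noteq> 0" unfolding e_def by (simp_all flip: power_mult_distrib)
  have anz: "a \<noteq> 0" using nz k by (simp add: a_def)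
  \<comment> \<open>In the summand the node with the larger column index is on top of each fraction.
    Differences are normalized accordingly: as 1 - c/g for l < k, which leaves a sign (-1)^k, and as
    1 - g/c for l > k. The signs cancel in the end.\<close>
  have neg: "(\<Prod>l<k. c - g l) = e * (\<Prod>l<k. g l) * (\<Prod>l<k. 1 - c / g l)"
    if "\<And>l. l < k \<Longrightarrow> g l \<noteq> 0" for c :: 'a and g
  proof -
    have "(\<Prod>l<k. c - g l) = (\<Prod>l<k. (-1) * (g l * (1 - c / g l)))"
      using that by (intro prod.cong) (auto simp: field_simps)
    also have "\<dots> = e * (\<Prod>l<k. g l) * (\<Prod>l<k. 1 - c / g l)"
      by (simp only: prod.distrib prod_constant card_lessThan e_def mult.assoc)
    finally show ?thesis .
  qed
  have pos: "(\<Prod>l\<in>I. c - g l) = c ^ card I * (\<Prod>l\<in>I. 1 - g l / c)" if "c \<noteq> 0" for c :: 'a and g and I :: "nat set"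
  proof -
    have "(\<Prod>l\<in>I. c - g l) = (\<Prod>l\<in>I. c * (1 - g l / c))"
      using that by (intro prod.cong) (auto simp: field_simps)
    then show ?thesis by (simp add: prod.distrib)
  qed
  have qa: "a / q \<noteq> 0" using anz q by simp
  have sh: "a / q / x = a / (q * x)" "x / (a / q) = q * x / a" for x by simp_all
  let ?t = "upd2 t k r (a / q)"
  have t': "?t k r = a / q" "?t l (Suc r) = t l (Suc r)" "l \<noteq> k \<Longrightarrow> ?t l r = t l r" "0 < r \<Longrightarrow> ?t l (r - 1) = t l (r - 1)" for l
    by (auto simp: upd2_def)
  have den: "(\<Prod>l\<in>{..r}-{k}. a - t l r) = e * A * PB * (a ^ N * HB)"
    unfolding prod_split_at(1)[OF k] A_def PB_def HB_def N_def card_greaterThanAtMost[symmetric]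
    by (subst neg, use nz k in simp, subst pos, rule anz, rule refl)
  have num: "(\<Prod>l<r. a - t l (r - 1)) = e * S * PS * (if k < r then (a - t k (r - 1)) * (a ^ (N - 1) * HS) else 1)"
  proof -
    have c: "N - 1 = card {k<..<r}" by (simp add: N_def)
    show ?thesis
      unfolding prod_split_at(3)[OF k] S_def PS_def HS_def c
      by (subst neg, use nz k in simp, subst pos, rule anz, rule refl)
  qed
  have fnum: "(\<Prod>l\<le>Suc r. a / q - t l (Suc r)) = e * U * PU * (a / q - t k (Suc r)) * ((a / q) ^ Suc N * HU)"
  proof -
    have k': "k \<le> Suc r" using k by simp
    have c: "card {k<..Suc r} = Suc N" using k by (simp add: N_def)
    show ?thesis
      unfolding prod_split_at(2)[OF k'] U_def PU_def HU_def c[symmetric]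
      by (subst neg, use nz k in simp, subst pos, rule qa, simp only: sh)
  qed
  have fden: "(\<Prod>l\<in>{..r}-{k}. (?t k r - ?t l r) * ?t l r) = e * A * PA * ((a / q) ^ N * HA) * (A * AH)"
  proof -
    have "(\<Prod>l\<in>{..r}-{k}. (?t k r - ?t l r) * ?t l r) = (\<Prod>l\<in>{..r}-{k}. (a / q - t l r) * t l r)"
      by (intro prod.cong) (auto simp: upd2_def)
    also have "\<dots> = (\<Prod>l\<in>{..r}-{k}. a / q - t l r) * (\<Prod>l\<in>{..r}-{k}. t l r)" by (rule prod.distrib)
    also have "(\<Prod>l\<in>{..r}-{k}. a / q - t l r) = e * A * PA * ((a / q) ^ N * HA)"
      unfolding prod_split_at(1)[OF k] A_def PA_def HA_def N_def card_greaterThanAtMost[symmetric]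
      by (subst neg, use nz k in simp, subst pos, rule qa, simp only: sh)
    also have "(\<Prod>l\<in>{..r}-{k}. t l r) = A * AH" by (simp only: prod_split_at(1)[OF k] A_def AH_def)
    finally show ?thesis .
  qed
  have fs: "(\<Prod>l<r. ?t l (r - 1)) = S * (if k < r then t k (r - 1) * SH else 1)"
  proof -
    have "(\<Prod>l<r. ?t l (r - 1)) = (\<Prod>l<r. t l (r - 1))" by (intro prod.cong) (auto simp: upd2_def)
    then show ?thesis by (simp only: prod_split_at(3)[OF k] S_def SH_def)
  qed
  have F: "f_coeff ?t r k = e * U * PU * (a / q - t k (Suc r)) * ((a / q) ^ Suc N * HU) * (S * (if k < r then t k (r - 1) * SH else 1)) /
     ((a / q)\<^sup>2 * (e * A * PA * ((a / q) ^ N * HA) * (A * AH)))"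
  proof -
    have "(\<Prod>l\<le>Suc r. ?t k r - ?t l (Suc r)) = (\<Prod>l\<le>Suc r. a / q - t l (Suc r))"
      by (simp only: t'(1,2))
    then show ?thesis unfolding f_coeff_def fden fs fnum by (simp only: t'(1))
  qed
  have D: "e_coeff_dual t r k = e * S * PS * (if k < r then (a - t k (r - 1)) * (a ^ (N - 1) * HS) else 1) / (e * A * PB * (a ^ N * HB))"
    unfolding e_coeff_dual_def a_def[symmetric] den num ..
  have R: "summand_ratio q t r k = PA / PU * PS / PB * (if k < r then - (1 - a / t k (r - 1)) else 1) / (1 - q * t k (Suc r) / a)
     * HS * HA / HB / HU * (if k < r then AH / SH / a else 1) * A / U"
    unfolding summand_ratio_def a_def PA_def PU_def PS_def PB_def HS_def HA_def HB_def HU_def AH_def SH_def A_def U_def ..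
  have nzs: "PA \<noteq> 0" "PU \<noteq> 0" "PB \<noteq> 0" "HA \<noteq> 0" "HB \<noteq> 0" "HU \<noteq> 0" "A \<noteq> 0" "U \<noteq> 0" "S \<noteq> 0" "AH \<noteq> 0" "SH \<noteq> 0"
    using k q anz nz d1 d2 d3 d1[symmetric] d2[symmetric] d3[symmetric]
    by (auto simp: PA_def PU_def PB_def HA_def HB_def HU_def A_def U_def S_def AH_def SH_def a_def)
  have uk: "a / q - t k (Suc r) = (a / q) * (1 - q * t k (Suc r) / a)" using q anz by (simp add: field_simps)
  have w: "1 - q * t k (Suc r) / a \<noteq> 0" using d3[of k] k anz by (simp add: a_def)
  show ?thesis
  proof (cases "k < r")
    case True
    then obtain N' where N': "N = Suc N'" unfolding N_def by (metis Suc_diff_Suc)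
    define s where "s = t k (r - 1)"
    have s0: "s \<noteq> 0" using nz k by (simp add: s_def)
    have "PA / PU * PS / PB * (- (1 - a / s)) / W * HS * HA / HB / HU * (AH / SH / a) * A / U *
       (e * U * PU * (b * W) * (b ^ Suc (Suc N') * HU) * (S * (s * SH)) / (b\<^sup>2 * (e * A * PA * (b ^ Suc N' * HA) * (A * AH))))
       = e * S * PS * ((a - s) * (a ^ N' * HS)) / (e * A * PB * (a ^ Suc N' * HB))"
      if "W \<noteq> 0" "b \<noteq> 0" for W b
      using nzs ee(2) anz s0 that by (simp add: divide_simps power2_eq_square) (simp add: algebra_simps)
    from this[OF w qa] show ?thesis
      using True unfolding F D R uk N' a_def[symmetric] by (simp only: if_True s_def diff_Suc_1)
  next
    case False
    then have N0: "N = 0" "HS = 1" "SH = 1" "AH = 1" "HA = 1" "HB = 1"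
      using k by (auto simp: N_def HS_def SH_def AH_def HA_def HB_def)
    have "PA / PU * PS / PB * 1 / W * 1 * 1 / 1 / HU * 1 * A / U *
       (e * U * PU * (b * W) * (b ^ Suc 0 * HU) * (S * 1) / (b\<^sup>2 * (e * A * PA * (b ^ 0 * 1) * (A * 1))))
       = e * S * PS * 1 / (e * A * PB * (a ^ 0 * 1))"
      if "W \<noteq> 0" "b \<noteq> 0" for W b
      using nzs ee(2) anz that by (simp add: divide_simps power2_eq_square)
    from this[OF w qa] show ?thesis
      using False unfolding F D R uk N0 a_def[symmetric] by (simp only: if_False)
  qed
qed

text \<open>Proved for an arbitrary commutative monoid to serve both the sums in
  \<open>p_exp\<close> and the products in the summand: raising one entry affects only slices of the
  set of index triples.\<close>

lemma (in comm_monoid_set) slice_first: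
  assumes "finite I"
  shows "F (\<lambda>(k, l, i). if k = c \<and> i = r then h l else \<^bold>1) I = F h {l. (c, l, r) \<in> I}"
proof -
  have "F h {l. (c, l, r) \<in> I} = F (\<lambda>(k, l, i). if k = c \<and> i = r then h l else \<^bold>1) ((\<lambda>l. (c, l, r)) ` {l. (c, l, r) \<in> I})"
    by (subst reindex) (auto simp: inj_on_def)
  also have "\<dots> = F (\<lambda>(k, l, i). if k = c \<and> i = r then h l else \<^bold>1) I"
    using assms by (intro mono_neutral_left) auto
  finally show ?thesis ..
qed

lemma (in comm_monoid_set) slice_second:
  assumes "finite I"
  shows "F (\<lambda>(k, l, i). if l = c \<and> i = r then h k else \<^bold>1) I = F h {k. (k, c, r) \<in> I}"
proof -
  have "F h {k. (k, c, r) \<in> I} = F (\<lambda>(k, l, i). if l = c \<and> i = r then h k else \<^bold>1) ((\<lambda>k. (k, c, r)) ` {k. (k, c, r) \<in> I})"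
    by (subst reindex) (auto simp: inj_on_def)
  also have "\<dots> = F (\<lambda>(k, l, i). if l = c \<and> i = r then h k else \<^bold>1) I"
    using assms by (intro mono_neutral_left) auto
  finally show ?thesis ..
qed

lemma (in comm_monoid_set) slice_pair:
  assumes "finite I"
  shows "F (\<lambda>(k, i). if k = c \<and> i = r then h else \<^bold>1) I = (if (c, r) \<in> I then h else \<^bold>1)"
proof -
  have "F (\<lambda>(k, i). if k = c \<and> i = r then h else \<^bold>1) I = F (\<lambda>p. if p = (c, r) then h else \<^bold>1) I"
    by (simp add: case_prod_unfold prod_eq_iff)
  then show ?thesis using assms by (simp add: delta)
qed

lemma inverse_exchange:
  fixes x y :: "'a::field"
  assumes "P * y = x * Q" "x \<noteq> 0" "y \<noteq> 0" shows "1 / P = 1 / Q * (y / x)"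
proof -
  have "1 / P = y / (P * y)" using assms(3) by simp
  then show ?thesis unfolding assms(1) by simp
qed

lemma finite_triangle:
  "finite {(k, i). k < i \<and> i \<le> (n::nat)}"
  "finite {(k, l, i). k < l \<and> l < i \<and> i \<le> (n::nat)}"
  "finite {(k, l, i). k < l \<and> l \<le> i \<and> i \<le> (n::nat)}"
  by (rule finite_subset[of _ "{..n} \<times> {..n}"], force, simp,
      (rule finite_subset[of _ "{..n} \<times> {..n} \<times> {..n}"], force, simp)+)

lemma p_exp_raise:
  assumes m: "gt_array n m" and k: "c \<le> r" and r: "r < n"
  shows "p_exp n (raise m c r) = p_exp n m
    - (\<Sum>l\<in>{c<..r}. int (m l r)) - (\<Sum>l<c. int (m l r)) + (\<Sum>l\<in>{c<..<r}. int (m l (r - 1)))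
    + (\<Sum>l<c. int (m l (Suc r))) + (if c < r then int (m c r) else 0)"
proof -
  let ?M = "raise m c r"
  let ?I1 = "{(k, l, i). k < l \<and> l \<le> i \<and> i \<le> n - 1}"
  let ?I2 = "{(k, l, i). k < l \<and> l < i \<and> i \<le> n - 1}"
  let ?I3 = "{(k, i). k < i \<and> i \<le> n - 1}"
  note fin = finite_triangle[of "n - 1"]
  have M: "?M a b = (if a = c \<and> b = r then m c r + 1 else m a b)" for a b
    by (auto simp: raise_def upd2_def)
  have 1: "(\<Sum>(k, l, i)\<in>?I1. int (?M k i) * int (?M l i)) = (\<Sum>(k, l, i)\<in>?I1. int (m k i) * int (m l i))
     + (\<Sum>l\<in>{c<..r}. int (m l r)) + (\<Sum>l<c. int (m l r))"
  proof -
    have "(\<Sum>(k, l, i)\<in>?I1. int (?M k i) * int (?M l i)) = (\<Sum>x\<in>?I1. (case x of (k, l, i) \<Rightarrow> int (m k i) * int (m l i))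
      + (case x of (k, l, i) \<Rightarrow> if k = c \<and> i = r then int (m l r) else 0) + (case x of (k, l, i) \<Rightarrow> if l = c \<and> i = r then int (m k r) else 0))"
      by (intro sum.cong) (auto simp: M algebra_simps)
    also have "\<dots> = (\<Sum>(k, l, i)\<in>?I1. int (m k i) * int (m l i))
       + (\<Sum>l\<in>{l. (c, l, r) \<in> ?I1}. int (m l r)) + (\<Sum>l\<in>{l. (l, c, r) \<in> ?I1}. int (m l r))"
      by (simp only: sum.distrib sum.slice_first[OF fin(3)] sum.slice_second[OF fin(3)])
    also have "{l. (c, l, r) \<in> ?I1} = {c<..r}" using r by auto
    also have "{l. (l, c, r) \<in> ?I1} = {..<c}" using r k by auto
    finally show ?thesis .
  qed
  have 2: "(\<Sum>(k, l, i)\<in>?I2. int (?M k i) * int (?M l (i - 1))) = (\<Sum>(k, l, i)\<in>?I2. int (m k i) * int (m l (i - 1)))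
     + (\<Sum>l\<in>{c<..<r}. int (m l (r - 1))) + (\<Sum>l<c. int (m l (Suc r)))"
  proof -
    have "(\<Sum>(k, l, i)\<in>?I2. int (?M k i) * int (?M l (i - 1))) = (\<Sum>x\<in>?I2. (case x of (k, l, i) \<Rightarrow> int (m k i) * int (m l (i - 1)))
      + (case x of (k, l, i) \<Rightarrow> if k = c \<and> i = r then int (m l (r - 1)) else 0) + (case x of (k, l, i) \<Rightarrow> if l = c \<and> i = Suc r then int (m k (Suc r)) else 0))"
      by (intro sum.cong) (auto simp: M algebra_simps)
    also have "\<dots> = (\<Sum>(k, l, i)\<in>?I2. int (m k i) * int (m l (i - 1)))
       + (\<Sum>l\<in>{l. (c, l, r) \<in> ?I2}. int (m l (r - 1))) + (\<Sum>l\<in>{l. (l, c, Suc r) \<in> ?I2}. int (m l (Suc r)))"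
      by (simp only: sum.distrib sum.slice_first[OF fin(2)] sum.slice_second[OF fin(2)])
    also have "{l. (c, l, r) \<in> ?I2} = {c<..<r}" using r by auto
    also have "(\<Sum>l\<in>{l. (l, c, Suc r) \<in> ?I2}. int (m l (Suc r))) = (\<Sum>l<c. int (m l (Suc r)))"
    proof (cases "Suc r = n")
      \<comment> \<open>The index set stops at i = n - 1, so this slice is empty, while the claimed
        sum runs over row n, where every entry is 0.\<close>
      case True
      then have "m l (Suc r) = 0" for l using m unfolding gt_array_def by (cases "l \<le> n") auto
      then show ?thesis by simp
    next
      case False
      then have "{l. (l, c, Suc r) \<in> ?I2} = {..<c}" using r k by auto
      then show ?thesis by simp
    qed
    finally show ?thesis .
  qed
  have 3: "(\<Sum>(k, i)\<in>?I3. int (?M k i) * (int (?M k i) - 1)) = (\<Sum>(k, i)\<in>?I3. int (m k i) * (int (m k i) - 1))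
     + 2 * (if c < r then int (m c r) else 0)"
  proof -
    have "(\<Sum>(k, i)\<in>?I3. int (?M k i) * (int (?M k i) - 1)) = (\<Sum>x\<in>?I3. (case x of (k, i) \<Rightarrow> int (m k i) * (int (m k i) - 1))
      + (case x of (k, i) \<Rightarrow> if k = c \<and> i = r then 2 * int (m c r) else 0))"
      by (intro sum.cong) (auto simp: M algebra_simps)
    also have "\<dots> = (\<Sum>(k, i)\<in>?I3. int (m k i) * (int (m k i) - 1)) + (if (c, r) \<in> ?I3 then 2 * int (m c r) else 0)"
      by (simp only: sum.distrib sum.slice_pair[OF fin(1)])
    finally show ?thesis using r by auto
  qed
  \<comment> \<open>The third sum grows by an even number, so its half grows by exactly m_{c,r} for
    c < r.\<close>
  have "(x + 2 * y) div 2 = x div 2 + y" for x y :: int by simp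
  then show ?thesis unfolding p_exp_def 1 2 3 by simp
qed

section \<open>Change of the fermionic summand when one entry is raised\<close>

context gt_model
begin

text \<open>
  Integer bounds make the dependence of $(q^c x)_l$ on each $m_{k,i}$ a shift of one of the bounds.
\<close>

definition qprod :: "'a \<Rightarrow> int \<Rightarrow> int \<Rightarrow> 'a" where
  "qprod x a b = (\<Prod>e\<in>{a..<b}. 1 - q powi e * x)"

lemma qpoch_qprod: "qpoch q (q powi c * x) l = qprod x c (c + int l)"
proof (induction l)
  case (Suc l)
  have "{c..<c + int (Suc l)} = insert (c + int l) {c..<c + int l}" by auto
  then have "qprod x c (c + int (Suc l)) = (1 - q powi (c + int l) * x) * qprod x c (c + int l)"
    unfolding qprod_def by simp
  moreover have "qpoch q y (Suc l) = (1 - q ^ l * y) * qpoch q y l" for y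
    by (simp add: qpoch_def mult.commute)
  ultimately show ?case using Suc q0 by (simp add: power_int_add mult_ac)
qed (simp add: qpoch_def qprod_def)

lemma qprod_end: "a \<le> b \<Longrightarrow> qprod x a (b + 1) = qprod x a b * (1 - q powi b * x)"
proof -
  assume "a \<le> b"
  then have "{a..<b + 1} = insert b {a..<b}" by auto
  then show ?thesis unfolding qprod_def by (simp add: mult.commute)
qed

lemma qprod_start: "a < b \<Longrightarrow> qprod x a b = (1 - q powi a * x) * qprod x (a + 1) b"
proof -
  assume "a < b"
  then have "{a..<b} = insert a {a + 1..<b}" by auto
  then show ?thesis unfolding qprod_def by simp
qed

text \<open>Moving both bounds down by one gains a factor at the lower end and loses one at the
  upper end.\<close>

lemma qprod_shift:
  "a \<le> b \<Longrightarrow> qprod x (a - 1) (b - 1) * (1 - q powi (b - 1) * x) = (1 - q powi (a - 1) * x) * qprod x a b"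
  using qprod_end[of "a - 1" "b - 1" x] qprod_start[of "a - 1" b x] by simp

text \<open>The lower bound 1 encodes (q)_m as the product of 1 - q^e over 1 \<le> e \<le> m, so
  that all three families of factors are instances of \<open>qprod\<close>.\<close>

definition factor_A :: "(nat \<Rightarrow> nat \<Rightarrow> nat) \<Rightarrow> nat \<Rightarrow> nat \<Rightarrow> 'a" where
  "factor_A m k i = 1 / qprod 1 1 (1 + (int (m k (i - 1)) - int (m k i)))"

definition factor_B :: "(nat \<Rightarrow> nat \<Rightarrow> nat) \<Rightarrow> nat \<Rightarrow> nat \<Rightarrow> nat \<Rightarrow> 'a" where
  "factor_B m k l i = 1 / qprod (zprod z k l) (int (m k i) - int (m l (i - 1))) (int (m k (i - 1)) - int (m l (i - 1)))"

definition factor_C :: "(nat \<Rightarrow> nat \<Rightarrow> nat) \<Rightarrow> nat \<Rightarrow> nat \<Rightarrow> nat \<Rightarrow> 'a" where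
  "factor_C m k l i = 1 / qprod (zprod z k l) (int (m k i) - int (m l i) + 1) (int (m k (i - 1)) - int (m l i) + 1)"

lemma gt_array_le: "gt_array n m \<Longrightarrow> k < i \<Longrightarrow> i \<le> n \<Longrightarrow> m k i \<le> m k (i - 1)"
  using gt_array_antimono[of n m k "i - 1"] by auto

lemma factor_A_eq: "gt_array n m \<Longrightarrow> k < i \<Longrightarrow> i \<le> n \<Longrightarrow> 1 / qpoch q q (m k (i - 1) - m k i) = factor_A m k i"
  using qpoch_qprod[of 1 1] gt_array_le[of m k i] by (simp add: factor_A_def of_nat_diff)

lemma factor_B_eq: "gt_array n m \<Longrightarrow> k < i \<Longrightarrow> i \<le> n \<Longrightarrow>
    1 / qpoch q (q powi (int (m k i) - int (m l (i - 1))) * zprod z k l) (m k (i - 1) - m k i) = factor_B m k l i"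
  using gt_array_le[of m k i] by (simp add: factor_B_def of_nat_diff qpoch_qprod)

lemma factor_C_eq: "gt_array n m \<Longrightarrow> k < i \<Longrightarrow> i \<le> n \<Longrightarrow>
    1 / qpoch q (q powi (int (m k i) - int (m l i) + 1) * zprod z k l) (m k (i - 1) - m k i) = factor_C m k l i"
proof -
  assume "gt_array n m" "k < i" "i \<le> n"
  then have "int (m k i) - int (m l i) + 1 + int (m k (i - 1) - m k i) = int (m k (i - 1)) - int (m l i) + 1"
    using gt_array_le[of m k i] by (simp add: of_nat_diff)
  then show ?thesis by (simp only: factor_C_def qpoch_qprod)
qed

text \<open>Dictionary between Pochhammer factors, written with powers of q and z_{k,l}, and the
  node ratios of \<open>summand_ratio\<close>.\<close>

lemma one_minus_node:
  assumes "k \<le> l" "l \<le> n"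
  shows "1 - node q z m l j / node q z m k i = 1 - q powi (int (m k i) - int (m l j)) * zprod z k l"
    "1 - q * node q z m l j / node q z m k i = 1 - q powi (int (m k i) - int (m l j) + 1) * zprod z k l"
    "1 - node q z m l j / (q * node q z m k i) = 1 - q powi (int (m k i) - int (m l j) - 1) * zprod z k l"
proof -
  note e = node_ratio[OF assms, where m = m and i = i and j = j]
  show "1 - node q z m l j / node q z m k i = 1 - q powi (int (m k i) - int (m l j)) * zprod z k l"
    by (simp only: e)
  have "q * node q z m l j / node q z m k i = q * (node q z m l j / node q z m k i)" by simp
  also have "\<dots> = q powi (int (m k i) - int (m l j) + 1) * zprod z k l"
    unfolding e using q0 power_int_add_1[of q "int (m k i) - int (m l j)"] by (simp add: mult_ac)
  finally show "1 - q * node q z m l j / node q z m k i = 1 - q powi (int (m k i) - int (m l j) + 1) * zprod z k l"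
    by simp
  have "node q z m l j / (q * node q z m k i) = (node q z m l j / node q z m k i) / q" by simp
  also have "\<dots> = q powi (int (m k i) - int (m l j) - 1) * zprod z k l"
    unfolding e using q0 power_int_diff[of q "int (m k i) - int (m l j)" 1] by (simp add: mult_ac)
  finally show "1 - node q z m l j / (q * node q z m k i) = 1 - q powi (int (m k i) - int (m l j) - 1) * zprod z k l"
    by simp
qed

lemma generic_nz: "k < l \<Longrightarrow> l \<le> n \<Longrightarrow> 1 - q powi c * zprod z k l \<noteq> 0"
  using z_generic[of k l c] by auto

text \<open>The entry m_{c,r} lengthens the product at i = r + 1 and shortens the one at i = r. In
  the second case validity of the raised array ensures that there is a factor to remove.\<close>

lemma factor_A_raise:
  assumes m: "gt_array n m" and M: "gt_array n (raise m c r)" and c: "c \<le> r" and r: "r < n"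
    and i: "k < i" "i \<le> n"
  shows "factor_A (raise m c r) k i = factor_A m k i
    * (if k = c \<and> i = Suc r then 1 / (1 - q * node q z m c (Suc r) / node q z m c r) else 1)
    * (if k = c \<and> i = r then 1 - node q z m c r / node q z m c (r - 1) else 1)"
proof -
  have R: "raise m c r a b = (if a = c \<and> b = r then m c r + 1 else m a b)" for a b
    by (auto simp: raise_def upd2_def)
  note le = gt_array_le[OF m i]
  have cn: "c \<le> n" using c r by simp
  consider "k = c" "i = Suc r" | "k = c" "i = r" | "\<not> (k = c \<and> i = Suc r)" "\<not> (k = c \<and> i = r)" by blast
  then show ?thesis
  proof cases
    case 1
    have "qprod 1 1 (1 + (int (m c r) - int (m c (Suc r))) + 1)
      = qprod 1 1 (1 + (int (m c r) - int (m c (Suc r)))) * (1 - q powi (1 + (int (m c r) - int (m c (Suc r)))) * 1)"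
      by (rule qprod_end) (use le 1 in simp)
    then show ?thesis unfolding one_minus_node[OF order_refl cn] using 1
      by (simp add: factor_A_def R algebra_simps zprod_def)
  next
    case 2
    have lt: "m c r < m c (r - 1)" using gt_array_le[OF M i] 2 i by (simp add: R split: if_splits)
    have "qprod 1 1 ((int (m c (r - 1)) - int (m c r)) + 1)
      = qprod 1 1 (int (m c (r - 1)) - int (m c r)) * (1 - q powi (int (m c (r - 1)) - int (m c r)) * 1)"
      by (rule qprod_end) (use lt in simp)
    moreover have "1 - q powi (int (m c (r - 1)) - int (m c r)) * 1 \<noteq> 0"
      using q_not_root[of "int (m c (r - 1)) - int (m c r)"] lt by auto
    moreover have "factor_A (raise m c r) k i = 1 / qprod 1 1 (int (m c (r - 1)) - int (m c r))"
      "factor_A m k i = 1 / qprod 1 1 (int (m c (r - 1)) - int (m c r) + 1)"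
      using 2 i by (auto simp: factor_A_def R algebra_simps)
    ultimately have "factor_A (raise m c r) k i = factor_A m k i * (1 - q powi (int (m c (r - 1)) - int (m c r)) * 1)"
      by simp
    moreover have "zprod z c c = 1" by (simp add: zprod_def)
    ultimately show ?thesis using 2 i one_minus_node(1)[OF order_refl cn, of m r "r - 1"] by simp
  next
    case 3
    then show ?thesis using i by (auto simp: factor_A_def R)
  qed
qed

text \<open>The entry m_{c,r} occurs in three roles: as m_{k,i-1} it moves the upper bound, as
  m_{k,i} the lower bound, and as m_{l,i-1} both bounds, which exchanges one factor for
  another.\<close>

lemma factor_B_raise:
  assumes m: "gt_array n m" and M: "gt_array n (raise m c r)" and c: "c \<le> r" and r: "r < n"
    and i: "k < l" "l < i" "i \<le> n"
  shows "factor_B (raise m c r) k l i = factor_B m k l i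
    * (if k = c \<and> i = Suc r then 1 / (1 - node q z m l r / node q z m c r) else 1)
    * (if k = c \<and> i = r then 1 - node q z m l (r - 1) / node q z m c r else 1)
    * (if l = c \<and> i = Suc r then (1 - node q z m c r / (q * node q z m k r)) / (1 - node q z m c r / (q * node q z m k (Suc r))) else 1)"
proof -
  have R: "raise m c r a b = (if a = c \<and> b = r then m c r + 1 else m a b)" for a b
    by (auto simp: raise_def upd2_def)
  have ki: "k < i" and kl: "k \<le> l" and ln: "l \<le> n" using i by auto
  note le = gt_array_le[OF m ki i(3)] and le' = gt_array_le[OF M ki i(3)]
  note nz = generic_nz[OF i(1) ln]
  consider "k = c" "i = Suc r" | "k = c" "i = r" | "l = c" "i = Suc r"
    | "\<not> (k = c \<and> i = Suc r)" "\<not> (k = c \<and> i = r)" "\<not> (l = c \<and> i = Suc r)" by blast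
  then show ?thesis
  proof cases
    case 1
    let ?a = "int (m c (Suc r)) - int (m l r)" and ?b = "int (m c r) - int (m l r)"
    have "qprod (zprod z c l) ?a (?b + 1) = qprod (zprod z c l) ?a ?b * (1 - q powi ?b * zprod z c l)"
      by (rule qprod_end) (use le 1 in simp)
    moreover have "factor_B (raise m c r) k l i = 1 / qprod (zprod z c l) ?a (?b + 1)" "factor_B m k l i = 1 / qprod (zprod z c l) ?a ?b"
      using 1 i by (auto simp: factor_B_def R algebra_simps)
    ultimately have "factor_B (raise m c r) k l i = factor_B m k l i * (1 / (1 - q powi ?b * zprod z c l))"
      by simp
    then show ?thesis using 1 i one_minus_node(1)[OF kl ln, of m r r] by simp
  next
    case 2
    let ?a = "int (m c r) - int (m l (r - 1))" and ?b = "int (m c (r - 1)) - int (m l (r - 1))"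
    have r1: "r - 1 \<noteq> r" using 2 i by simp
    have "qprod (zprod z c l) ?a ?b = (1 - q powi ?a * zprod z c l) * qprod (zprod z c l) (?a + 1) ?b"
      by (rule qprod_start) (use le' 2 r1 in \<open>simp add: R\<close>)
    moreover have "factor_B (raise m c r) k l i = 1 / qprod (zprod z c l) (?a + 1) ?b" "factor_B m k l i = 1 / qprod (zprod z c l) ?a ?b"
      using 2 i r1 by (auto simp: factor_B_def R algebra_simps)
    moreover have "1 - q powi ?a * zprod z c l \<noteq> 0" using nz[of ?a] 2 by simp
    ultimately have "factor_B (raise m c r) k l i = factor_B m k l i * (1 - q powi ?a * zprod z c l)"
      by simp
    then show ?thesis using 2 i r1 one_minus_node(1)[OF kl ln, of m "r - 1" r] by simp
  next
    case 3
    let ?a = "int (m k (Suc r)) - int (m c r)" and ?b = "int (m k r) - int (m c r)"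
    have "qprod (zprod z k c) (?a - 1) (?b - 1) * (1 - q powi (?b - 1) * zprod z k c)
      = (1 - q powi (?a - 1) * zprod z k c) * qprod (zprod z k c) ?a ?b"
      by (rule qprod_shift) (use le 3 in simp)
    moreover have "factor_B (raise m c r) k l i = 1 / qprod (zprod z k c) (?a - 1) (?b - 1)" "factor_B m k l i = 1 / qprod (zprod z k c) ?a ?b"
      using 3 i by (auto simp: factor_B_def R algebra_simps)
    ultimately have "factor_B (raise m c r) k l i = factor_B m k l i * ((1 - q powi (?b - 1) * zprod z k c) / (1 - q powi (?a - 1) * zprod z k c))"
      using nz[of "?a - 1"] nz[of "?b - 1"] 3 by (simp only: inverse_exchange not_False_eq_True)
    then show ?thesis using 3 i one_minus_node(3)[OF kl ln, of m r] by simp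
  next
    case 4
    then have "raise m c r k i = m k i" "raise m c r l (i - 1) = m l (i - 1)" "raise m c r k (i - 1) = m k (i - 1)"
      using i by (auto simp: R)
    then show ?thesis using 4 by (simp only: factor_B_def if_False mult_1_right)
  qed
qed

text \<open>As for \<open>factor_B\<close>, except that the third role is that of m_{l,i}, hence at
  i = r instead of i = r + 1.\<close>

lemma factor_C_raise:
  assumes m: "gt_array n m" and M: "gt_array n (raise m c r)" and c: "c \<le> r" and r: "r < n"
    and i: "k < l" "l \<le> i" "i \<le> n"
  shows "factor_C (raise m c r) k l i = factor_C m k l i
    * (if k = c \<and> i = Suc r then 1 / (1 - q * node q z m l (Suc r) / node q z m c r) else 1)
    * (if k = c \<and> i = r then 1 - q * node q z m l r / node q z m c r else 1)
    * (if l = c \<and> i = r then (1 - node q z m c r / node q z m k (r - 1)) / (1 - node q z m c r / node q z m k r) else 1)"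
proof -
  have R: "raise m c r a b = (if a = c \<and> b = r then m c r + 1 else m a b)" for a b
    by (auto simp: raise_def upd2_def)
  have ki: "k < i" and kl: "k \<le> l" and ln: "l \<le> n" using i by auto
  note le = gt_array_le[OF m ki i(3)] and le' = gt_array_le[OF M ki i(3)]
  note nz = generic_nz[OF i(1) ln]
  consider "k = c" "i = Suc r" | "k = c" "i = r" | "l = c" "i = r"
    | "\<not> (k = c \<and> i = Suc r)" "\<not> (k = c \<and> i = r)" "\<not> (l = c \<and> i = r)" by blast
  then show ?thesis
  proof cases
    case 1
    let ?a = "int (m c (Suc r)) - int (m l (Suc r)) + 1" and ?b = "int (m c r) - int (m l (Suc r)) + 1"
    have "qprod (zprod z c l) ?a (?b + 1) = qprod (zprod z c l) ?a ?b * (1 - q powi ?b * zprod z c l)"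
      by (rule qprod_end) (use le 1 in simp)
    moreover have "factor_C (raise m c r) k l i = 1 / qprod (zprod z c l) ?a (?b + 1)" "factor_C m k l i = 1 / qprod (zprod z c l) ?a ?b"
      using 1 i by (auto simp: factor_C_def R algebra_simps)
    ultimately have "factor_C (raise m c r) k l i = factor_C m k l i * (1 / (1 - q powi ?b * zprod z c l))"
      by simp
    then show ?thesis using 1 i one_minus_node(2)[OF kl ln, of m "Suc r" r] by simp
  next
    case 2
    let ?a = "int (m c r) - int (m l r) + 1" and ?b = "int (m c (r - 1)) - int (m l r) + 1"
    have r1: "r - 1 \<noteq> r" using 2 i by simp
    have "qprod (zprod z c l) ?a ?b = (1 - q powi ?a * zprod z c l) * qprod (zprod z c l) (?a + 1) ?b"
      by (rule qprod_start) (use le' 2 r1 in \<open>simp add: R\<close>)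
    moreover have "factor_C (raise m c r) k l i = 1 / qprod (zprod z c l) (?a + 1) ?b" "factor_C m k l i = 1 / qprod (zprod z c l) ?a ?b"
      using 2 i r1 by (auto simp: factor_C_def R algebra_simps)
    moreover have "1 - q powi ?a * zprod z c l \<noteq> 0" using nz[of ?a] 2 by simp
    ultimately have "factor_C (raise m c r) k l i = factor_C m k l i * (1 - q powi ?a * zprod z c l)"
      by simp
    then show ?thesis using 2 i r1 one_minus_node(2)[OF kl ln, of m r r] by simp
  next
    case 3
    let ?a = "int (m k r) - int (m c r) + 1" and ?b = "int (m k (r - 1)) - int (m c r) + 1"
    have "qprod (zprod z k c) (?a - 1) (?b - 1) * (1 - q powi (?b - 1) * zprod z k c)
      = (1 - q powi (?a - 1) * zprod z k c) * qprod (zprod z k c) ?a ?b"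
      by (rule qprod_shift) (use le 3 in simp)
    moreover have "factor_C (raise m c r) k l i = 1 / qprod (zprod z k c) (?a - 1) (?b - 1)" "factor_C m k l i = 1 / qprod (zprod z k c) ?a ?b"
      using 3 i by (auto simp: factor_C_def R algebra_simps)
    ultimately have "factor_C (raise m c r) k l i = factor_C m k l i * ((1 - q powi (?b - 1) * zprod z k c) / (1 - q powi (?a - 1) * zprod z k c))"
      using nz[of "?a - 1"] nz[of "?b - 1"] 3 by (simp only: inverse_exchange not_False_eq_True)
    then show ?thesis using 3 i one_minus_node(1)[OF kl ln, of m r] by simp
  next
    case 4
    then have "raise m c r k i = m k i" "raise m c r l i = m l i" "raise m c r k (i - 1) = m k (i - 1)"
      using i by (auto simp: R)
    then show ?thesis using 4 by (simp only: factor_C_def if_False mult_1_right)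
  qed
qed

definition prod_A :: "(nat \<Rightarrow> nat \<Rightarrow> nat) \<Rightarrow> 'a" where
  "prod_A m = (\<Prod>(k, i)\<in>{(k, i). k < i \<and> i \<le> n}. factor_A m k i)"

definition prod_B :: "(nat \<Rightarrow> nat \<Rightarrow> nat) \<Rightarrow> 'a" where
  "prod_B m = (\<Prod>(k, l, i)\<in>{(k, l, i). k < l \<and> l < i \<and> i \<le> n}. factor_B m k l i)"

definition prod_C :: "(nat \<Rightarrow> nat \<Rightarrow> nat) \<Rightarrow> 'a" where
  "prod_C m = (\<Prod>(k, l, i)\<in>{(k, l, i). k < l \<and> l \<le> i \<and> i \<le> n}. factor_C m k l i)"

definition sgn_part :: "(nat \<Rightarrow> nat \<Rightarrow> nat) \<Rightarrow> 'a" where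
  "sgn_part m = (- 1) powi ((\<Sum>i=1..n. int (row_sum m i)) - (\<Sum>i<n. int (m i i)))"

definition z_part :: "(nat \<Rightarrow> nat \<Rightarrow> nat) \<Rightarrow> 'a" where
  "z_part m = (\<Prod>j=1..n. z j ^ (\<Sum>k<j. \<Sum>i=j+1..n. m k (i - 1)))"

definition summand :: "(nat \<Rightarrow> nat \<Rightarrow> nat) \<Rightarrow> 'a" where
  "summand m = sgn_part m * q powi p_exp n m * z_part m * prod_A m * prod_B m * prod_C m"

context
  fixes m c r
  assumes m: "gt_array n m" and M: "gt_array n (raise m c r)" and c: "c \<le> r" and r: "r < n"
begin

lemma prod_A_raise: "prod_A (raise m c r) = prod_A m * (1 / (1 - q * node q z m c (Suc r) / node q z m c r))
    * (if c < r then 1 - node q z m c r / node q z m c (r - 1) else 1)"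
proof -
  let ?I = "{(k, i). k < i \<and> i \<le> n}"
  have "prod_A (raise m c r) = (\<Prod>x\<in>?I. (case x of (k, i) \<Rightarrow> factor_A m k i)
    * (case x of (k, i) \<Rightarrow> if k = c \<and> i = Suc r then 1 / (1 - q * node q z m c (Suc r) / node q z m c r) else 1)
    * (case x of (k, i) \<Rightarrow> if k = c \<and> i = r then 1 - node q z m c r / node q z m c (r - 1) else 1))"
    unfolding prod_A_def by (intro prod.cong refl) (clarsimp simp only: factor_A_raise[OF m M c r] split: prod.splits)
  also have "\<dots> = prod_A m
    * (if (c, Suc r) \<in> ?I then 1 / (1 - q * node q z m c (Suc r) / node q z m c r) else 1)
    * (if (c, r) \<in> ?I then 1 - node q z m c r / node q z m c (r - 1) else 1)"
    by (simp only: prod_A_def prod.distrib prod.slice_pair[OF finite_triangle(1)])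
  finally show ?thesis using c r by auto
qed

lemma prod_B_raise: "prod_B (raise m c r) = prod_B m * (\<Prod>l\<in>{c<..r}. 1 / (1 - node q z m l r / node q z m c r))
    * (\<Prod>l\<in>{c<..<r}. 1 - node q z m l (r - 1) / node q z m c r)
    * (\<Prod>k<c. (1 - node q z m c r / (q * node q z m k r)) / (1 - node q z m c r / (q * node q z m k (Suc r))))"
proof -
  let ?I = "{(k, l, i). k < l \<and> l < i \<and> i \<le> n}"
  have "prod_B (raise m c r) = (\<Prod>x\<in>?I. (case x of (k, l, i) \<Rightarrow> factor_B m k l i)
    * (case x of (k, l, i) \<Rightarrow> if k = c \<and> i = Suc r then 1 / (1 - node q z m l r / node q z m c r) else 1)
    * (case x of (k, l, i) \<Rightarrow> if k = c \<and> i = r then 1 - node q z m l (r - 1) / node q z m c r else 1)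
    * (case x of (k, l, i) \<Rightarrow> if l = c \<and> i = Suc r then (1 - node q z m c r / (q * node q z m k r)) / (1 - node q z m c r / (q * node q z m k (Suc r))) else 1))"
    unfolding prod_B_def by (intro prod.cong refl) (clarsimp simp only: factor_B_raise[OF m M c r] split: prod.splits)
  also have "\<dots> = prod_B m * (\<Prod>l\<in>{l. (c, l, Suc r) \<in> ?I}. 1 / (1 - node q z m l r / node q z m c r))
    * (\<Prod>l\<in>{l. (c, l, r) \<in> ?I}. 1 - node q z m l (r - 1) / node q z m c r)
    * (\<Prod>k\<in>{k. (k, c, Suc r) \<in> ?I}. (1 - node q z m c r / (q * node q z m k r)) / (1 - node q z m c r / (q * node q z m k (Suc r))))"
    by (simp only: prod_B_def prod.distrib prod.slice_first[OF finite_triangle(2)] prod.slice_second[OF finite_triangle(2)])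
  also have "{l. (c, l, Suc r) \<in> ?I} = {c<..r}" using r by auto
  also have "{l. (c, l, r) \<in> ?I} = {c<..<r}" using r by auto
  also have "{k. (k, c, Suc r) \<in> ?I} = {..<c}" using c r by auto
  finally show ?thesis .
qed

lemma prod_C_raise: "prod_C (raise m c r) = prod_C m * (\<Prod>l\<in>{c<..Suc r}. 1 / (1 - q * node q z m l (Suc r) / node q z m c r))
    * (\<Prod>l\<in>{c<..r}. 1 - q * node q z m l r / node q z m c r)
    * (\<Prod>k<c. (1 - node q z m c r / node q z m k (r - 1)) / (1 - node q z m c r / node q z m k r))"
proof -
  let ?I = "{(k, l, i). k < l \<and> l \<le> i \<and> i \<le> n}"
  have "prod_C (raise m c r) = (\<Prod>x\<in>?I. (case x of (k, l, i) \<Rightarrow> factor_C m k l i)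
    * (case x of (k, l, i) \<Rightarrow> if k = c \<and> i = Suc r then 1 / (1 - q * node q z m l (Suc r) / node q z m c r) else 1)
    * (case x of (k, l, i) \<Rightarrow> if k = c \<and> i = r then 1 - q * node q z m l r / node q z m c r else 1)
    * (case x of (k, l, i) \<Rightarrow> if l = c \<and> i = r then (1 - node q z m c r / node q z m k (r - 1)) / (1 - node q z m c r / node q z m k r) else 1))"
    unfolding prod_C_def by (intro prod.cong refl) (clarsimp simp only: factor_C_raise[OF m M c r] split: prod.splits)
  also have "\<dots> = prod_C m * (\<Prod>l\<in>{l. (c, l, Suc r) \<in> ?I}. 1 / (1 - q * node q z m l (Suc r) / node q z m c r))
    * (\<Prod>l\<in>{l. (c, l, r) \<in> ?I}. 1 - q * node q z m l r / node q z m c r)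
    * (\<Prod>k\<in>{k. (k, c, r) \<in> ?I}. (1 - node q z m c r / node q z m k (r - 1)) / (1 - node q z m c r / node q z m k r))"
    by (simp only: prod_C_def prod.distrib prod.slice_first[OF finite_triangle(3)] prod.slice_second[OF finite_triangle(3)])
  also have "{l. (c, l, Suc r) \<in> ?I} = {c<..Suc r}" using r by auto
  also have "{l. (c, l, r) \<in> ?I} = {c<..r}" using r by auto
  also have "{k. (k, c, r) \<in> ?I} = {..<c}" using c r by auto
  finally show ?thesis .
qed

text \<open>The sum of the row sums grows by one, and the diagonal sum grows along with it only for
  c = r.\<close>

lemma sgn_part_raise: "sgn_part (raise m c r) = sgn_part m * (if c < r then - 1 else 1)"
proof -
  have "(\<Sum>i=1..n. int (row_sum (raise m c r) i)) = (\<Sum>i=1..n. int (row_sum m i) + (if i = Suc r then 1 else 0))"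
    using c by (intro sum.cong) (auto simp: row_sum_raise)
  then have 1: "(\<Sum>i=1..n. int (row_sum (raise m c r) i)) = (\<Sum>i=1..n. int (row_sum m i)) + 1"
    using r by (simp add: sum.distrib)
  have "(\<Sum>i<n. int (raise m c r i i)) = (\<Sum>i<n. int (m i i) + (if i = r then (if c < r then 0 else 1) else 0))"
    using c by (intro sum.cong) (auto simp: raise_def upd2_def)
  then have 2: "(\<Sum>i<n. int (raise m c r i i)) = (\<Sum>i<n. int (m i i)) + (if c < r then 0 else 1)"
    using r by (simp add: sum.distrib)
  have "((- 1) :: 'a) powi (x + 1) = - ((- 1) powi x)" for x by (simp add: power_int_add)
  from this[of "(\<Sum>i=1..n. int (row_sum m i)) - (\<Sum>i<n. int (m i i))"]
  show ?thesis unfolding sgn_part_def 1 2 by (simp add: algebra_simps)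
qed

text \<open>The entry m_{c,r} contributes to the exponent of z_j exactly for c < j \<le> r.\<close>

lemma z_part_raise: "z_part (raise m c r) = z_part m * zprod z c r"
proof -
  have inner: "(\<Sum>k<j. \<Sum>i=j+1..n. raise m c r k (i - 1)) = (\<Sum>k<j. \<Sum>i=j+1..n. m k (i - 1)) + (if c < j \<and> j \<le> r then 1 else 0)" for j
  proof -
    have "(\<Sum>k<j. \<Sum>i=j+1..n. raise m c r k (i - 1)) = (\<Sum>k<j. \<Sum>i=j+1..n. m k (i - 1) + (if k = c then if i = Suc r then 1 else 0 else 0))"
      by (intro sum.cong) (auto simp: raise_def upd2_def)
    also have "\<dots> = (\<Sum>k<j. \<Sum>i=j+1..n. m k (i - 1)) + (\<Sum>k<j. \<Sum>i=j+1..n. if k = c then if i = Suc r then 1 else 0 else 0)"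
      by (simp only: sum.distrib)
    also have "(\<Sum>k<j. \<Sum>i=j+1..n. if k = c then if i = Suc r then 1 else 0 else 0)
       = (\<Sum>k<j. if k = c then (if j \<le> r then 1 else 0 :: nat) else 0)"
      using r by (intro sum.cong) auto
    also have "\<dots> = (if c < j \<and> j \<le> r then 1 else 0)" by simp
    finally show ?thesis .
  qed
  have "z_part (raise m c r) = (\<Prod>j=1..n. z j ^ (\<Sum>k<j. \<Sum>i=j+1..n. m k (i - 1)) * (if j \<in> {c+1..r} then z j else 1))"
    unfolding z_part_def inner by (intro prod.cong) auto
  also have "\<dots> = z_part m * (\<Prod>j=1..n. if j \<in> {c+1..r} then z j else 1)"
    by (simp only: prod.distrib z_part_def)
  also have "(\<Prod>j=1..n. if j \<in> {c+1..r} then z j else 1) = zprod z c r"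
  proof -
    have "{1..n} \<inter> {c+1..r} = {c+1..r}" using r by auto
    then show ?thesis unfolding zprod_def by (subst prod.inter_restrict[symmetric]) auto
  qed
  finally show ?thesis .
qed

text \<open>The sums of entries in \<open>p_exp_raise\<close> are, up to sign, exponents of products
  of nodes. Passing to nodes introduces factors z_1 ... z_l, which cancel except for the z_{c,r}
  supplied by \<open>z_part_raise\<close>.\<close>

lemma monomial_raise:
  "q powi (p_exp n (raise m c r)) * zprod z c r = q powi (p_exp n m)
    * (if c < r then (\<Prod>l\<in>{c<..r}. node q z m l r) / (\<Prod>l\<in>{c<..<r}. node q z m l (r - 1)) / node q z m c r else 1)
    * (\<Prod>l<c. node q z m l r) / (\<Prod>l<c. node q z m l (Suc r))"
proof -
  let ?y = "zprod z 0"
  have nd: "(\<Prod>l\<in>I. node q z m l i) = q powi (- (\<Sum>l\<in>I. int (m l i))) * prod ?y I" for I i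
    unfolding node_def prod.distrib prod_powi sum_negf ..
  have ynz: "prod ?y I \<noteq> 0" if "I \<subseteq> {..n}" for I
    using that zprod_nz finite_subset[OF that] by auto
  have yL: "prod ?y {..<c} \<noteq> 0" by (rule ynz) (use c r in auto)
  have yH: "prod ?y {c<..<r} \<noteq> 0" by (rule ynz) (use c r in auto)
  have yc: "?y c \<noteq> 0" using zprod_nz c r by simp
  show ?thesis
  proof (cases "c < r")
    case True
    have "{c<..r} = insert r {c<..<r}" using True by auto
    then have y1: "prod ?y {c<..r} = ?y c * zprod z c r * prod ?y {c<..<r}"
      using zprod_mult[of c r] True by simp
    have "q powi (p + (- h - a + s + u + x)) * zc = q powi p * (q powi - h * (yc * zc * ys) / (q powi - s * ys) / (q powi - x * yc)) * (q powi - a * yl) / (q powi - u * yl)"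
      if "yl \<noteq> 0" "yc \<noteq> 0" "ys \<noteq> 0" for p h a s u x zc yl yc ys
      using that q0 by (simp add: power_int_add power_int_minus power_int_diff field_simps)
    from this[OF yL yc yH] show ?thesis
      unfolding p_exp_raise[OF m c r] nd y1 using True by (simp add: node_def algebra_simps)
  next
    case False
    then have e: "c = r" using c by simp
    have "q powi (p + (- a + u)) = q powi p * (q powi - a * yl) / (q powi - u * yl)"
      if "yl \<noteq> 0" for p a u yl
      using that q0 by (simp add: power_int_add power_int_minus power_int_diff field_simps)
    from this[OF yL] show ?thesis
      unfolding p_exp_raise[OF m c r] nd using e by (simp add: zprod_def algebra_simps)
  qed
qed

lemma summand_raise: "summand (raise m c r) = summand m * summand_ratio q (node q z m) r c"
proof -
  let ?t = "node q z m"
  have "summand (raise m c r) = sgn_part (raise m c r) * (q powi p_exp n (raise m c r) * zprod z c r) * z_part m * prod_A (raise m c r) * prod_B (raise m c r) * prod_C (raise m c r)"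
    by (simp only: summand_def z_part_raise mult_ac)
  also have "\<dots> = summand m * summand_ratio q ?t r c"
    unfolding sgn_part_raise monomial_raise prod_A_raise prod_B_raise prod_C_raise summand_def summand_ratio_def
    by (simp add: prod_dividef mult_ac)
  finally show ?thesis .
qed

text \<open>A detailed balance relation: weighted by the summand, the coefficient linking
  \<open>raise m c r\<close> to \<open>m\<close> in \<open>gt_f\<close> becomes a dual e-coefficient
  at \<open>m\<close>, and those have sum 1 over the columns.\<close>

lemma summand_f_coeff: "summand (raise m c r) * f_coeff (node q z (raise m c r)) r c = summand m * e_coeff_dual (node q z m) r c"
proof -
  have "summand_ratio q (node q z m) r c * f_coeff (upd2 (node q z m) c r (node q z m c r / q)) r c = e_coeff_dual (node q z m) r c"
  proof (rule summand_ratio_f_coeff[OF c q0])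
    show "node q z m l i \<noteq> 0" if "l \<le> Suc r" for l i using that r by (simp add: node_nz)
    show "node q z m c r \<noteq> node q z m l r" "node q z m c r \<noteq> q * node q z m l r" if "l \<le> r" "l \<noteq> c" for l
      using that c r by (auto simp: node_eq node_eq_q)
    \<comment> \<open>Equality would force l = c and m_{c,r} + 1 = m_{c,r+1}, against monotonicity
      along the column.\<close>
    show "node q z m c r \<noteq> q * node q z m l (Suc r)" if "l \<le> Suc r" for l
      using that c r gt_array_antimono[OF m c r] by (auto simp: node_eq_q)
  qed
  then show ?thesis unfolding summand_raise node_raise by (simp add: mult.assoc)
qed

end

lemma summand_zero: "summand (\<lambda>_ _. 0) = 1"
proof -
  have "prod_A (\<lambda>_ _. 0) = 1" "prod_B (\<lambda>_ _. 0) = 1" "prod_C (\<lambda>_ _. 0) = 1"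
    by (auto simp: prod_A_def prod_B_def prod_C_def factor_A_def factor_B_def factor_C_def qprod_def intro!: prod.neutral)
  moreover have "p_exp n (\<lambda>_ _. 0) = 0" by (simp add: p_exp_def case_prod_unfold)
  ultimately show ?thesis by (simp add: summand_def sgn_part_def z_part_def row_sum_def)
qed

section \<open>The functional given by summation against the fermionic weight\<close>

definition gt_psi :: "weight \<Rightarrow> ((nat \<Rightarrow> nat \<Rightarrow> nat) \<Rightarrow> 'a) \<Rightarrow> 'a" where
  "gt_psi \<gamma> X = (\<Sum>m | gt_array n m \<and> wt n m = \<gamma>. summand m * X m)"

text \<open>Raising and lowering are inverse bijections between the pairs (m, k) of the two sides,
  detailed balance exchanges the coefficients, and their sum over k is 1. Pairs outside the
  bijection have zero coefficient.\<close>

lemma gt_psi_gt_f: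
  assumes r: "r < n"
  shows "gt_psi \<gamma> (gt_f r X) = gt_psi (\<lambda>i. \<gamma> i - alpha (Suc r) i) X"
proof -
  let ?A = "\<lambda>\<gamma>. {m. gt_array n m \<and> wt n m = \<gamma>}"
  let ?\<gamma> = "\<lambda>i. \<gamma> i - alpha (Suc r) i"
  define P where "P = {(m, k). m \<in> ?A \<gamma> \<and> k \<le> r \<and> 0 < m k r \<and> gt_array n (lower m k r)}"
  define Q where "Q = {(m, k). m \<in> ?A ?\<gamma> \<and> k \<le> r \<and> gt_array n (raise m k r)}"
  have "gt_psi \<gamma> (gt_f r X) = (\<Sum>m\<in>?A \<gamma>. \<Sum>k\<in>{..r}. summand m * f_coeff (node q z m) r k * X (lower m k r))"
    unfolding gt_psi_def by (intro sum.cong) (auto simp: gt_f_def sum_distrib_left mult.assoc)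
  also have "\<dots> = (\<Sum>(m, k)\<in>?A \<gamma> \<times> {..r}. summand m * f_coeff (node q z m) r k * X (lower m k r))"
    by (rule sum.cartesian_product)
  also have "\<dots> = (\<Sum>(m, k)\<in>P. summand m * f_coeff (node q z m) r k * X (lower m k r))"
  proof (rule sum.mono_neutral_right)
    show "\<forall>x\<in>?A \<gamma> \<times> {..r} - P. (case x of (m, k) \<Rightarrow> summand m * f_coeff (node q z m) r k * X (lower m k r)) = 0"
    proof
      fix x assume x0: "x \<in> ?A \<gamma> \<times> {..r} - P"
      obtain m k where "x = (m, k)" by (cases x)
      moreover from x0 this have "gt_array n m" "k \<le> r" "\<not> (0 < m k r \<and> gt_array n (lower m k r))"
        unfolding P_def by simp_all
      ultimately have x: "x = (m, k)" "gt_array n m" "k \<le> r" "\<not> (0 < m k r \<and> gt_array n (lower m k r))" by blast+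
      then show "(case x of (m, k) \<Rightarrow> summand m * f_coeff (node q z m) r k * X (lower m k r)) = 0"
        using f_coeff_eq_0[OF x(2,3) r x(4)] by simp
    qed
  qed (use finite_wt[of n \<gamma>] in \<open>auto simp: P_def\<close>)
  also have "\<dots> = (\<Sum>(m, k)\<in>Q. summand m * e_coeff_dual (node q z m) r k * X m)"
  proof (rule sum.reindex_bij_witness[of _ "\<lambda>(m, k). (raise m k r, k)" "\<lambda>(m, k). (lower m k r, k)"])
    fix x assume "x \<in> P"
    then obtain m k where x: "x = (m, k)" "gt_array n m" "wt n m = \<gamma>" "k \<le> r" "0 < m k r" "gt_array n (lower m k r)"
      by (auto simp: P_def)
    have rl: "raise (lower m k r) k r = m" using x by (intro raise_lower)
    have w: "wt n m = (\<lambda>i. wt n (lower m k r) i + alpha (Suc r) i)"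
      using wt_raise[OF x(4) r, of "lower m k r"] rl by simp
    show "(case case x of (m, k) \<Rightarrow> (lower m k r, k) of (m, k) \<Rightarrow> (raise m k r, k)) = x"
      using x rl by simp
    have "wt n (lower m k r) = ?\<gamma>" using w x(3) by (auto simp: fun_eq_iff)
    then show "(case x of (m, k) \<Rightarrow> (lower m k r, k)) \<in> Q" using x rl by (simp add: Q_def)
    have "summand m * f_coeff (node q z m) r k = summand (lower m k r) * e_coeff_dual (node q z (lower m k r)) r k"
      using summand_f_coeff[of "lower m k r" k r] x r rl by simp
    then show "(case case x of (m, k) \<Rightarrow> (lower m k r, k) of (m, k) \<Rightarrow> summand m * e_coeff_dual (node q z m) r k * X m)
        = (case x of (m, k) \<Rightarrow> summand m * f_coeff (node q z m) r k * X (lower m k r))"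
      using x by simp
  next
    fix x assume "x \<in> Q"
    then obtain m k where x: "x = (m, k)" "gt_array n m" "wt n m = ?\<gamma>" "k \<le> r" "gt_array n (raise m k r)"
      by (auto simp: Q_def)
    show "(case case x of (m, k) \<Rightarrow> (raise m k r, k) of (m, k) \<Rightarrow> (lower m k r, k)) = x"
      using x by (simp add: lower_raise)
    have "wt n (raise m k r) = \<gamma>" using wt_raise[OF x(4) r] x(3) by simp
    moreover have "0 < raise m k r k r" by (simp add: raise_def upd2_def)
    ultimately show "(case x of (m, k) \<Rightarrow> (raise m k r, k)) \<in> P"
      using x by (simp add: P_def lower_raise)
  qed
  also have "\<dots> = (\<Sum>(m, k)\<in>?A ?\<gamma> \<times> {..r}. summand m * e_coeff_dual (node q z m) r k * X m)"
  proof (rule sum.mono_neutral_left)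
    show "\<forall>x\<in>?A ?\<gamma> \<times> {..r} - Q. (case x of (m, k) \<Rightarrow> summand m * e_coeff_dual (node q z m) r k * X m) = 0"
    proof
      fix x assume "x \<in> ?A ?\<gamma> \<times> {..r} - Q"
      then obtain m k where x: "x = (m, k)" "gt_array n m" "k \<le> r" "\<not> gt_array n (raise m k r)"
        by (auto simp: Q_def)
      then show "(case x of (m, k) \<Rightarrow> summand m * e_coeff_dual (node q z m) r k * X m) = 0"
        using e_coeff_dual_eq_0[OF x(2,3) r x(4)] by simp
    qed
  qed (use finite_wt[of n ?\<gamma>] in \<open>auto simp: Q_def\<close>)
  also have "\<dots> = (\<Sum>m\<in>?A ?\<gamma>. \<Sum>k\<in>{..r}. summand m * e_coeff_dual (node q z m) r k * X m)"
    by (rule sum.cartesian_product[symmetric])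
  also have "\<dots> = (\<Sum>m\<in>?A ?\<gamma>. summand m * (\<Sum>k\<le>r. e_coeff_dual (node q z m) r k) * X m)"
    by (simp only: sum_distrib_left sum_distrib_right)
  also have "\<dots> = gt_psi ?\<gamma> X"
    unfolding gt_psi_def using r by (simp add: sum_e_coeff_dual inj_node)
  finally show ?thesis .
qed

end

section \<open>Operators on the Verma module\<close>

lemma poly_mapping_sum_singles: "p = (\<Sum>k\<in>Poly_Mapping.keys p. Poly_Mapping.single k (Poly_Mapping.lookup p k))"
proof (rule poly_mapping_eqI)
  fix k
  have "Poly_Mapping.lookup (\<Sum>k\<in>Poly_Mapping.keys p. Poly_Mapping.single k (Poly_Mapping.lookup p k)) k
      = (\<Sum>k'\<in>Poly_Mapping.keys p. if k' = k then Poly_Mapping.lookup p k else 0)"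
    unfolding lookup_sum by (intro sum.cong) (auto simp: lookup_single when_def)
  then show "Poly_Mapping.lookup p k = Poly_Mapping.lookup (\<Sum>k\<in>Poly_Mapping.keys p. Poly_Mapping.single k (Poly_Mapping.lookup p k)) k"
    by (simp add: in_keys_iff)
qed

lemma const_commute: "const c * p = p * const c"
proof -
  have "const c * (\<Sum>k\<in>A. Poly_Mapping.single k (f k)) = (\<Sum>k\<in>A. Poly_Mapping.single k (f k)) * const c" for A f
    by (simp add: sum_distrib_left sum_distrib_right const_def mult_single mult.commute)
  then show ?thesis using poly_mapping_sum_singles[of p] by metis
qed

lemma gen_carrier:
  "i \<in> {1..n} \<Longrightarrow> gen (EE i) \<in> carrier (free_alg n)" "i \<in> {1..n} \<Longrightarrow> gen (FF i) \<in> carrier (free_alg n)"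
  "i \<le> n \<Longrightarrow> gen (VV i) \<in> carrier (free_alg n)" "i \<le> n \<Longrightarrow> gen (VI i) \<in> carrier (free_alg n)"
  by (auto intro!: free_alg_gen simp: gl_gens_def)

lemma free_alg_power: "p \<in> carrier (free_alg n) \<Longrightarrow> p ^ k \<in> carrier (free_alg n)"
  by (induction k) (auto intro: free_alg_mult free_alg_one)

lemma K_carrier: "i \<in> {1..n} \<Longrightarrow> Kpoly i \<in> carrier (free_alg n)" "i \<in> {1..n} \<Longrightarrow> Kinv_poly i \<in> carrier (free_alg n)"
  by (auto simp: Kpoly_def Kinv_poly_def intro!: free_alg_mult gen_carrier)

lemmas free_alg_closed = free_alg_add free_alg_diff free_alg_mult free_alg_const free_alg_one free_alg_power
  gen_carrier K_carrier

lemma qcls_hom: "qcls n v \<in> ring_hom (free_alg n) (quantum_gl n v)"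
  using ideal.rcos_ring_hom[OF ideal_gl_ideal] by (simp add: qcls_def[abs_def] quantum_gl_def)

lemma qcls_closed: "p \<in> carrier (free_alg n) \<Longrightarrow> qcls n v p \<in> carrier (quantum_gl n v)"
  by (rule ring_hom_closed[OF qcls_hom])

lemma qcls_surj: "x \<in> carrier (quantum_gl n v) \<Longrightarrow> \<exists>p \<in> carrier (free_alg n). x = qcls n v p"
  by (auto simp: quantum_gl_def FactRing_def A_RCOSETS_def' qcls_def)

lemma qcls_relation: "r \<in> gl_relations n v \<Longrightarrow> qcls n v r = qcls n v 0"
proof -
  assume r: "r \<in> gl_relations n v"
  interpret ring "free_alg n" by (rule ring_free_alg)
  interpret I: ideal "gl_ideal n v" "free_alg n" by (rule ideal_gl_ideal)
  have "r \<in> gl_ideal n v" unfolding gl_ideal_def using genideal_self[OF gl_relations_carrier] r by blast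
  moreover have "(0 :: 'a free_poly) \<in> gl_ideal n v" using I.zero_closed by simp
  ultimately show ?thesis
    unfolding qcls_def using a_coset_join2[OF _ I.a_subgroup] I.Icarr by simp
qed

context quantum_gl_module
begin

text \<open>The action pulled back to the free algebra, where the defining relations can be applied
  without handling cosets.\<close>

definition op_act :: "'a free_poly \<Rightarrow> 'm \<Rightarrow> 'm" where
  "op_act p w = act (qcls n v p) w"

lemma op_act_add: "p \<in> carrier (free_alg n) \<Longrightarrow> p' \<in> carrier (free_alg n) \<Longrightarrow> op_act (p + p') w = op_act p w + op_act p' w"
  unfolding op_act_def using ring_hom_add[OF qcls_hom, of p n p' v] by (simp add: act_add qcls_closed)

lemma op_act_mult: "p \<in> carrier (free_alg n) \<Longrightarrow> p' \<in> carrier (free_alg n) \<Longrightarrow> op_act (p * p') w = op_act p (op_act p' w)"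
  unfolding op_act_def using ring_hom_mult[OF qcls_hom, of p n p' v] by (simp add: act_mult qcls_closed)

lemma op_act_right_add: "p \<in> carrier (free_alg n) \<Longrightarrow> op_act p (w + w') = op_act p w + op_act p w'"
  unfolding op_act_def by (intro act_right_add qcls_closed)

lemma op_act_const: "op_act (const c) w = scale c w"
  by (simp add: op_act_def act_const)

lemma op_act_one: "op_act 1 w = w"
  using op_act_const[of 1 w] by (simp add: const_def)

lemma op_act_zero: "op_act 0 w = 0"
  using op_act_const[of 0 w] by (simp add: const_def)

lemma op_act_diff: "p \<in> carrier (free_alg n) \<Longrightarrow> p' \<in> carrier (free_alg n) \<Longrightarrow> op_act (p - p') w = op_act p w - op_act p' w"
  using op_act_add[of "p - p'" p' w] by (simp add: free_alg_diff)

lemma op_act_relation: "r \<in> gl_relations n v \<Longrightarrow> op_act r w = 0"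
  using op_act_zero[of w] by (simp add: op_act_def qcls_relation)

lemma op_act_scale: "p \<in> carrier (free_alg n) \<Longrightarrow> op_act p (scale c w) = scale c (op_act p w)"
  using op_act_mult[of p "const c" w] op_act_mult[of "const c" p w]
  by (simp add: free_alg_const op_act_const const_commute)

lemma op_act_right_zero: "p \<in> carrier (free_alg n) \<Longrightarrow> op_act p 0 = 0"
  using op_act_scale[of p 0 0] by simp

lemma op_act_const_mult: "p \<in> carrier (free_alg n) \<Longrightarrow> op_act (const c * p) w = scale c (op_act p w)"
  by (simp add: op_act_mult free_alg_const op_act_const)

lemma op_act_power_eigen:
  "p \<in> carrier (free_alg n) \<Longrightarrow> op_act p w = scale c w \<Longrightarrow> op_act (p ^ k) w = scale (c ^ k) w"
  by (induction k) (auto simp: op_act_one op_act_mult free_alg_power op_act_scale mult.commute)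

lemma V_VI: "k \<le> n \<Longrightarrow> op_act (gen (VV k)) (op_act (gen (VI k)) w) = w"
  using op_act_relation[OF gl_relations.inv_right, of k w]
  by (simp add: op_act_diff op_act_mult free_alg_closed op_act_one)

lemma VI_V: "k \<le> n \<Longrightarrow> op_act (gen (VI k)) (op_act (gen (VV k)) w) = w"
  using op_act_relation[OF gl_relations.inv_left, of k w]
  by (simp add: op_act_diff op_act_mult free_alg_closed op_act_one)

lemma V_commute: "k \<le> n \<Longrightarrow> l \<le> n \<Longrightarrow>
    op_act (gen (VV k)) (op_act (gen (VV l)) w) = op_act (gen (VV l)) (op_act (gen (VV k)) w)"
  using op_act_relation[OF gl_relations.commute, of k l w]
  by (simp add: op_act_diff op_act_mult free_alg_closed)

lemma VI_V_commute: "k \<le> n \<Longrightarrow> l \<le> n \<Longrightarrow>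
    op_act (gen (VI k)) (op_act (gen (VV l)) w) = op_act (gen (VV l)) (op_act (gen (VI k)) w)"
  using V_commute[of k l "op_act (gen (VI k)) w"] by (metis V_VI VI_V)

lemma form_eps: "k \<le> n \<Longrightarrow> form n (eps k) \<beta> = \<beta> k"
proof -
  assume "k \<le> n"
  have "form n (eps k) \<beta> = (\<Sum>l\<le>n. if l = k then \<beta> k else 0)"
    unfolding form_def eps_def by (intro sum.cong) auto
  then show ?thesis using \<open>k \<le> n\<close> by simp
qed

lemma V_E: "k \<le> n \<Longrightarrow> j \<in> {1..n} \<Longrightarrow>
    op_act (gen (VV k)) (op_act (gen (EE j)) w) = scale (v powi alpha j k) (op_act (gen (EE j)) (op_act (gen (VV k)) w))"
  using op_act_relation[OF gl_relations.weight_E, of k j "op_act (gen (VV k)) w"]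
  by (simp add: op_act_diff op_act_mult op_act_const free_alg_closed VI_V form_eps)

lemma V_F: "k \<le> n \<Longrightarrow> j \<in> {1..n} \<Longrightarrow>
    op_act (gen (VV k)) (op_act (gen (FF j)) w) = scale (v powi - alpha j k) (op_act (gen (FF j)) (op_act (gen (VV k)) w))"
  using op_act_relation[OF gl_relations.weight_F, of k j "op_act (gen (VV k)) w"]
  by (simp add: op_act_diff op_act_mult op_act_const free_alg_closed VI_V form_eps)

lemma E_F: "i \<in> {1..n} \<Longrightarrow> j \<in> {1..n} \<Longrightarrow> op_act (gen (EE i)) (op_act (gen (FF j)) w) = op_act (gen (FF j)) (op_act (gen (EE i)) w)
    + (if i = j then scale (1 / (v - inverse v)) (op_act (Kpoly i) w - op_act (Kinv_poly i) w) else 0)"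
proof -
  assume i: "i \<in> {1..n}" and j: "j \<in> {1..n}"
  let ?R = "if i = j then const (1 / (v - inverse v)) * (Kpoly i - Kinv_poly i) else 0"
  have "?R \<in> carrier (free_alg n)" using i by (auto intro!: free_alg_closed simp: free_alg_carrier[of 0])
  then have A: "op_act (gen (EE i)) (op_act (gen (FF j)) w) - op_act (gen (FF j)) (op_act (gen (EE i)) w) - op_act ?R w = 0"
    using op_act_relation[OF gl_relations.E_F[OF i j], of w] i j by (simp only: op_act_diff op_act_mult free_alg_closed)
  have B: "op_act ?R w = (if i = j then scale (1 / (v - inverse v)) (op_act (Kpoly i) w - op_act (Kinv_poly i) w) else 0)"
    using i by (simp add: op_act_const_mult op_act_diff op_act_zero free_alg_closed)
  have "a - b - c = 0 \<Longrightarrow> c = d \<Longrightarrow> a = b + d" for a b c d :: 'm by (simp add: algebra_simps)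
  from this[OF A B] show ?thesis .
qed

end

text \<open>The eigenvalue v^(alpha_i, lambda - gamma) of K_i in weight lambda - gamma.\<close>

definition whit_scalar :: "nat \<Rightarrow> 'a::field \<Rightarrow> (nat \<Rightarrow> 'a) \<Rightarrow> nat \<Rightarrow> weight \<Rightarrow> 'a" where
  "whit_scalar n v vl i \<gamma> = vpow n vl (alpha i) * v powi - form n (alpha i) \<gamma>"

lemma vpow_alpha: "i \<in> {1..n} \<Longrightarrow> vpow n vl (alpha i) = vl (i - 1) * inverse (vl i)"
proof -
  assume i: "i \<in> {1..n}"
  have "vpow n vl (alpha i) = (\<Prod>k\<le>n. (if k = i - 1 then vl (i - 1) else 1) * (if k = i then inverse (vl i) else 1))"
    unfolding vpow_def alpha_def eps_def using i by (intro prod.cong) (auto simp: power_int_minus)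
  then show ?thesis using i by (auto simp: prod.distrib)
qed

section \<open>Weight vectors and the twisted generators\<close>

locale verma_gt = verma_module scale n v act vl hw + gt_model n q z
  for scale :: "'a::field \<Rightarrow> 'm::ab_group_add \<Rightarrow> 'm" and n :: nat and v :: 'a
    and act :: "'a free_poly set \<Rightarrow> 'm \<Rightarrow> 'm" and vl :: "nat \<Rightarrow> 'a" and hw :: 'm
    and q :: 'a and z :: "nat \<Rightarrow> 'a" +
  assumes q_eq: "q = v\<^sup>2" and v0: "v \<noteq> 0" and vl0: "\<And>k. k \<le> n \<Longrightarrow> vl k \<noteq> 0"
    and z_eq: "\<And>i. i \<in> {1..n} \<Longrightarrow> z i = z_var n v vl i"
begin

abbreviation kappa :: "nat \<Rightarrow> weight \<Rightarrow> 'a" where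
  "kappa \<equiv> whit_scalar n v vl"

text \<open>Refers to the single v^(eps_k) and not just to the K_i of \<open>weight_space\<close>,
  because the commutation relations with E_i and F_i are given for these. The argument is the depth
  below lambda.\<close>

definition has_wt :: "weight \<Rightarrow> 'm \<Rightarrow> bool" where
  "has_wt \<gamma> w \<longleftrightarrow> (\<forall>k\<le>n. op_act (gen (VV k)) w = scale (vl k * v powi - \<gamma> k) w)"

lemma kappa_alt: "i \<in> {1..n} \<Longrightarrow> kappa i \<gamma> = (vl (i - 1) * v powi - \<gamma> (i - 1)) * inverse (vl i * v powi - \<gamma> i)"
  using v0 by (simp add: whit_scalar_def vpow_alpha form_alpha power_int_diff power_int_minus divide_inverse)

lemma kappa_nz: "i \<in> {1..n} \<Longrightarrow> kappa i \<gamma> \<noteq> 0"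
proof -
  assume i: "i \<in> {1..n}"
  then have "vl i \<noteq> 0" "vl (i - 1) \<noteq> 0" by (auto intro!: vl0)
  then show ?thesis using v0 i by (simp add: kappa_alt)
qed

lemma kappa_add: "i \<in> {1..n} \<Longrightarrow> kappa i (\<lambda>k. \<gamma> k + \<beta> k) = kappa i \<gamma> * v powi - form n (alpha i) \<beta>"
  "i \<in> {1..n} \<Longrightarrow> kappa i (\<lambda>k. \<gamma> k - \<beta> k) = kappa i \<gamma> * v powi form n (alpha i) \<beta>"
proof -
  assume i: "i \<in> {1..n}"
  have "- form n (alpha i) (\<lambda>k. \<gamma> k + \<beta> k) = - form n (alpha i) \<gamma> + - form n (alpha i) \<beta>"
    "- form n (alpha i) (\<lambda>k. \<gamma> k - \<beta> k) = - form n (alpha i) \<gamma> + form n (alpha i) \<beta>"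
    using i by (simp_all add: form_alpha)
  then show "kappa i (\<lambda>k. \<gamma> k + \<beta> k) = kappa i \<gamma> * v powi - form n (alpha i) \<beta>"
    "kappa i (\<lambda>k. \<gamma> k - \<beta> k) = kappa i \<gamma> * v powi form n (alpha i) \<beta>"
    using v0 by (simp_all only: whit_scalar_def power_int_add mult.assoc simp_thms)
qed

lemma has_wt_VI: "has_wt \<gamma> w \<Longrightarrow> k \<le> n \<Longrightarrow> op_act (gen (VI k)) w = scale (inverse (vl k * v powi - \<gamma> k)) w"
proof -
  assume w: "has_wt \<gamma> w" and k: "k \<le> n"
  define c where "c = vl k * v powi - \<gamma> k"
  have c0: "c \<noteq> 0" using v0 vl0[OF k] by (simp add: c_def)
  have "scale (inverse c) w = scale (inverse c) (op_act (gen (VI k)) (op_act (gen (VV k)) w))" using VI_V[OF k] by simp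
  also have "\<dots> = scale (inverse c) (op_act (gen (VI k)) (scale c w))" using w k by (simp add: has_wt_def c_def)
  also have "\<dots> = op_act (gen (VI k)) w" using k c0 by (simp add: op_act_scale gen_carrier)
  finally show ?thesis by (simp add: c_def)
qed

lemma K_eigen:
  assumes "has_wt \<gamma> w" "i \<in> {1..n}"
  shows "op_act (Kpoly i) w = scale (kappa i \<gamma>) w" "op_act (Kinv_poly i) w = scale (inverse (kappa i \<gamma>)) w"
proof -
  have i: "i \<le> n" "i - 1 \<le> n" using assms by auto
  have V: "op_act (gen (VV k)) w = scale (vl k * v powi - \<gamma> k) w" if "k \<le> n" for k
    using assms that by (simp add: has_wt_def)
  note VI = has_wt_VI[OF assms(1)]
  show "op_act (Kpoly i) w = scale (kappa i \<gamma>) w"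
    unfolding Kpoly_def kappa_alt[OF assms(2)] using i by (simp add: op_act_mult gen_carrier VI V op_act_scale mult.commute)
  show "op_act (Kinv_poly i) w = scale (inverse (kappa i \<gamma>)) w"
    unfolding Kinv_poly_def kappa_alt[OF assms(2)] using i by (simp add: op_act_mult gen_carrier VI V op_act_scale mult.commute)
qed

lemma has_wt_E: "has_wt \<gamma> w \<Longrightarrow> i \<in> {1..n} \<Longrightarrow> has_wt (\<lambda>k. \<gamma> k - alpha i k) (op_act (gen (EE i)) w)"
  unfolding has_wt_def using v0
  by (auto simp: V_E op_act_scale gen_carrier power_int_diff power_int_minus divide_inverse mult_ac)

lemma has_wt_F: "has_wt \<gamma> w \<Longrightarrow> i \<in> {1..n} \<Longrightarrow> has_wt (\<lambda>k. \<gamma> k + alpha i k) (op_act (gen (FF i)) w)"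
  unfolding has_wt_def using v0
  by (auto simp: V_F op_act_scale gen_carrier power_int_add power_int_diff power_int_minus divide_inverse mult_ac)

lemma has_wt_scale: "has_wt \<gamma> w \<Longrightarrow> has_wt \<gamma> (scale c w)"
  unfolding has_wt_def by (auto simp: op_act_scale gen_carrier mult.commute)

definition whit_e :: "nat \<Rightarrow> 'm \<Rightarrow> 'm" where
  "whit_e i w = op_act (const (1 - v\<^sup>2) * (gen (EE i) * Kpoly i ^ (i - 1))) w"

text \<open>Up to a scalar the adjoint of Kbar_i Ebar_i Kbar_i^(i-1). The K_i^(-1) on the right and
  the factor v absorb the change of the normalization of J from beta to beta - alpha_i; the factor 1
  - v^(-2) cancels the denominator in the dual Whittaker equation.\<close>

definition whit_f :: "nat \<Rightarrow> 'm \<Rightarrow> 'm" where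
  "whit_f i w = op_act (const (v * (1 - (inverse v)\<^sup>2)) * (Kinv_poly i ^ (i - 1) * (gen (FF i) * Kinv_poly i))) w"

lemma whit_e_linear: "i \<in> {1..n} \<Longrightarrow> whit_e i (w + w') = whit_e i w + whit_e i w'" "i \<in> {1..n} \<Longrightarrow> whit_e i (scale c w) = scale c (whit_e i w)"
  "i \<in> {1..n} \<Longrightarrow> whit_e i 0 = 0"
  unfolding whit_e_def by (intro op_act_right_add op_act_scale op_act_right_zero free_alg_closed; simp)+

lemma whit_f_linear: "i \<in> {1..n} \<Longrightarrow> whit_f i (w + w') = whit_f i w + whit_f i w'" "i \<in> {1..n} \<Longrightarrow> whit_f i (scale c w) = scale c (whit_f i w)"
  "i \<in> {1..n} \<Longrightarrow> whit_f i 0 = 0"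
  unfolding whit_f_def by (intro op_act_right_add op_act_scale op_act_right_zero free_alg_closed; simp)+

lemma whit_e_wt: "has_wt \<gamma> w \<Longrightarrow> i \<in> {1..n} \<Longrightarrow> whit_e i w = scale ((1 - v\<^sup>2) * kappa i \<gamma> ^ (i - 1)) (op_act (gen (EE i)) w)"
  unfolding whit_e_def
  by (simp add: op_act_const op_act_mult free_alg_closed op_act_power_eigen[OF _ K_eigen(1)] op_act_scale mult.commute)

lemma whit_f_wt: "has_wt \<gamma> w \<Longrightarrow> i \<in> {1..n} \<Longrightarrow> whit_f i w = scale (v * (1 - (inverse v)\<^sup>2) * inverse (kappa i \<gamma>)
     * inverse (kappa i (\<lambda>k. \<gamma> k + alpha i k)) ^ (i - 1)) (op_act (gen (FF i)) w)"
proof -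
  assume w: "has_wt \<gamma> w" and i: "i \<in> {1..n}"
  have "op_act (Kinv_poly i ^ (i - 1)) (op_act (gen (FF i)) w) = scale (inverse (kappa i (\<lambda>k. \<gamma> k + alpha i k)) ^ (i - 1)) (op_act (gen (FF i)) w)"
    by (rule op_act_power_eigen[OF K_carrier(2)[OF i] K_eigen(2)[OF has_wt_F[OF w i] i]])
  then show ?thesis
    unfolding whit_f_def using i
    by (simp add: op_act_const op_act_mult free_alg_closed K_eigen(2)[OF w i] op_act_scale mult_ac)
qed

lemma has_wt_whit_f: "has_wt \<gamma> w \<Longrightarrow> i \<in> {1..n} \<Longrightarrow> has_wt (\<lambda>k. \<gamma> k + alpha i k) (whit_f i w)"
  by (simp add: whit_f_wt has_wt_scale has_wt_F)

lemma form_alpha_alpha: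
  "i \<in> {1..n} \<Longrightarrow> j \<in> {1..n} \<Longrightarrow> form n (alpha i) (alpha j) = (if i = j then 2 else if i = Suc j \<or> j = Suc i then - 1 else 0)"
  by (simp only: form_alpha) (auto simp: alpha_def eps_def)

text \<open>The power on the left comes from K_i^(i-1) passing F_j, the one on the right from the j
  inverse powers of K_j passing E_i.\<close>

lemma v_pow_comm_factor:
  assumes "i \<in> {1..n}" "j \<in> {1..n}"
  shows "(v powi - form n (alpha i) (alpha j)) ^ (i - 1) = comm_factor q (i - 1) (j - 1) * (v powi - form n (alpha i) (alpha j)) ^ j"
proof -
  obtain i' j' where ij: "i = Suc i'" "j = Suc j'" using assms by (metis atLeastAtMost_iff not_one_le_zero old.nat.exhaust)
  consider "i' = j'" | "i' = Suc j'" | "j' = Suc i'" | "i' \<noteq> j'" "i' \<noteq> Suc j'" "j' \<noteq> Suc i'" by blast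
  then show ?thesis
  proof cases
    case 1
    then show ?thesis using assms ij v0
      by (simp add: form_alpha_alpha comm_factor_def q_eq power_int_minus power_mult[symmetric] power2_eq_square field_simps)
  next
    case 2
    then show ?thesis using assms ij by (simp add: form_alpha_alpha comm_factor_def)
  next
    case 3
    then show ?thesis using assms ij v0 by (simp add: form_alpha_alpha comm_factor_def q_eq power2_eq_square field_simps)
  next
    case 4
    then show ?thesis using assms ij by (simp add: form_alpha_alpha comm_factor_def)
  qed
qed

lemma q_ne_1: "q \<noteq> 1"
  using q_not_root[of 1] by auto

text \<open>The scalars are those of \<open>gt_e_f\<close>, which is what lets the model represent
  the Verma module. After the twist the Cartan term (K_i - K_i^(-1))/(v - v^(-1)) becomes (1 - q)(1
  - \<open>ki\<close>^(-2)).\<close>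

lemma whit_e_f:
  assumes w: "has_wt \<gamma> w" and i: "i \<in> {1..n}" and j: "j \<in> {1..n}"
  shows "whit_e i (whit_f j w) = scale (comm_factor q (i - 1) (j - 1)) (whit_f j (whit_e i w)) +
    (if i = j then scale ((1 - q) * (1 - q powi (1 + form n (alpha i) \<gamma>) * z i)) w else 0)"
proof -
  define a where "a = form n (alpha i) (alpha j)"
  have a': "form n (alpha j) (alpha i) = a" using i j by (auto simp: a_def form_alpha_alpha)
  define u where "u = v powi - a"
  define ki where "ki = kappa i \<gamma>"
  define kj where "kj = kappa j \<gamma>"
  define kj' where "kj' = kappa j (\<lambda>k. \<gamma> k + alpha j k)"
  define c0 where "c0 = v * (1 - (inverse v)\<^sup>2)"
  define c where "c = comm_factor q (i - 1) (j - 1)"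
  define C where "C = (1 - v\<^sup>2) * (ki * u) ^ (i - 1) * (c0 * inverse kj * inverse kj' ^ (j - 1))"
  have nz: "ki \<noteq> 0" "kj \<noteq> 0" "kj' \<noteq> 0" using kappa_nz i j by (simp_all add: ki_def kj_def kj'_def)
  have u0: "u \<noteq> 0" using v0 by (simp add: u_def)
  have vu: "v powi a = inverse u" using v0 by (simp add: u_def power_int_minus)
  let ?E = "op_act (gen (EE i))" and ?F = "op_act (gen (FF j))"
  have L: "whit_e i (whit_f j w) = scale C (?E (?F w))"
  proof -
    have "whit_e i (whit_f j w) = scale (c0 * inverse kj * inverse kj' ^ (j - 1)) (whit_e i (?F w))"
      using i unfolding whit_f_wt[OF w j] kj_def[symmetric] kj'_def[symmetric] c0_def[symmetric] by (simp add: whit_e_linear)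
    also have "whit_e i (?F w) = scale ((1 - v\<^sup>2) * (ki * u) ^ (i - 1)) (?E (?F w))"
      using whit_e_wt[OF has_wt_F[OF w j] i] kappa_add(1)[OF i, of \<gamma> "alpha j"] by (simp add: ki_def u_def a_def)
    finally show ?thesis by (simp add: C_def mult_ac)
  qed
  have R: "scale c (whit_f j (whit_e i w)) = scale C (?F (?E w))"
  proof -
    have "kappa j (\<lambda>k. \<gamma> k - alpha i k) = kj * inverse u"
      using kappa_add(2)[OF j, of \<gamma> "alpha i"] by (simp add: a' vu kj_def)
    moreover have "kappa j (\<lambda>k. \<gamma> k - alpha i k + alpha j k) = kj' * inverse u"
      using kappa_add(2)[OF j, of "\<lambda>k. \<gamma> k + alpha j k" "alpha i"] by (simp add: a' vu kj'_def algebra_simps)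
    ultimately have "whit_f j (?E w) = scale (c0 * (inverse kj * u) * (inverse kj' * u) ^ (j - 1)) (?F (?E w))"
      using whit_f_wt[OF has_wt_E[OF w i] j] by (simp add: c0_def)
    then have "scale c (whit_f j (whit_e i w)) = scale (c * ((1 - v\<^sup>2) * ki ^ (i - 1)) * (c0 * (inverse kj * u) * (inverse kj' * u) ^ (j - 1))) (?F (?E w))"
      unfolding whit_e_wt[OF w i] ki_def[symmetric] using j by (simp add: whit_f_linear mult.assoc)
    also have "c * ((1 - v\<^sup>2) * ki ^ (i - 1)) * (c0 * (inverse kj * u) * (inverse kj' * u) ^ (j - 1))
      = (1 - v\<^sup>2) * ki ^ (i - 1) * (c * (u * u ^ (j - 1))) * (c0 * inverse kj * inverse kj' ^ (j - 1))"
      by (simp only: power_mult_distrib mult_ac)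
    \<comment> \<open>One factor \<open>u\<close> comes from the K_j^(-1) to the right of F_j, the
      other j - 1 from the power to its left.\<close>
    also have "u * u ^ (j - 1) = u ^ j" using j by (cases j) auto
    also have "c * u ^ j = u ^ (i - 1)" using v_pow_comm_factor[OF i j] by (simp add: c_def u_def a_def)
    also have "(1 - v\<^sup>2) * ki ^ (i - 1) * u ^ (i - 1) * (c0 * inverse kj * inverse kj' ^ (j - 1)) = C"
      by (simp only: C_def power_mult_distrib mult_ac)
    finally show ?thesis .
  qed
  show ?thesis
  proof (cases "i = j")
    case False
    then show ?thesis using L R E_F[OF i j, of w] by (simp add: c_def)
  next
    case True
    have "E_F_w": "?E (?F w) = ?F (?E w) + scale ((ki - inverse ki) / (v - inverse v)) w"
      using E_F[OF i j, of w] True K_eigen[OF w i] by (simp add: ki_def scale_left_diff_distrib[symmetric])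
    have vv: "v - inverse v \<noteq> 0"
    proof
      assume "v - inverse v = 0"
      then have "v * v = 1" using v0 by (metis right_inverse eq_iff_diff_eq_0)
      then show False using q_ne_1 by (simp add: q_eq power2_eq_square)
    qed
    have c0: "c0 = v - inverse v" using v0 by (simp add: c0_def power2_eq_square field_simps)
    have "kj' = ki * u" using True kappa_add(1)[OF i, of \<gamma> "alpha j"] by (simp add: kj'_def ki_def u_def a_def)
    then have "C * ((ki - inverse ki) / (v - inverse v)) = (1 - v\<^sup>2) * (kj' ^ (i - 1) * inverse kj' ^ (i - 1)) * (c0 / (v - inverse v)) * (inverse ki * (ki - inverse ki))"
      using True by (simp add: C_def kj_def ki_def mult_ac)
    also have "kj' ^ (i - 1) * inverse kj' ^ (i - 1) = 1" using nz by (simp add: power_inverse)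
    also have "c0 / (v - inverse v) = 1" using vv c0 by simp
    also have "inverse ki * (ki - inverse ki) = 1 - inverse ki * inverse ki" using nz by (simp add: right_diff_distrib)
    \<comment> \<open>The 1 in the exponent compensates the factor q^(-1) that (rho, alpha_i) = 1
      contributes to z_i.\<close>
    also have "inverse ki * inverse ki = q powi (1 + form n (alpha i) \<gamma>) * z i"
    proof -
      have "q powi (1 + form n (alpha i) \<gamma>) * z i = q powi form n (alpha i) \<gamma> * inverse (vpow n vl (alpha i)) ^ 2"
        using z_eq[OF i] q0 by (simp add: z_var_def form_rho_alpha[OF i] power_int_add q_eq power_inverse)
      also have "q powi form n (alpha i) \<gamma> = (v powi form n (alpha i) \<gamma>)\<^sup>2"
        using v0 by (simp add: q_eq power_int_power power_int_power' mult.commute)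
      finally show ?thesis using v0 by (simp add: ki_def whit_scalar_def power_int_minus power2_eq_square mult_ac)
    qed
    finally have "C * ((ki - inverse ki) / (v - inverse v)) = (1 - q) * (1 - q powi (1 + form n (alpha i) \<gamma>) * z i)"
      by (simp add: q_eq)
    then show ?thesis using True L R E_F_w by (simp add: c_def scale_right_distrib)
  qed
qed

lemma hw_E: "i \<in> {1..n} \<Longrightarrow> op_act (gen (EE i)) hw = 0"
proof -
  assume i: "i \<in> {1..n}"
  let ?S = "{qcls n v (gen (EE i)) |i. i \<in> {1..n}} \<union> {qcls n v (gen (VV i) - const (vl i)) |i. i \<in> {0..n}}"
  have "qcls n v (gen (EE i)) \<in> left_ideal_gen (quantum_gl n v) ?S"
    unfolding left_ideal_gen_def using i by blast
  then show ?thesis unfolding annihilator[symmetric] by (simp add: op_act_def)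
qed

lemma hw_wt: "has_wt (\<lambda>_. 0) hw"
  unfolding has_wt_def
proof (intro allI impI)
  fix k assume k: "k \<le> n"
  let ?S = "{qcls n v (gen (EE i)) |i. i \<in> {1..n}} \<union> {qcls n v (gen (VV i) - const (vl i)) |i. i \<in> {0..n}}"
  have "qcls n v (gen (VV k) - const (vl k)) \<in> left_ideal_gen (quantum_gl n v) ?S"
  proof -
    have "qcls n v (gen (VV k) - const (vl k)) \<in> ?S"
      using k by (intro UnI2 CollectI exI[of _ k]) simp
    then show ?thesis unfolding left_ideal_gen_def by blast
  qed
  then have "op_act (gen (VV k) - const (vl k)) hw = 0" unfolding annihilator[symmetric] by (simp add: op_act_def)
  then show "op_act (gen (VV k)) hw = scale (vl k * v powi - 0) hw"
    using k by (simp add: op_act_diff free_alg_closed op_act_const)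
qed

end

section \<open>Comparison of the Verma module with the model\<close>

context gt_model
begin

lemma gt_e_linear: "gt_e r (\<lambda>m. Y m + c * Z m) = (\<lambda>m. gt_e r Y m + c * gt_e r Z m)" "gt_e r (\<lambda>_. 0) = (\<lambda>_. 0)"
  by (auto simp: gt_e_def fun_eq_iff sum.distrib sum_distrib_left algebra_simps)

lemma gt_f_linear: "gt_f r (\<lambda>m. Y m + c * Z m) = (\<lambda>m. gt_f r Y m + c * gt_f r Z m)" "gt_f r (\<lambda>_. 0) = (\<lambda>_. 0)"
  by (auto simp: gt_f_def fun_eq_iff sum.distrib sum_distrib_left algebra_simps)

lemma gt_psi_linear: "gt_psi \<gamma> (\<lambda>m. Y m + c * Z m) = gt_psi \<gamma> Y + c * gt_psi \<gamma> Z" "gt_psi \<gamma> (\<lambda>_. 0) = 0"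
  by (simp_all add: gt_psi_def sum.distrib sum_distrib_left algebra_simps)

definition gt_vac :: "(nat \<Rightarrow> nat \<Rightarrow> nat) \<Rightarrow> 'a" where
  "gt_vac m = (if m = (\<lambda>_ _. 0) then 1 else 0)"

lemma gt_array_zero: "gt_array n (\<lambda>_ _. 0)" "wt n (\<lambda>_ _. 0) = (\<lambda>_. 0)" "gt_size (\<lambda>_ _. 0) = 0"
  by (auto simp: gt_array_def wt_def row_sum_def root_sum_def fun_eq_iff gt_size_def)

lemma gt_e_vac: "gt_e r gt_vac = (\<lambda>_. 0)"
proof -
  have "raise m k r \<noteq> (\<lambda>_ _. 0)" for m k by (metis Suc_neq_Zero raise_def upd2_def)
  then have "gt_vac (raise m k r) = 0" for m k by (simp only: gt_vac_def if_False)
  then show ?thesis by (simp add: gt_e_def fun_eq_iff)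
qed

lemma gt_f_at_zero: "r < n \<Longrightarrow> gt_f r Y (\<lambda>_ _. 0) = 0"
  using f_coeff_eq_0[OF gt_array_zero(1)] by (simp add: gt_f_def)

lemma gt_psi_vac: "gt_psi \<gamma> gt_vac = (if \<gamma> = (\<lambda>_. 0) then 1 else 0)"
proof -
  have "gt_psi \<gamma> gt_vac = (\<Sum>m | gt_array n m \<and> wt n m = \<gamma>. if m = (\<lambda>_ _. 0) then 1 else 0)"
    unfolding gt_psi_def gt_vac_def by (intro sum.cong) (auto simp: summand_zero)
  then show ?thesis using finite_wt[of n \<gamma>] gt_array_zero by auto
qed

lemma gt_f_support:
  assumes "\<And>m. Y m \<noteq> 0 \<Longrightarrow> gt_array n m \<and> wt n m = \<gamma>" "r < n" "gt_f r Y m \<noteq> 0"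
  shows "gt_array n m \<and> wt n m = (\<lambda>k. \<gamma> k + alpha (Suc r) k)"
proof -
  have m: "gt_array n m" using assms(3) by (auto simp: gt_f_def split: if_splits)
  then have "(\<Sum>k\<le>r. f_coeff (node q z m) r k * Y (lower m k r)) \<noteq> 0" using assms(3) by (simp add: gt_f_def)
  then obtain k where k: "k \<in> {..r}" "f_coeff (node q z m) r k * Y (lower m k r) \<noteq> 0" by (rule sum.not_neutral_contains_not_neutral)
  then have l: "0 < m k r" "wt n (lower m k r) = \<gamma>" using f_coeff_eq_0[OF m _ assms(2), of k] assms(1) by auto
  then have "wt n m = (\<lambda>k. \<gamma> k + alpha (Suc r) k)"
    using wt_raise[of k r n "lower m k r"] k(1) assms(2) by (simp add: raise_lower)
  then show ?thesis using m by simp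
qed

end

context verma_gt
begin

definition verma_word :: "nat list \<Rightarrow> 'm" where
  "verma_word w = foldr whit_f w hw"

definition gt_word :: "nat list \<Rightarrow> (nat \<Rightarrow> nat \<Rightarrow> nat) \<Rightarrow> 'a" where
  "gt_word w = foldr (\<lambda>i. gt_f (i - 1)) w gt_vac"

definition word_wt :: "nat list \<Rightarrow> weight" where
  "word_wt w = foldr (\<lambda>i \<gamma> k. \<gamma> k + alpha i k) w (\<lambda>_. 0)"

lemma word_simps [simp]:
  "verma_word [] = hw" "verma_word (i # w) = whit_f i (verma_word w)" "gt_word [] = gt_vac" "gt_word (i # w) = gt_f (i - 1) (gt_word w)"
  "word_wt [] = (\<lambda>_. 0)" "word_wt (i # w) = (\<lambda>k. word_wt w k + alpha i k)"
  by (simp_all add: verma_word_def gt_word_def word_wt_def)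

text \<open>
  Several words may have dependent images in the Verma module, so this is a relation; that it is a
  function follows only from the injectivity of the \<open>gt_e r\<close>.
\<close>

inductive gt_rel :: "'m \<Rightarrow> ((nat \<Rightarrow> nat \<Rightarrow> nat) \<Rightarrow> 'a) \<Rightarrow> bool" where
  zero: "gt_rel 0 (\<lambda>_. 0)"
| add: "gt_rel x Y \<Longrightarrow> set w \<subseteq> {1..n} \<Longrightarrow> gt_rel (x + scale c (verma_word w)) (\<lambda>m. Y m + c * gt_word w m)"

lemma gt_rel_word: "set w \<subseteq> {1..n} \<Longrightarrow> gt_rel (verma_word w) (gt_word w)"
  using gt_rel.add[OF gt_rel.zero, of w 1] by simp

lemma gt_rel_add: "gt_rel x' Y' \<Longrightarrow> gt_rel x Y \<Longrightarrow> gt_rel (x + scale c x') (\<lambda>m. Y m + c * Y' m)"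
proof (induction rule: gt_rel.induct)
  case (add x' Y' w d)
  have "gt_rel (x + scale c x' + scale (c * d) (verma_word w)) (\<lambda>m. (Y m + c * Y' m) + (c * d) * gt_word w m)"
    by (rule gt_rel.add) (use add in auto)
  then show ?case by (simp add: scale_right_distrib algebra_simps)
qed simp

lemma gt_rel_scale: "gt_rel x Y \<Longrightarrow> gt_rel (scale c x) (\<lambda>m. c * Y m)"
  using gt_rel_add[OF _ gt_rel.zero, of x Y c] by simp

lemma gt_rel_map:
  assumes "gt_rel x Y"
    and "A 0 = 0" "\<And>x y c. A (x + scale c y) = A x + scale c (A y)"
    and "A' (\<lambda>_. 0) = (\<lambda>_. 0)" "\<And>Y Z c. A' (\<lambda>m. Y m + c * Z m) = (\<lambda>m. A' Y m + c * A' Z m)"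
    and "\<And>w. set w \<subseteq> {1..n} \<Longrightarrow> gt_rel (A (verma_word w)) (A' (gt_word w))"
  shows "gt_rel (A x) (A' Y)"
  using assms(1)
proof (induction rule: gt_rel.induct)
  case zero show ?case unfolding assms(2,4) by (rule gt_rel.zero)
next
  case (add x Y w c)
  show ?case unfolding assms(3,5) by (rule gt_rel_add) (use add assms(6) in auto)
qed

lemma gt_rel_whit_f: "gt_rel x Y \<Longrightarrow> i \<in> {1..n} \<Longrightarrow> gt_rel (whit_f i x) (gt_f (i - 1) Y)"
  by (erule gt_rel_map) (use gt_rel_word[of "i # _"] in \<open>auto simp: whit_f_linear gt_f_linear\<close>)

lemma has_wt_verma_word: "set w \<subseteq> {1..n} \<Longrightarrow> has_wt (word_wt w) (verma_word w)"
  by (induction w) (auto simp: hw_wt has_wt_whit_f)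

lemma gt_word_support: "set w \<subseteq> {1..n} \<Longrightarrow> gt_word w m \<noteq> 0 \<Longrightarrow> gt_array n m \<and> wt n m = word_wt w"
proof (induction w arbitrary: m)
  case Nil
  then show ?case by (auto simp: gt_vac_def gt_array_zero split: if_splits)
next
  case (Cons i w)
  have "gt_array n m \<and> wt n m = (\<lambda>k. word_wt w k + alpha (Suc (i - 1)) k)"
    by (rule gt_f_support[where Y = "gt_word w"]) (use Cons in auto)
  then show ?case using Cons.prems(1) by simp
qed

text \<open>Induction on the word: e_i moves past the first letter by the same rule on both sides,
  and it kills both vacua.\<close>

lemma gt_rel_whit_e_word: "set w \<subseteq> {1..n} \<Longrightarrow> i \<in> {1..n} \<Longrightarrow> gt_rel (whit_e i (verma_word w)) (gt_e (i - 1) (gt_word w))"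
proof (induction w)
  case Nil
  have "whit_e i hw = 0" using whit_e_wt[OF hw_wt Nil(2)] hw_E[OF Nil(2)] by simp
  then show ?case using gt_rel.zero by (simp add: gt_e_vac)
next
  case (Cons j w)
  then have j: "j \<in> {1..n}" and w: "set w \<subseteq> {1..n}" and i: "i \<in> {1..n}" by auto
  define c where "c = comm_factor q (i - 1) (j - 1)"
  define H where "H = (if i = j then (1 - q) * (1 - q powi (1 + form n (alpha i) (word_wt w)) * z i) else 0)"
  have "gt_e (i - 1) (gt_word (j # w)) = (\<lambda>m. c * gt_f (j - 1) (gt_e (i - 1) (gt_word w)) m + H * gt_word w m)"
  proof
    fix m
    show "gt_e (i - 1) (gt_word (j # w)) m = c * gt_f (j - 1) (gt_e (i - 1) (gt_word w)) m + H * gt_word w m"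
    proof (cases "gt_array n m")
      case True
      have "i - 1 = j - 1 \<longleftrightarrow> i = j" "Suc (i - 1) = i" using i j by auto
      \<comment> \<open>The scalar in \<open>gt_e_f\<close> depends on the weight of the array, the
        one in \<open>whit_e_f\<close> on the weight of the word. They agree wherever
        \<open>gt_word w\<close> is nonzero.\<close>
      moreover have "gt_word w m = 0 \<or> wt n m = word_wt w" using gt_word_support[OF w] by blast
      ultimately show ?thesis
        using gt_e_f[OF True, of "i - 1" "j - 1" "gt_word w"] i j by (auto simp: c_def H_def)
    next
      case False
      then have "gt_word w m = 0" using gt_word_support[OF w] by blast
      then show ?thesis using False by (simp add: gt_e_def gt_f_def)
    qed
  qed
  moreover have "whit_e i (verma_word (j # w)) = scale c (whit_f j (whit_e i (verma_word w))) + scale H (verma_word w)"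
    using whit_e_f[OF has_wt_verma_word[OF w] i j] by (simp add: c_def H_def)
  moreover have "gt_rel (scale c (whit_f j (whit_e i (verma_word w))) + scale H (verma_word w)) (\<lambda>m. c * gt_f (j - 1) (gt_e (i - 1) (gt_word w)) m + H * gt_word w m)"
    by (intro gt_rel_add gt_rel_scale gt_rel_whit_f gt_rel_word w j Cons.IH i)
  ultimately show ?case by simp
qed

lemma gt_rel_whit_e: "gt_rel x Y \<Longrightarrow> i \<in> {1..n} \<Longrightarrow> gt_rel (whit_e i x) (gt_e (i - 1) Y)"
  by (erule gt_rel_map) (simp_all add: whit_e_linear gt_e_linear gt_rel_whit_e_word del: One_nat_def)

section \<open>Every vector of the Verma module is represented\<close>

definition representable :: "'m \<Rightarrow> bool" where
  "representable x \<longleftrightarrow> (\<exists>Y. gt_rel x Y)"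

lemma representable_zero: "representable 0"
  using gt_rel.zero by (auto simp: representable_def)

lemma representable_add: "representable x \<Longrightarrow> representable y \<Longrightarrow> representable (x + scale c y)"
  using gt_rel_add by (fastforce simp: representable_def)

lemma representable_scale: "representable y \<Longrightarrow> representable (scale c y)"
  using representable_add[OF representable_zero, of y c] by simp

lemma representable_word: "set w \<subseteq> {1..n} \<Longrightarrow> representable (verma_word w)"
  using gt_rel_word by (auto simp: representable_def)

lemma representable_op_act:
  assumes p: "p \<in> carrier (free_alg n)" and w: "\<And>w. set w \<subseteq> {1..n} \<Longrightarrow> representable (op_act p (verma_word w))" and x: "representable x"
  shows "representable (op_act p x)"
proof -
  obtain Y where "gt_rel x Y" using x by (auto simp: representable_def)
  then show ?thesis
    by (induction rule: gt_rel.induct)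
      (auto simp: op_act_right_zero op_act_right_add op_act_scale p representable_zero w intro: representable_add)
qed

text \<open>A word is a weight vector, so each generator acts on it as a multiple of
  \<open>whit_e\<close>, \<open>whit_f\<close> or the identity, all of which preserve
  representability.\<close>

lemma representable_gen:
  assumes g: "g \<in> gl_gens n" and x: "representable x"
  shows "representable (op_act (gen g) x)"
proof (rule representable_op_act[OF free_alg_gen[OF g] _ x])
  fix w assume w: "set w \<subseteq> {1..n}"
  note wt = has_wt_verma_word[OF w]
  consider i where "g = EE i" "i \<in> {1..n}" | i where "g = FF i" "i \<in> {1..n}"
    | i where "g = VV i" "i \<le> n" | i where "g = VI i" "i \<le> n"
    using g by (auto simp: gl_gens_def)
  then show "representable (op_act (gen g) (verma_word w))"
  proof cases
    case 1
    define c where "c = (1 - v\<^sup>2) * kappa i (word_wt w) ^ (i - 1)"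
    have c: "c \<noteq> 0" using kappa_nz[OF 1(2)] q_ne_1 by (simp add: c_def q_eq)
    have "whit_e i (verma_word w) = scale c (op_act (gen g) (verma_word w))"
      using whit_e_wt[OF wt 1(2)] 1(1) by (simp only: c_def)
    then have "op_act (gen g) (verma_word w) = scale (inverse c) (whit_e i (verma_word w))" using c by simp
    then show ?thesis using gt_rel_whit_e_word[OF w 1(2)] by (auto simp: representable_def intro: representable_scale[unfolded representable_def])
  next
    case 2
    define c where "c = v * (1 - (inverse v)\<^sup>2) * inverse (kappa i (word_wt w)) * inverse (kappa i (\<lambda>k. word_wt w k + alpha i k)) ^ (i - 1)"
    have "(inverse v)\<^sup>2 \<noteq> 1" using q_ne_1 by (simp add: q_eq power_inverse)
    then have c: "c \<noteq> 0" using kappa_nz[OF 2(2)] v0 by (simp add: c_def)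
    have "verma_word (i # w) = scale c (op_act (gen g) (verma_word w))"
      using whit_f_wt[OF wt 2(2)] 2(1) by (simp only: c_def word_simps)
    then have "op_act (gen g) (verma_word w) = scale (inverse c) (verma_word (i # w))" using c by (simp del: word_simps)
    then show ?thesis using 2 w by (simp add: representable_scale representable_word del: word_simps)
  next
    case 3
    then show ?thesis using wt w by (simp add: has_wt_def representable_scale representable_word)
  next
    case 4
    then show ?thesis using has_wt_VI[OF wt] w by (simp add: representable_scale representable_word)
  qed
qed

text \<open>The highest weight vector generates the module, so it is enough to apply monomials of
  the free algebra to it, one letter at a time.\<close>

lemma gt_rel_total: "\<exists>Y. gt_rel x Y"
proof -
  obtain p where p: "p \<in> carrier (free_alg n)" "x = op_act p hw"
    using generated[of x] qcls_surj unfolding op_act_def by blast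
  have word: "representable (op_act (Poly_Mapping.single (Word l) c) hw) \<and> Poly_Mapping.single (Word l) c \<in> carrier (free_alg n)"
    if "set l \<subseteq> gl_gens n" for l c
    using that
  proof (induction l)
    case Nil
    have "Poly_Mapping.single (Word []) c = const c" by (simp add: const_def zero_word_def)
    then show ?case using representable_scale[OF representable_word[of "[]"]] by (simp add: op_act_const free_alg_const)
  next
    case (Cons g l)
    have e: "Poly_Mapping.single (Word (g # l)) c = gen g * Poly_Mapping.single (Word l) c"
      by (simp add: gen_def mult_single plus_word_def)
    have g: "g \<in> gl_gens n" using Cons by simp
    have A: "representable (op_act (Poly_Mapping.single (Word l) c) hw)"
      and B: "Poly_Mapping.single (Word l) c \<in> carrier (free_alg n)"
      using Cons by auto
    show ?case unfolding e
      using representable_gen[OF g A] by (simp only: op_act_mult[OF free_alg_gen[OF g] B] free_alg_mult[OF free_alg_gen[OF g] B] simp_thms)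
  qed
  have "representable (op_act (\<Sum>k\<in>A. Poly_Mapping.single k (f k)) hw) \<and> (\<Sum>k\<in>A. Poly_Mapping.single k (f k)) \<in> carrier (free_alg n)"
    if "finite A" "\<And>k. k \<in> A \<Longrightarrow> set (letters k) \<subseteq> gl_gens n" for A f
    using that
  proof (induction A)
    case empty
    then show ?case by (simp add: op_act_zero representable_zero free_alg_carrier[of 0])
  next
    case (insert k A)
    have "representable (op_act (Poly_Mapping.single k (f k)) hw)" "Poly_Mapping.single k (f k) \<in> carrier (free_alg n)"
      using word[of "letters k" "f k"] insert.prems by auto
    then show ?case using insert representable_add[of "op_act (Poly_Mapping.single k (f k)) hw" _ 1]
      by (simp add: op_act_add free_alg_add)
  qed
  from this[of "Poly_Mapping.keys p" "Poly_Mapping.lookup p"] have "representable (op_act p hw)"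
    using p(1) poly_mapping_sum_singles[of p] by (simp add: free_alg_carrier)
  then show ?thesis using p(2) by (simp add: representable_def)
qed

lemma kappa_eq_iff: "i \<in> {1..n} \<Longrightarrow> kappa i \<gamma> = kappa i \<delta> \<longleftrightarrow> form n (alpha i) \<gamma> = form n (alpha i) \<delta>"
proof
  assume i: "i \<in> {1..n}" and "kappa i \<gamma> = kappa i \<delta>"
  moreover have "vpow n vl (alpha i) \<noteq> 0" using kappa_nz[OF i] by (auto simp: whit_scalar_def)
  ultimately have "v powi - form n (alpha i) \<gamma> = v powi - form n (alpha i) \<delta>" by (simp add: whit_scalar_def)
  \<comment> \<open>Squaring passes from powers of v to powers of q, for which injectivity of the
    exponent is available.\<close>
  then have "(v powi - form n (alpha i) \<gamma>)\<^sup>2 = (v powi - form n (alpha i) \<delta>)\<^sup>2" by simp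
  moreover have "(v powi a)\<^sup>2 = q powi a" for a
    by (simp add: q_eq power2_eq_square power_int_mult_distrib)
  ultimately show "form n (alpha i) \<gamma> = form n (alpha i) \<delta>" by (simp add: powi_inj)
qed (simp add: whit_scalar_def)

end

section \<open>Adjointness and orthogonality of the Whittaker components\<close>

lemma form_root_sum: "form n (root_sum n d) \<gamma> = (\<Sum>i=1..n. int (d i) * form n (alpha i) \<gamma>)"
  unfolding form_def root_sum_def sum_distrib_right sum_distrib_left
  by (subst sum.swap) (simp add: mult.assoc)

lemma Qplus_zero: "(\<lambda>_. 0) \<in> Qplus n"
  unfolding Qplus_def by (rule image_eqI[of _ _ "\<lambda>_. 0"]) (auto simp: root_sum_def)

text \<open>Expanding one argument in simple roots gives (gamma, gamma) = 0, a vanishing sum of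
  squares of coordinates.\<close>

lemma Qplus_form_zero:
  assumes "\<gamma> \<in> Qplus n" "\<And>i. i \<in> {1..n} \<Longrightarrow> form n (alpha i) \<gamma> = 0"
  shows "\<gamma> = (\<lambda>_. 0)"
proof
  fix k
  obtain d where d: "\<gamma> = root_sum n d" using assms(1) by (auto simp: Qplus_def)
  have "form n \<gamma> \<gamma> = 0" using assms(2) form_root_sum[of n d \<gamma>] d by simp
  then have "\<forall>k\<in>{..n}. \<gamma> k * \<gamma> k = 0"
    unfolding form_def by (subst (asm) sum_nonneg_eq_0_iff) auto
  then show "\<gamma> k = 0" by (cases "k \<le> n") (auto simp: d root_sum_alt)
qed

locale whittaker_pairing = verma_gt scale n v act vl hw q z + D: verma_module scale' n "inverse v" act' "\<lambda>k. inverse (vl k)" hw'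
  for scale :: "'a::field \<Rightarrow> 'm::ab_group_add \<Rightarrow> 'm" and n :: nat and v :: 'a
    and act :: "'a free_poly set \<Rightarrow> 'm \<Rightarrow> 'm" and vl :: "nat \<Rightarrow> 'a" and hw :: 'm
    and q :: 'a and z :: "nat \<Rightarrow> 'a"
    and scale' :: "'a \<Rightarrow> 'k::ab_group_add \<Rightarrow> 'k" and act' :: "'a free_poly set \<Rightarrow> 'k \<Rightarrow> 'k" and hw' :: 'k +
  fixes \<theta> :: "weight \<Rightarrow> 'm" and \<theta>' :: "weight \<Rightarrow> 'k" and \<sigma> and B :: "'m \<Rightarrow> 'k \<Rightarrow> 'a"
  assumes whit: "whittaker_vector n v vl scale act hw \<theta>"
    and whit': "whittaker_vector n (inverse v) (\<lambda>k. inverse (vl k)) scale' act' hw' \<theta>'"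
    and anti: "shapovalov_anti_iso n v \<sigma>"
    and pairing: "shapovalov_pairing n v \<sigma> scale act hw scale' act' hw' B"
begin

lemma B_left: "B (x + y) w = B x w + B y w" "B (scale c x) w = c * B x w" "B 0 w = 0"
proof -
  have "Vector_Spaces.linear scale (*) (\<lambda>x. B x w)" using pairing by (simp add: shapovalov_pairing_def)
  then interpret L: Vector_Spaces.linear scale "(*)" "\<lambda>x. B x w" .
  show "B (x + y) w = B x w + B y w" "B (scale c x) w = c * B x w" "B 0 w = 0"
    by (rule L.add L.scale L.zero)+
qed

lemma B_right: "B w (scale' c x) = c * B w x" "B w 0 = 0"
proof -
  have "Vector_Spaces.linear scale' (*) (\<lambda>x. B w x)" using pairing by (simp add: shapovalov_pairing_def)
  then interpret L: Vector_Spaces.linear scale' "(*)" "\<lambda>x. B w x" .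
  show "B w (scale' c x) = c * B w x" "B w 0 = 0"
    by (rule L.scale L.zero)+
qed

lemma B_hw: "B hw hw' = 1"
  using pairing by (simp add: shapovalov_pairing_def)

lemma B_op_act: "p \<in> carrier (free_alg n) \<Longrightarrow> B (op_act p x) y = B x (act' (\<sigma> (qcls n v p)) y)"
  using pairing qcls_closed[of p n v] unfolding shapovalov_pairing_def op_act_def by blast

lemma B_F: "i \<in> {1..n} \<Longrightarrow> B (op_act (gen (FF i)) x) y = B x (D.op_act (gen (EE i)) y)"
  by (simp add: B_op_act gen_carrier shapovalov_anti_iso.F[OF anti] D.op_act_def)

lemma B_V: "k \<le> n \<Longrightarrow> B (op_act (gen (VV k)) x) y = B x (D.op_act (gen (VI k)) y)"
  using shapovalov_anti_iso.V[OF anti, of k] by (simp add: B_op_act gen_carrier D.op_act_def)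

text \<open>The anti-isomorphism is specified on v^(eps_k); inserting v^(eps_k) v^(-eps_k) = 1
  transfers the adjunction to the inverse.\<close>

lemma B_VI: "k \<le> n \<Longrightarrow> B (op_act (gen (VI k)) x) y = B x (D.op_act (gen (VV k)) y)"
  using B_V[of k "op_act (gen (VI k)) x" "D.op_act (gen (VV k)) y"] by (simp add: V_VI D.VI_V)

lemma B_Kinv: "i \<in> {1..n} \<Longrightarrow> B (op_act (Kinv_poly i) x) y = B x (D.op_act (Kpoly i) y)"
proof -
  assume "i \<in> {1..n}"
  then have i: "i \<le> n" "i - 1 \<le> n" by auto
  show ?thesis unfolding Kinv_poly_def Kpoly_def
    by (simp only: op_act_mult D.op_act_mult gen_carrier i B_V B_VI D.VI_V_commute)
qed

lemma B_Kinv_power: "i \<in> {1..n} \<Longrightarrow> B (op_act (Kinv_poly i ^ k) x) y = B x (D.op_act (Kpoly i ^ k) y)"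
proof (induction k arbitrary: x)
  case 0
  then show ?case by (simp add: op_act_one D.op_act_one)
next
  case (Suc k)
  note C = free_alg_power[OF K_carrier(1)[OF Suc.prems]] free_alg_power[OF K_carrier(2)[OF Suc.prems]] K_carrier[OF Suc.prems]
  have "B (op_act (Kinv_poly i ^ Suc k) x) y = B (op_act (Kinv_poly i ^ k) (op_act (Kinv_poly i) x)) y"
    unfolding power_Suc2 by (simp only: op_act_mult C)
  also have "\<dots> = B x (D.op_act (Kpoly i) (D.op_act (Kpoly i ^ k) y))"
    using Suc by (simp only: B_Kinv)
  also have "\<dots> = B x (D.op_act (Kpoly i ^ Suc k) y)"
    unfolding power_Suc by (simp only: D.op_act_mult C)
  finally show ?case .
qed

text \<open>The anti-isomorphism reverses the order, so the power of K_i^(-1) to the left of F_i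
  becomes the power of Kbar_i that acts first, as in the dual Whittaker equation.\<close>

lemma B_whit_f: "i \<in> {1..n} \<Longrightarrow> B (whit_f i x) y = v * (1 - (inverse v)\<^sup>2) *
    B x (D.op_act (Kpoly i) (D.op_act (gen (EE i) * Kpoly i ^ (i - 1)) y))"
  by (simp add: whit_f_def op_act_const op_act_mult D.op_act_mult free_alg_closed B_left B_Kinv B_Kinv_power B_F)

lemma theta_whit_e: "i \<in> {1..n} \<Longrightarrow> whit_e i (\<theta> \<gamma>) = \<theta> (\<lambda>k. \<gamma> k - alpha i k)"
proof -
  assume i: "i \<in> {1..n}"
  have "op_act (gen (EE i) * Kpoly i ^ (i - 1)) (\<theta> (\<lambda>k. (\<gamma> k - alpha i k) + alpha i k)) = scale (1 / (1 - v ^ 2)) (\<theta> (\<lambda>k. \<gamma> k - alpha i k))"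
  proof -
    have "\<forall>\<beta>. op_act (gen (EE i) * Kpoly i ^ (i - 1)) (\<theta> (\<lambda>k. \<beta> k + alpha i k)) = scale (1 / (1 - v ^ 2)) (\<theta> \<beta>)"
      using whit i unfolding whittaker_vector_def op_act_def by blast
    then show ?thesis by (rule spec)
  qed
  then show ?thesis using q_ne_1 i by (simp add: whit_e_def op_act_const_mult free_alg_closed q_eq)
qed

lemma theta'_E: "i \<in> {1..n} \<Longrightarrow> D.op_act (gen (EE i) * Kpoly i ^ (i - 1)) (\<theta>' \<gamma>)
    = scale' (1 / (1 - (inverse v) ^ 2)) (\<theta>' (\<lambda>k. \<gamma> k - alpha i k))"
proof -
  assume i: "i \<in> {1..n}"
  have "D.op_act (gen (EE i) * Kpoly i ^ (i - 1)) (\<theta>' (\<lambda>k. (\<gamma> k - alpha i k) + alpha i k))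
      = scale' (1 / (1 - (inverse v) ^ 2)) (\<theta>' (\<lambda>k. \<gamma> k - alpha i k))"
  proof -
    have "\<forall>\<beta>. D.op_act (gen (EE i) * Kpoly i ^ (i - 1)) (\<theta>' (\<lambda>k. \<beta> k + alpha i k)) = scale' (1 / (1 - (inverse v) ^ 2)) (\<theta>' \<beta>)"
      using whit' i unfolding whittaker_vector_def D.op_act_def by blast
    then show ?thesis by (rule spec)
  qed
  then show ?thesis by simp
qed

lemma theta'_K: "i \<in> {1..n} \<Longrightarrow> D.op_act (Kpoly i) (\<theta>' \<gamma>) = scale' (inverse (kappa i \<gamma>)) (\<theta>' \<gamma>)"
proof (cases "\<gamma> \<in> Qplus n")
  case True
  assume i: "i \<in> {1..n}"
  have "D.op_act (Kpoly i) (\<theta>' \<gamma>) = scale' (vpow n (\<lambda>k. inverse (vl k)) (alpha i) * inverse v powi - form n (alpha i) \<gamma>) (\<theta>' \<gamma>)"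
    using whit' True i unfolding whittaker_vector_def weight_space_def D.op_act_def by blast
  moreover have "vpow n (\<lambda>k. inverse (vl k)) (alpha i) * inverse v powi - form n (alpha i) \<gamma> = inverse (kappa i \<gamma>)"
    by (simp add: whit_scalar_def vpow_alpha[OF i] power_int_inverse)
  ultimately show ?thesis by simp
next
  case False
  assume i: "i \<in> {1..n}"
  have "\<theta>' \<gamma> = 0" using whit' False by (simp add: whittaker_vector_def)
  then show ?thesis using i by (simp add: D.op_act_right_zero K_carrier)
qed

lemma theta_Kinv: "i \<in> {1..n} \<Longrightarrow> \<gamma> \<in> Qplus n \<Longrightarrow> op_act (Kinv_poly i) (\<theta> \<gamma>) = scale (inverse (kappa i \<gamma>)) (\<theta> \<gamma>)"
proof -
  assume i: "i \<in> {1..n}" and \<gamma>: "\<gamma> \<in> Qplus n"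
  have K: "op_act (Kpoly i) (\<theta> \<gamma>) = scale (kappa i \<gamma>) (\<theta> \<gamma>)"
    using whit \<gamma> i unfolding whittaker_vector_def weight_space_def op_act_def whit_scalar_def by blast
  have n: "i \<le> n" "i - 1 \<le> n" using i by auto
  have "op_act (Kinv_poly i) (op_act (Kpoly i) (\<theta> \<gamma>)) = \<theta> \<gamma>"
    unfolding Kinv_poly_def Kpoly_def
    by (simp only: op_act_mult gen_carrier n free_alg_mult VI_V_commute[symmetric] V_VI VI_V)
  then have "scale (kappa i \<gamma>) (op_act (Kinv_poly i) (\<theta> \<gamma>)) = \<theta> \<gamma>"
    using i by (simp add: K op_act_scale K_carrier)
  then have "scale (inverse (kappa i \<gamma>)) (scale (kappa i \<gamma>) (op_act (Kinv_poly i) (\<theta> \<gamma>))) = scale (inverse (kappa i \<gamma>)) (\<theta> \<gamma>)" by simp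
  then show ?thesis using kappa_nz[OF i] by simp
qed

lemma theta_zero: "\<theta> (\<lambda>_. 0) = hw" "\<theta>' (\<lambda>_. 0) = hw'"
  using whit whit' by (simp_all add: whittaker_vector_def)

lemma theta_outside: "\<gamma> \<notin> Qplus n \<Longrightarrow> \<theta> \<gamma> = 0" "\<gamma> \<notin> Qplus n \<Longrightarrow> \<theta>' \<gamma> = 0"
  using whit whit' by (simp_all add: whittaker_vector_def)

text \<open>Adjointness of K_i^(-1) and Kbar_i forces equal eigenvalues wherever the pairing does
  not vanish.\<close>

lemma theta_orthogonal:
  assumes "\<gamma> \<in> Qplus n" "\<delta> \<in> Qplus n" "B (\<theta> \<gamma>) (\<theta>' \<delta>) \<noteq> 0" "i \<in> {1..n}"
  shows "form n (alpha i) \<gamma> = form n (alpha i) \<delta>"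
proof -
  have "inverse (kappa i \<gamma>) * B (\<theta> \<gamma>) (\<theta>' \<delta>) = inverse (kappa i \<delta>) * B (\<theta> \<gamma>) (\<theta>' \<delta>)"
    using B_Kinv[OF assms(4), of "\<theta> \<gamma>" "\<theta>' \<delta>"] assms by (simp add: theta_Kinv theta'_K B_left B_right)
  then have "kappa i \<gamma> = kappa i \<delta>" using assms(3) by simp
  then show ?thesis using kappa_eq_iff[OF assms(4)] by blast
qed

text \<open>A nonzero gamma in \<open>Qplus n\<close> pairs nontrivially with some alpha_i, so
  orthogonality applies; outside \<open>Qplus n\<close> the component is 0.\<close>

lemma B_hw_theta': "B hw (\<theta>' \<gamma>) = (if \<gamma> = (\<lambda>_. 0) then 1 else 0)"
proof (cases "\<gamma> \<in> Qplus n \<and> \<gamma> \<noteq> (\<lambda>_. 0)")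
  case True
  then obtain i where "i \<in> {1..n}" "form n (alpha i) \<gamma> \<noteq> 0" using Qplus_form_zero by blast
  moreover have "form n (alpha i) (\<lambda>_. 0) = 0" for i by (simp add: form_def)
  ultimately have "B hw (\<theta>' \<gamma>) = 0"
    using theta_orthogonal[of "\<lambda>_. 0" \<gamma> i] True Qplus_zero by (metis theta_zero(1))
  then show ?thesis using True by simp
next
  case False
  then show ?thesis
    by (cases "\<gamma> = (\<lambda>_. 0)") (simp_all add: theta_zero B_hw theta_outside B_right)
qed

lemma B_theta_hw': "B (\<theta> \<gamma>) hw' = (if \<gamma> = (\<lambda>_. 0) then 1 else 0)"
proof (cases "\<gamma> \<in> Qplus n \<and> \<gamma> \<noteq> (\<lambda>_. 0)")
  case True
  then obtain i where "i \<in> {1..n}" "form n (alpha i) \<gamma> \<noteq> 0" using Qplus_form_zero by blast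
  moreover have "form n (alpha i) (\<lambda>_. 0) = 0" for i by (simp add: form_def)
  ultimately have "B (\<theta> \<gamma>) hw' = 0"
    using theta_orthogonal[of \<gamma> "\<lambda>_. 0" i] True Qplus_zero by (metis theta_zero(2))
  then show ?thesis using True by simp
next
  case False
  then show ?thesis
    by (cases "\<gamma> = (\<lambda>_. 0)") (simp_all add: theta_zero B_hw theta_outside B_left)
qed

section \<open>The normalized functional and its evaluation in the model\<close>

definition J_norm :: "weight \<Rightarrow> 'a" where
  "J_norm \<gamma> = v powi (- (form n \<gamma> \<gamma> div 2)) * vpow n vl \<gamma>"

text \<open>Passing to gamma - alpha_i lowers half the norm by (alpha_i, gamma) - 1. The eigenvalue
  of K_i at gamma - alpha_i accounts for (alpha_i, gamma) - 2 and for (lambda, alpha_i); the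
  explicit \<open>v\<close> supplies the remaining power.\<close>

lemma J_norm_step: "i \<in> {1..n} \<Longrightarrow> J_norm \<gamma> * (v * inverse (kappa i (\<lambda>k. \<gamma> k - alpha i k))) = J_norm (\<lambda>k. \<gamma> k - alpha i k)"
proof -
  assume i: "i \<in> {1..n}"
  let ?d = "\<lambda>k. \<gamma> k - alpha i k"
  have sym: "form n \<beta> \<delta> = form n \<delta> \<beta>" for \<beta> \<delta> by (simp add: form_def mult.commute)
  have fd: "form n (alpha i) ?d = form n (alpha i) \<gamma> - 2"
    using form_alpha_alpha[OF i i] i by (simp add: form_alpha)
  have "form n \<gamma> \<gamma> = form n ?d ?d + 2 * form n (alpha i) \<gamma> - form n (alpha i) (alpha i)"
    unfolding form_def by (simp add: sum_distrib_left sum_subtractf[symmetric] sum.distrib[symmetric] algebra_simps)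
  then have "form n \<gamma> \<gamma> = form n ?d ?d + 2 * (form n (alpha i) \<gamma> - 1)"
    using form_alpha_alpha[OF i i] by simp
  then have f2: "form n \<gamma> \<gamma> div 2 = form n ?d ?d div 2 + (form n (alpha i) \<gamma> - 1)" by simp
  have "vpow n vl \<gamma> = (\<Prod>k\<le>n. vl k powi ?d k * vl k powi alpha i k)"
    unfolding vpow_def using vl0 by (intro prod.cong) (auto simp flip: power_int_add)
  then have vp: "vpow n vl \<gamma> = vpow n vl ?d * vpow n vl (alpha i)" by (simp add: vpow_def prod.distrib)
  have nz: "vpow n vl (alpha i) \<noteq> 0" using kappa_nz[OF i] by (auto simp: whit_scalar_def)
  have "v powi - (a + (f - 1)) * (V * W) * (v * inverse (W * v powi - (f - 2))) = v powi - a * V" if "W \<noteq> 0" for a f V W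
  proof -
    have e: "v powi - (a + (f - 1)) = v powi - a * v powi - (f - 2) * inverse v"
    proof -
      have "- (a + (f - 1)) = (- a) + (- (f - 2)) + (- 1)" by simp
      moreover have "v powi (- 1) = inverse v" by (simp add: power_int_minus)
      ultimately show ?thesis using v0 by (simp only: power_int_add simp_thms)
    qed
    have "(A * P * inverse v) * (V * W) * (v * inverse (W * P)) = A * V" if "P \<noteq> 0" for A P
      using that \<open>W \<noteq> 0\<close> v0 by (simp add: field_simps)
    then show ?thesis unfolding e using v0 by (simp only: power_int_eq_0_iff simp_thms)
  qed
  from this[OF nz] show ?thesis unfolding J_norm_def f2 vp whit_scalar_def fd by blast
qed

lemma B_whit_f_theta': "i \<in> {1..n} \<Longrightarrow> J_norm \<gamma> * B (whit_f i x) (\<theta>' \<gamma>) = J_norm (\<lambda>k. \<gamma> k - alpha i k) * B x (\<theta>' (\<lambda>k. \<gamma> k - alpha i k))"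
proof -
  assume i: "i \<in> {1..n}"
  have "(inverse v)\<^sup>2 \<noteq> 1" using q_ne_1 by (simp add: q_eq power_inverse)
  then have "B (whit_f i x) (\<theta>' \<gamma>) = v * inverse (kappa i (\<lambda>k. \<gamma> k - alpha i k)) * B x (\<theta>' (\<lambda>k. \<gamma> k - alpha i k))"
    unfolding B_whit_f[OF i] theta'_E[OF i] D.op_act_scale[OF K_carrier(1)[OF i]] theta'_K[OF i] B_right by simp
  then show ?thesis unfolding J_norm_step[OF i, of \<gamma>, symmetric] by (simp add: mult_ac)
qed

text \<open>On words both sides obey the same recursion: removing the first letter i replaces gamma
  by gamma - alpha_i. The base case compares the two vacua.\<close>

lemma gt_rel_psi: "gt_rel x Y \<Longrightarrow> J_norm \<gamma> * B x (\<theta>' \<gamma>) = gt_psi \<gamma> Y"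
proof (induction rule: gt_rel.induct)
  case (add x Y w c)
  have "J_norm \<gamma> * B (verma_word w) (\<theta>' \<gamma>) = gt_psi \<gamma> (gt_word w)"
    using add.hyps(2)
  proof (induction w arbitrary: \<gamma>)
    case Nil
    have "J_norm (\<lambda>_. 0) = 1" by (simp add: J_norm_def form_def vpow_def)
    then show ?case by (simp add: B_hw_theta' gt_psi_vac)
  next
    case (Cons i w)
    then have i: "i \<in> {1..n}" "Suc (i - 1) = i" "i - 1 < n" by auto
    show ?case using B_whit_f_theta'[OF i(1), of \<gamma> "verma_word w"] gt_psi_gt_f[OF i(3), of \<gamma> "gt_word w"] Cons by (simp add: i(2))
  qed
  then show ?case using add.IH by (simp add: B_left gt_psi_linear algebra_simps)
qed (simp add: B_left gt_psi_linear)

text \<open>On a nonempty word both sides are 0, since the zero array cannot be lowered and the dual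
  highest weight vector is killed by every Ebar_i.\<close>

lemma gt_rel_vac: "gt_rel x Y \<Longrightarrow> B x hw' = Y (\<lambda>_ _. 0)"
proof (induction rule: gt_rel.induct)
  case (add x Y w c)
  have "B (verma_word w) hw' = gt_word w (\<lambda>_ _. 0)"
  proof (cases w)
    case Nil then show ?thesis by (simp add: B_hw gt_vac_def)
  next
    case (Cons i w')
    then have i: "i \<in> {1..n}" "i - 1 < n" using add.hyps(2) by auto
    \<comment> \<open>The dual Whittaker equation sends the component of index 0, which is
      \<open>hw'\<close>, to the one of index -alpha_i, and this index lies outside
      \<open>Qplus n\<close>.\<close>
    have "\<theta>' (\<lambda>k. 0 - alpha i k) = 0"
    proof (rule theta_outside)
      show "(\<lambda>k. 0 - alpha i k) \<notin> Qplus n"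
      proof
        assume "(\<lambda>k. 0 - alpha i k) \<in> Qplus n"
        then obtain d where d: "(\<lambda>k. 0 - alpha i k) = root_sum n d" by (auto simp: Qplus_def)
        then have "root_sum n (d(i := Suc (d i))) = root_sum n (\<lambda>_. 0)"
          unfolding root_sum_Suc[OF i(1)] d[symmetric] by (simp add: root_sum_def)
        from root_sum_inj[OF this i(1)] show False by simp
      qed
    qed
    then have "B (whit_f i (verma_word w')) hw' = 0"
      using i(1) theta'_E[OF i(1), of "\<lambda>_. 0"] by (simp add: theta_zero B_whit_f D.op_act_right_zero K_carrier B_right)
    then show ?thesis using Cons i(2) by (simp add: gt_f_at_zero)
  qed
  then show ?case using add.IH by (simp add: B_left)
qed (simp add: B_left)

text \<open>Induction on the size of \<open>m\<close>, for all representatives \<open>Y\<close> at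
  once, because \<open>gt_e r Y\<close> is just some representative of the component at gamma -
  alpha_{r+1}. By induction every \<open>gt_e r\<close> kills the difference of \<open>Y\<close> and
  the indicator of weight gamma at size N, and joint injectivity gives 0 at size N + 1.\<close>

lemma theta_coefficients:
  "gt_rel (\<theta> \<gamma>) Y \<Longrightarrow> gt_array n m \<Longrightarrow> Y m = (if wt n m = \<gamma> then 1 else 0)"
proof (induction "gt_size m" arbitrary: \<gamma> Y m)
  case 0
  then have "m = (\<lambda>_ _. 0)" by (intro gt_size_zero) auto
  then show ?case using gt_rel_vac[OF 0(2)]
    by (cases "\<gamma> = (\<lambda>_. 0)") (simp_all add: B_theta_hw' gt_array_zero eq_commute[of "\<lambda>_. 0" \<gamma>])
next
  case (Suc N)
  let ?W = "\<lambda>m. if gt_array n m \<and> wt n m = \<gamma> then 1 else (0 :: 'a)"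
  have "Y m + (- 1) * ?W m = 0"
  proof (rule gt_e_jointly_injective[of N "\<lambda>m. Y m + (- 1) * ?W m"])
    fix r m' assume r: "r < n" and m': "gt_array n m'" "gt_size m' = N"
    have "gt_rel (\<theta> (\<lambda>k. \<gamma> k - alpha (Suc r) k)) (gt_e r Y)"
      using gt_rel_whit_e[OF Suc.prems(1), of "Suc r"] theta_whit_e[of "Suc r" \<gamma>] r by simp
    then have "gt_e r Y m' = (if wt n m' = (\<lambda>k. \<gamma> k - alpha (Suc r) k) then 1 else 0)"
      by (rule Suc.hyps(1)[OF m'(2)[symmetric] _ m'(1)])
    then show "gt_e r (\<lambda>m. Y m + (- 1) * ?W m) m' = 0"
      unfolding gt_e_linear using gt_e_indicator[OF r m'(1), of \<gamma>] by simp
  qed (use Suc in auto)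
  then show ?case using Suc.prems(2) by simp
qed

lemma J_eq_sum_summand: "whittaker_J n v vl B \<theta> \<theta>' d = (\<Sum>m\<in>arrays n d. summand m)"
proof -
  define \<beta> where "\<beta> = root_sum n d"
  obtain Y where Y: "gt_rel (\<theta> \<beta>) Y" using gt_rel_total by blast
  have "whittaker_J n v vl B \<theta> \<theta>' d = J_norm \<beta> * B (\<theta> \<beta>) (\<theta>' \<beta>)"
    by (simp add: whittaker_J_def Let_def \<beta>_def J_norm_def)
  also have "\<dots> = gt_psi \<beta> Y" by (rule gt_rel_psi[OF Y])
  also have "\<dots> = (\<Sum>m | gt_array n m \<and> wt n m = \<beta>. summand m)"
    unfolding gt_psi_def by (intro sum.cong) (auto simp: theta_coefficients[OF Y])
  finally show ?thesis by (simp add: arrays_wt \<beta>_def)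
qed

end

lemma (in gt_model) summand_arrays:
  assumes m: "m \<in> arrays n d"
  shows "summand m = (- 1) powi ((\<Sum>i=1..n. int (d i)) - (\<Sum>i<n. int (m i i)))
       * q powi p_exp n m
       * (\<Prod>j=1..n. z j ^ (\<Sum>k<j. \<Sum>i=j+1..n. m k (i - 1)))
       * (\<Prod>(k, i) \<in> {(k, i). k < i \<and> i \<le> n}.
            1 / qpoch q q (m k (i - 1) - m k i))
       * (\<Prod>(k, l, i) \<in> {(k, l, i). k < l \<and> l < i \<and> i \<le> n}.
            1 / qpoch q (q powi (int (m k i) - int (m l (i - 1))) * zprod z k l)
                  (m k (i - 1) - m k i))
       * (\<Prod>(k, l, i) \<in> {(k, l, i). k < l \<and> l \<le> i \<and> i \<le> n}.
            1 / qpoch q (q powi (int (m k i) - int (m l i) + 1) * zprod z k l)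
                  (m k (i - 1) - m k i))"
proof -
  have v: "gt_array n m" and d: "\<And>i. i \<in> {1..n} \<Longrightarrow> row_sum m i = d i"
    using m by (auto simp: arrays_alt)
  have "(\<Sum>i=1..n. int (row_sum m i)) = (\<Sum>i=1..n. int (d i))" using d by (intro sum.cong) auto
  moreover have "prod_A m = (\<Prod>(k, i) \<in> {(k, i). k < i \<and> i \<le> n}. 1 / qpoch q q (m k (i - 1) - m k i))"
    unfolding prod_A_def by (intro prod.cong refl) (auto intro!: factor_A_eq[OF v, symmetric] simp del: One_nat_def)
  moreover have "prod_B m = (\<Prod>(k, l, i) \<in> {(k, l, i). k < l \<and> l < i \<and> i \<le> n}.
            1 / qpoch q (q powi (int (m k i) - int (m l (i - 1))) * zprod z k l) (m k (i - 1) - m k i))"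
    unfolding prod_B_def by (intro prod.cong refl) (auto intro!: factor_B_eq[OF v, symmetric] simp del: One_nat_def)
  moreover have "prod_C m = (\<Prod>(k, l, i) \<in> {(k, l, i). k < l \<and> l \<le> i \<and> i \<le> n}.
            1 / qpoch q (q powi (int (m k i) - int (m l i) + 1) * zprod z k l) (m k (i - 1) - m k i))"
    unfolding prod_C_def by (intro prod.cong refl) (auto intro!: factor_C_eq[OF v, symmetric] simp del: One_nat_def)
  ultimately show ?thesis by (simp only: summand_def sgn_part_def z_part_def)
qed

section \<open>Genericity\<close>

definition monom_eval :: "(nat \<Rightarrow> 'a::field_char_0) \<Rightarrow> (nat \<Rightarrow>\<^sub>0 nat) \<Rightarrow> 'a" where
  "monom_eval x m = (\<Prod>i \<in> Poly_Mapping.keys m. x i ^ Poly_Mapping.lookup m i)"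

text \<open>The difference of the two monomials is a nonzero polynomial that would vanish at
  \<open>x\<close>.\<close>

lemma alg_independent_monomials:
  assumes "alg_independent I x" "Poly_Mapping.keys m1 \<subseteq> I" "Poly_Mapping.keys m2 \<subseteq> I" "m1 \<noteq> m2"
  shows "monom_eval x m1 \<noteq> monom_eval x m2"
proof
  assume e: "monom_eval x m1 = monom_eval x m2"
  define p :: "(nat \<Rightarrow>\<^sub>0 nat) \<Rightarrow>\<^sub>0 rat" where "p = Poly_Mapping.single m1 1 - Poly_Mapping.single m2 1"
  have lk: "Poly_Mapping.lookup p m = (if m = m1 then 1 else if m = m2 then - 1 else 0)" for m
    using assms(4) by (auto simp: p_def lookup_minus lookup_single when_def)
  have keys: "Poly_Mapping.keys p = {m1, m2}" using assms(4) by (auto simp: in_keys_iff lk split: if_splits)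
  have "mpoly_eval x p = 0"
    unfolding mpoly_eval_def keys using assms(4) e by (simp add: lk monom_eval_def)
  moreover have "\<forall>m\<in>Poly_Mapping.keys p. Poly_Mapping.keys m \<subseteq> I" using assms keys by simp
  ultimately have "p = 0" using assms(1) unfolding alg_independent_def by blast
  then show False using keys by simp
qed

lemma alg_independent_monomial_nz:
  assumes "alg_independent I x" "Poly_Mapping.keys m \<subseteq> I"
  shows "monom_eval x m \<noteq> 0"
proof
  assume e: "monom_eval x m = 0"
  define p :: "(nat \<Rightarrow>\<^sub>0 nat) \<Rightarrow>\<^sub>0 rat" where "p = Poly_Mapping.single m 1"
  have "mpoly_eval x p = 0" using e by (simp add: mpoly_eval_def p_def monom_eval_def)
  moreover have "\<forall>m\<in>Poly_Mapping.keys p. Poly_Mapping.keys m \<subseteq> I" using assms by (simp add: p_def)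
  ultimately have "p = 0" using assms(1) unfolding alg_independent_def by blast
  then have "Poly_Mapping.lookup p m = 0" by simp
  then show False by (simp add: p_def)
qed

lemma monom_eval_two:
  assumes "i \<noteq> j"
  shows "monom_eval x (Poly_Mapping.single i a + Poly_Mapping.single j b) = x i ^ a * x j ^ b"
proof -
  let ?m = "Poly_Mapping.single i a + Poly_Mapping.single j b"
  have "Poly_Mapping.keys ?m \<subseteq> {i, j}" using Poly_Mapping.keys_add[of "Poly_Mapping.single i a" "Poly_Mapping.single j b"]
    by (auto split: if_splits)
  then have "monom_eval x ?m = (\<Prod>k\<in>{i, j}. x k ^ Poly_Mapping.lookup ?m k)"
    unfolding monom_eval_def by (intro prod.mono_neutral_left) (auto simp: in_keys_iff)
  then show ?thesis using assms by (simp add: lookup_add lookup_single)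
qed

context
  fixes n :: nat and v :: "'a::field_char_0" and vl :: "nat \<Rightarrow> 'a"
  assumes gen: "generic_weight n v vl"
begin

lemma generic_v: "v \<noteq> 0"
  using alg_independent_monomial_nz[OF gen[unfolded generic_weight_def], of "Poly_Mapping.single 0 1"]
  by (simp add: monom_eval_def)

lemma generic_vl: "k \<le> n \<Longrightarrow> vl k \<noteq> 0"
  using alg_independent_monomial_nz[OF gen[unfolded generic_weight_def], of "Poly_Mapping.single (Suc k) 1"]
  by (simp add: monom_eval_def)

text \<open>The monomials differ in the exponent of \<open>vl k\<close>, which is 2 on the left and
  0 on the right.\<close>

lemma generic_powers:
  assumes "k \<le> n" "l \<le> n" "k \<noteq> l"
  shows "v ^ a * vl k ^ 2 \<noteq> v ^ b * vl l ^ 2"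
proof -
  let ?m = "\<lambda>a k. Poly_Mapping.single 0 a + Poly_Mapping.single (Suc k) 2 :: nat \<Rightarrow>\<^sub>0 nat"
  have keys: "Poly_Mapping.keys (?m a k) \<subseteq> {0..n+1}" if "k \<le> n" for a k
    using Poly_Mapping.keys_add[of "Poly_Mapping.single 0 a" "Poly_Mapping.single (Suc k) 2"] that
    by (auto split: if_splits)
  have "Poly_Mapping.lookup (?m a k) (Suc k) \<noteq> Poly_Mapping.lookup (?m b l) (Suc k)"
    using assms(3) by (simp add: lookup_add lookup_single)
  then have "?m a k \<noteq> ?m b l" by metis
  from alg_independent_monomials[OF gen[unfolded generic_weight_def] keys[OF assms(1)] keys[OF assms(2)] this]
  show ?thesis by (simp add: monom_eval_two)
qed

lemma generic_root: "v powi c = 1 \<Longrightarrow> c = 0"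
proof -
  assume c: "v powi c = 1"
  have no: "v ^ a \<noteq> 1" if "a > 0" for a :: nat
  proof -
    have "Poly_Mapping.single 0 a \<noteq> (0 :: nat \<Rightarrow>\<^sub>0 nat)" using that by (metis lookup_single_eq lookup_zero less_irrefl)
    then show ?thesis
      using alg_independent_monomials[OF gen[unfolded generic_weight_def], of "Poly_Mapping.single 0 a" 0] that
      by (simp add: monom_eval_def)
  qed
  show "c = 0"
  proof (rule ccontr)
    assume "c \<noteq> 0"
    then show False using c no[of "nat c"] no[of "nat (- c)"]
      by (cases "c > 0") (auto simp: power_int_def power_inverse)
  qed
qed

lemma gt_model_generic:
  assumes q: "q = v ^ 2" and z: "\<And>i. i \<in> {1..n} \<Longrightarrow> z i = z_var n v vl i"
  shows "gt_model n q z"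
proof
  have vq: "q powi c = v powi (2 * c)" for c
  proof -
    have "v powi (c + c) = v powi c * v powi c" by (rule power_int_add) (simp add: generic_v)
    then show ?thesis by (simp only: q power2_eq_square power_int_mult_distrib mult_2)
  qed
  have zi: "z i = (vl i)\<^sup>2 * inverse ((vl (i - 1))\<^sup>2 * q)" if "i \<in> {1..n}" for i
  proof -
    have "vl (i - 1) \<noteq> 0" "vl i \<noteq> 0" using that by (auto intro!: generic_vl)
    then show ?thesis using that generic_v
      by (simp add: z z_var_def vpow_alpha form_rho_alpha q field_simps power2_eq_square)
  qed
  show "q \<noteq> 0" using generic_v q by simp
  show "z j \<noteq> 0" if "j \<in> {1..n}" for j
  proof -
    have "vl (j - 1) \<noteq> 0" "vl j \<noteq> 0" using that by (auto intro!: generic_vl)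
    then show ?thesis using zi[OF that] generic_v q by simp
  qed
  show "c = 0" if "q powi c = 1" for c using generic_root[of "2 * c"] that vq by simp
  show "q powi c * zprod z k l \<noteq> 1" if kl: "k < l" "l \<le> n" for k l c
  proof
    assume e: "q powi c * zprod z k l = 1"
    \<comment> \<open>Telescoping gives z_{k,l} = q^(-(l-k)) v^(2(lambda_l - lambda_k)), kept here
      free of division.\<close>
    have zp: "zprod z k l * ((vl k)\<^sup>2 * q ^ (l - k)) = (vl l)\<^sup>2"
      using kl
    proof (induction l)
      case (Suc l)
      have s: "zprod z k (Suc l) = zprod z k l * z (Suc l)" if "k \<le> l"
        using that by (simp add: zprod_def prod.nat_ivl_Suc')
      have zl: "z (Suc l) * ((vl l)\<^sup>2 * q) = (vl (Suc l))\<^sup>2"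
        using zi[of "Suc l"] generic_vl[of l] generic_v Suc.prems by (simp add: q field_simps)
      show ?case
      proof (cases "k = l")
        case True
        then show ?thesis using s zl by (simp add: zprod_def)
      next
        case False
        then have "k < l" using Suc.prems by simp
        then have IH: "zprod z k l * ((vl k)\<^sup>2 * q ^ (l - k)) = (vl l)\<^sup>2" using Suc by simp
        have "Suc l - k = Suc (l - k)" using \<open>k < l\<close> by simp
        then have "zprod z k (Suc l) * ((vl k)\<^sup>2 * q ^ (Suc l - k)) = (zprod z k l * ((vl k)\<^sup>2 * q ^ (l - k))) * z (Suc l) * q"
          using s \<open>k < l\<close> by (simp add: mult_ac)
        then show ?thesis unfolding IH using zl by (simp add: mult_ac)
      qed
    qed simp
    have "(vl k)\<^sup>2 * q ^ (l - k) = q powi c * (vl l)\<^sup>2"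
      using e zp by (metis mult.assoc mult.left_neutral)
    moreover have "q ^ (l - k) = v ^ (2 * (l - k))" by (simp add: q power_mult)
    ultimately have A: "v ^ (2 * (l - k)) * (vl k)\<^sup>2 = v powi (2 * c) * (vl l)\<^sup>2"
      by (simp only: vq mult.commute)
    \<comment> \<open>Splitting 2c into its positive and negative parts clears the negative exponent
      and leaves an equality of two genuine monomials.\<close>
    have "v powi (2 * c) * v ^ nat (- (2 * c)) = v ^ nat (2 * c)"
      using generic_v by (cases "c \<ge> 0") (simp_all add: power_int_def power_inverse)
    then have "v ^ nat (2 * c) * (vl l)\<^sup>2 = v ^ nat (- (2 * c)) * (v powi (2 * c) * (vl l)\<^sup>2)"
      by (simp only: mult_ac)
    also have "\<dots> = v ^ (2 * (l - k) + nat (- (2 * c))) * (vl k)\<^sup>2"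
      unfolding A[symmetric] by (simp only: power_add mult_ac)
    finally have "v ^ (2 * (l - k) + nat (- (2 * c))) * (vl k)\<^sup>2 = v ^ nat (2 * c) * (vl l)\<^sup>2" ..
    then show False using generic_powers[of k l] kl by simp
  qed
qed

end

theorem proposition2p2:
  fixes n :: nat and d :: "nat \<Rightarrow> nat"
    and v q :: "'a::field_char_0" and vl z :: "nat \<Rightarrow> 'a"
    and scale :: "'a \<Rightarrow> 'm::ab_group_add \<Rightarrow> 'm" and act :: "'a free_poly set \<Rightarrow> 'm \<Rightarrow> 'm"
    and hw :: 'm and \<theta> :: "weight \<Rightarrow> 'm"
    and scale' :: "'a \<Rightarrow> 'k::ab_group_add \<Rightarrow> 'k" and act' :: "'a free_poly set \<Rightarrow> 'k \<Rightarrow> 'k"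
    and hw' :: 'k and \<theta>' :: "weight \<Rightarrow> 'k"
    and \<sigma> :: "'a free_poly set \<Rightarrow> 'a free_poly set" and B :: "'m \<Rightarrow> 'k \<Rightarrow> 'a"
  assumes "n \<ge> 1"
    and "generic_weight n v vl"
    and "verma_module scale n v act vl hw"
    and "verma_module scale' n (inverse v) act' (\<lambda>k. inverse (vl k)) hw'"
    and "whittaker_vector n v vl scale act hw \<theta>"
    and "whittaker_vector n (inverse v) (\<lambda>k. inverse (vl k)) scale' act' hw' \<theta>'"
    and "shapovalov_anti_iso n v \<sigma>"
    and "shapovalov_pairing n v \<sigma> scale act hw scale' act' hw' B"
    and "q = v ^ 2"
    and "\<And>i. i \<in> {1..n} \<Longrightarrow> z i = z_var n v vl i"
  shows "whittaker_J n v vl B \<theta> \<theta>' d =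
    (\<Sum>m \<in> arrays n d.
       (- 1) powi ((\<Sum>i=1..n. int (d i)) - (\<Sum>i<n. int (m i i)))
       * q powi p_exp n m
       * (\<Prod>j=1..n. z j ^ (\<Sum>k<j. \<Sum>i=j+1..n. m k (i - 1)))
       * (\<Prod>(k, i) \<in> {(k, i). k < i \<and> i \<le> n}.
            1 / qpoch q q (m k (i - 1) - m k i))
       * (\<Prod>(k, l, i) \<in> {(k, l, i). k < l \<and> l < i \<and> i \<le> n}.
            1 / qpoch q (q powi (int (m k i) - int (m l (i - 1))) * zprod z k l)
                  (m k (i - 1) - m k i))
       * (\<Prod>(k, l, i) \<in> {(k, l, i). k < l \<and> l \<le> i \<and> i \<le> n}.
            1 / qpoch q (q powi (int (m k i) - int (m l i) + 1) * zprod z k l)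
                  (m k (i - 1) - m k i)))"
proof -
  have gt: "gt_model n q z"
    by (rule gt_model_generic[OF assms(2,9,10)])
  interpret whittaker_pairing scale n v act vl hw q z scale' act' hw' \<theta> \<theta>' \<sigma> B
    by (intro whittaker_pairing.intro verma_gt.intro verma_gt_axioms.intro whittaker_pairing_axioms.intro
        gt assms generic_v[OF assms(2)] generic_vl[OF assms(2)])
  show ?thesis
    unfolding J_eq_sum_summand by (intro sum.cong refl summand_arrays)
qed

end
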